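(* Let $u\in C^\infty(\mathbb{R}^2;\mathbb{R}^2)$ satisfy $$-\Delta u=u(1-|u|^2)\quad\text{in }\mathbb{R}^2$$ and $$|u(x)|\to 1\quad\text{as }|x|\to\infty .$$ Then $$\int_{\mathbb{R}^2}(1-|u|^2)^2\,\mathrm{d}x<\infty .$$
   Context: Here $|\cdot|$ is the Euclidean norm on $\mathbb{R}^2$, and $\Delta$ acts componentwise on the vector-valued map $u$. *)

theory Defs
  imports "HOL-Analysis.Analysis"
begin

definition pderivative :: "'n \<Rightarrow> (real ^ 'n \<Rightarrow> 'b::real_normed_vector) \<Rightarrow> real ^ 'n \<Rightarrow> 'b"
  where "pderivative i f x = frechet_derivative f (at x) (axis i 1)"

text \<open>Class \<open>C\<^sup>k\<close> on the whole space. Total differentiability is demanded at each stage so that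
  \<^const>\<open>frechet_derivative\<close> is never evaluated where it is arbitrary; it is
  implied by continuity of the first partial derivatives, so this is the usual notion.\<close>

fun Ck :: "nat \<Rightarrow> (real ^ 'n \<Rightarrow> 'b::real_normed_vector) \<Rightarrow> bool"
  where
    "Ck 0 f \<longleftrightarrow> continuous_on UNIV f"
  | "Ck (Suc k) f \<longleftrightarrow> (\<forall>x. f differentiable (at x)) \<and> (\<forall>i. Ck k (pderivative i f))"

definition C_infinity :: "(real ^ 'n \<Rightarrow> 'b::real_normed_vector) \<Rightarrow> bool"
  where "C_infinity f \<longleftrightarrow> (\<forall>k. Ck k f)"

definition laplacian :: "(real ^ 'n \<Rightarrow> real) \<Rightarrow> real ^ 'n \<Rightarrow> real"
  where "laplacian f x = (\<Sum>i\<in>UNIV. pderivative i (pderivative i f) x)"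

definition vec_laplacian :: "(real ^ 'n \<Rightarrow> real ^ 'm) \<Rightarrow> real ^ 'n \<Rightarrow> real ^ 'm"
  where "vec_laplacian u x = (\<chi> j. laplacian (\<lambda>y. u y $ j) x)"

end

theory Submission
  imports Defs
begin

text \<open>
  Regard \<open>u\<close> as a complex function and write \<open>\<nabla>u / u = s + \<i> v\<close> outside a large disc; thus \<open>s\<close> and \<open>v\<close>
  are the gradients of the logarithm of the modulus and of the (possibly multivalued) phase. Bernstein
  estimates give \<open>\<nabla>u, \<nabla>\<^sup>2u \<rightarrow> 0\<close>. The field \<open>v\<close> is single-valued and curl-free, with the small divergence
  \<open>-2 s \<bullet> v\<close>, so that \<open>v\<^sub>1 - \<i> v\<^sub>2\<close> is almost holomorphic, while \<open>s\<close> is a massive field driven by \<open>v \<bullet> \<nabla>v\<close>.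
  Since a holomorphic function that vanishes at infinity decays like \<open>1/r\<close>, one expects almost this decay
  for \<open>v\<close>, and then \<open>1 - |u|\<^sup>2 \<approx> |v|\<^sup>2\<close> is square integrable.

  To make this precise, put \<open>r = exp t\<close> and integrate over circles. The flux \<open>Q = \<integral> (v\<^sub>2 \<partial>\<theta> v\<^sub>1 - v\<^sub>1 \<partial>\<theta> v\<^sub>2) d\<theta>\<close>
  satisfies \<open>Q' \<approx> a\<close> and, by Wirtinger's inequality, \<open>2 |Q| \<le> a\<close> approximately, where
  \<open>a = r\<^sup>2 \<integral> |\<nabla>v|\<^sup>2 d\<theta>\<close>. Hence \<open>-Q\<close> either becomes negative and grows, which contradicts \<open>v \<rightarrow> 0\<close>, or decays
  almost like \<open>exp (-2 t)\<close>.
\<close>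

section \<open>Gradients in the plane\<close>

text \<open>The integral is finite once the circle integrals of \<open>(1 - |u|^2)^2\<close> decay
  faster than \<open>exp (-2 t)\<close>, because the area element is
  \<open>exp (2 t) dt d\<theta>\<close>. The obstacle is that \<open>a\<close> is never bounded
  pointwise: the flux argument only bounds \<open>exp (m t) * a\<close> by minus a derivative. Every
  later inequality must therefore consume \<open>a\<close> as a derivative. This is why the decay of
  \<open>A\<close> comes from a bootstrap, and why the second-order inequality for \<open>X\<close>
  is split into two first-order ones. The rates arise as follows. The error terms lower the ideal
  flux rate 2 to 9/5. The bootstrap turns a rate \<open>\<alpha>\<close> of \<open>A\<close> into
  \<open>9/10 + \<alpha>/2\<close>, and three rounds from 0 give 63/40. Then
  \<open>exp (2 t) * A^2\<close> has rate 63/20 - 2 = 23/20, and inverting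
  \<open>X' + exp t * X\<close> gains one more factor \<open>exp (-t)\<close>, which gives 43/20 >
  2.\<close>

lemma pderivative_bounded_linear:
  fixes f :: "real ^ 'n \<Rightarrow> 'b::real_normed_vector" and L :: "'b \<Rightarrow> 'c::real_normed_vector"
  assumes L: "bounded_linear L" and f: "f differentiable (at x)"
  shows "pderivative i (\<lambda>y. L (f y)) x = L (pderivative i f x)"
proof -
  have "((\<lambda>y. L (f y)) has_derivative (\<lambda>h. L (frechet_derivative f (at x) h))) (at x)"
    using bounded_linear.has_derivative[OF L] f frechet_derivative_works by blast
  then show ?thesis
    unfolding pderivative_def using frechet_derivative_at by metis
qed

lemma Ck_bounded_linear:
  fixes f :: "real ^ 'n \<Rightarrow> 'b::real_normed_vector" and L :: "'b \<Rightarrow> 'c::real_normed_vector"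
  assumes L: "bounded_linear L"
  shows "Ck k f \<Longrightarrow> Ck k (\<lambda>y. L (f y))"
proof (induction k arbitrary: f)
  case 0
  then show ?case
    using continuous_on_compose2[OF bounded_linear.continuous_on[OF L continuous_on_id]] by force
next
  case (Suc k)
  have "(\<lambda>y. L (f y)) differentiable (at x)" for x
  proof -
    obtain D where "(f has_derivative D) (at x)"
      using Suc.prems unfolding Ck.simps differentiable_def by blast
    from bounded_linear.has_derivative[OF L this] show ?thesis unfolding differentiable_def by blast
  qed
  moreover have "pderivative i (\<lambda>y. L (f y)) = (\<lambda>y. L (pderivative i f y))" for i
    using pderivative_bounded_linear[OF L, of f] Suc.prems by (intro ext) simp
  ultimately show ?case using Suc by simp
qed

lemma C_infinity_bounded_linear:
  fixes f :: "real ^ 'n \<Rightarrow> 'b::real_normed_vector" and L :: "'b \<Rightarrow> 'c::real_normed_vector"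
  assumes "bounded_linear L" "C_infinity f"
  shows "C_infinity (\<lambda>y. L (f y))"
  using Ck_bounded_linear assms unfolding C_infinity_def by blast

lemma C_infinity_pderivative:
  "C_infinity f \<Longrightarrow> C_infinity (pderivative i f)"
  unfolding C_infinity_def by (metis Ck.simps(2))

lemma C_infinity_differentiable:
  "C_infinity f \<Longrightarrow> f differentiable (at x)"
  unfolding C_infinity_def by (metis Ck.simps(2))

lemma C_infinity_continuous: "C_infinity f \<Longrightarrow> continuous_on UNIV f"
  unfolding C_infinity_def by (metis Ck.simps(1))

text \<open>Total differentiability bundled with the two partial derivatives as explicit terms, so
  that the calculus rules compose by resolution. \<open>C_infinity_has_grad\<close> and
  \<open>has_grad_pderivative\<close> translate from and to \<open>pderivative\<close>.\<close>

definition has_grad ::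
  "(real ^ 2 \<Rightarrow> 'b::real_normed_vector) \<Rightarrow> 'b \<Rightarrow> 'b \<Rightarrow> real ^ 2 \<Rightarrow> bool"
  where "has_grad f p q x \<longleftrightarrow> (f has_derivative (\<lambda>h. (h $ 1) *\<^sub>R p + (h $ 2) *\<^sub>R q)) (at x)"

lemma C_infinity_has_grad:
  assumes "C_infinity f"
  shows "has_grad f (pderivative 1 f x) (pderivative 2 f x) x"
proof -
  let ?D = "frechet_derivative f (at x)"
  have D: "(f has_derivative ?D) (at x)"
    using C_infinity_differentiable[OF assms] frechet_derivative_works by blast
  have "?D h = (h $ 1) *\<^sub>R pderivative 1 f x + (h $ 2) *\<^sub>R pderivative 2 f x" for h
  proof -
    have lin: "linear ?D" using D has_derivative_bounded_linear bounded_linear.linear by blast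
    have "h = (h $ 1) *\<^sub>R axis 1 1 + (h $ 2) *\<^sub>R axis 2 1"
      by (simp add: vec_eq_iff forall_2 axis_def)
    then have "?D h = ?D ((h $ 1) *\<^sub>R axis 1 1 + (h $ 2) *\<^sub>R axis 2 1)" by simp
    then show ?thesis unfolding pderivative_def
      using linear_add[OF lin] linear_cmul[OF lin] by simp
  qed
  then have "?D = (\<lambda>h. (h $ 1) *\<^sub>R pderivative 1 f x + (h $ 2) *\<^sub>R pderivative 2 f x)" by blast
  with D show ?thesis unfolding has_grad_def by simp
qed

lemma has_grad_pderivative:
  assumes "has_grad f p q x"
  shows "pderivative 1 f x = p" "pderivative 2 f x = q"
proof -
  have "frechet_derivative f (at x) = (\<lambda>h. (h $ 1) *\<^sub>R p + (h $ 2) *\<^sub>R q)"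
    using frechet_derivative_at[OF assms[unfolded has_grad_def]] by simp
  then show "pderivative 1 f x = p" "pderivative 2 f x = q"
    unfolding pderivative_def by (auto simp: axis_def)
qed

lemma has_grad_const: "has_grad (\<lambda>_. c) 0 0 x"
  unfolding has_grad_def by simp

lemma
  assumes "has_grad f p q x"
  shows has_grad_minus: "has_grad (\<lambda>y. - f y) (- p) (- q) x"
    and has_grad_add: "has_grad g p' q' x \<Longrightarrow> has_grad (\<lambda>y. f y + g y) (p + p') (q + q') x"
    and has_grad_diff: "has_grad g p' q' x \<Longrightarrow> has_grad (\<lambda>y. f y - g y) (p - p') (q - q') x"
  using assms unfolding has_grad_def by (auto intro!: derivative_eq_intros simp: algebra_simps)

lemma has_grad_mult:
  fixes f g :: "real ^ 2 \<Rightarrow> 'b::real_normed_algebra"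
  shows "has_grad f p q x \<Longrightarrow> has_grad g p' q' x \<Longrightarrow>
    has_grad (\<lambda>y. f y * g y) (f x * p' + p * g x) (f x * q' + q * g x) x"
  unfolding has_grad_def by (auto intro!: derivative_eq_intros simp: algebra_simps)

lemma has_grad_inverse:
  fixes f :: "real ^ 2 \<Rightarrow> 'b::real_normed_field"
  shows "has_grad f p q x \<Longrightarrow> f x \<noteq> 0 \<Longrightarrow>
    has_grad (\<lambda>y. inverse (f y)) (- p / (f x)^2) (- q / (f x)^2) x"
  unfolding has_grad_def
  by (auto intro!: derivative_eq_intros simp: field_simps power2_eq_square scaleR_conv_of_real)

lemma has_grad_divide:
  fixes f g :: "real ^ 2 \<Rightarrow> 'b::real_normed_field"
  assumes "has_grad f p q x" "has_grad g p' q' x" "g x \<noteq> 0"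
  shows "has_grad (\<lambda>y. f y / g y) (p / g x - f x * p' / (g x)^2) (q / g x - f x * q' / (g x)^2) x"
  using has_grad_mult[OF assms(1) has_grad_inverse[OF assms(2,3)]]
  by (simp add: divide_inverse algebra_simps)

lemma has_grad_linear:
  assumes "bounded_linear L" "has_grad f p q x"
  shows "has_grad (\<lambda>y. L (f y)) (L p) (L q) x"
  using bounded_linear.has_derivative[OF assms(1) assms(2)[unfolded has_grad_def]]
  unfolding has_grad_def
  by (simp add: linear_add[OF bounded_linear.linear] linear_cmul[OF bounded_linear.linear] assms(1))

lemmas has_grad_Re = has_grad_linear[OF bounded_linear_Re]
lemmas has_grad_Im = has_grad_linear[OF bounded_linear_Im]

lemma has_grad_eq:
  "has_grad f p q x \<Longrightarrow> p = p' \<Longrightarrow> q = q' \<Longrightarrow> has_grad f p' q' x"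
  by simp

lemma has_grad_continuous: "has_grad f p q x \<Longrightarrow> isCont f x"
  unfolding has_grad_def by (rule has_derivative_continuous)

lemma has_grad_compose:
  assumes "has_grad f p q (vector [X t, Y t])"
    and X: "(X has_real_derivative X') (at t)" and Y: "(Y has_real_derivative Y') (at t)"
  shows "((\<lambda>t. f (vector [X t, Y t])) has_vector_derivative X' *\<^sub>R p + Y' *\<^sub>R q) (at t)"
proof -
  have v: "vector [a, b] = a *\<^sub>R axis 1 1 + b *\<^sub>R (axis 2 1 :: real ^ 2)" for a b
    by (simp add: vec_eq_iff forall_2 axis_def)
  have "((\<lambda>t. vector [X t, Y t] :: real ^ 2) has_derivative
      (\<lambda>h. vector [h * X', h * Y'])) (at t)"
    unfolding v using X Y by (auto intro!: derivative_eq_intros simp: has_field_derivative_def mult.commute)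
  from has_derivative_compose[OF this] assms(1)
  have "((\<lambda>t. f (vector [X t, Y t])) has_derivative (\<lambda>h. (h * X') *\<^sub>R p + (h * Y') *\<^sub>R q)) (at t)"
    unfolding has_grad_def by fastforce
  then show ?thesis unfolding has_vector_derivative_def
    by (simp add: scaleR_add_right)
qed

lemma has_grad_scaleR:
  fixes f :: "real ^ 2 \<Rightarrow> real" and g :: "real ^ 2 \<Rightarrow> 'b::real_normed_vector"
  shows "has_grad f p q x \<Longrightarrow> has_grad g p' q' x \<Longrightarrow>
    has_grad (\<lambda>y. f y *\<^sub>R g y) (f x *\<^sub>R p' + p *\<^sub>R g x) (f x *\<^sub>R q' + q *\<^sub>R g x) x"
  unfolding has_grad_def by (auto intro!: derivative_eq_intros simp: algebra_simps)

lemma has_grad_inner: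
  fixes f g :: "real ^ 2 \<Rightarrow> 'b::real_inner"
  shows "has_grad f p q x \<Longrightarrow> has_grad g p' q' x \<Longrightarrow>
    has_grad (\<lambda>y. f y \<bullet> g y) (f x \<bullet> p' + p \<bullet> g x) (f x \<bullet> q' + q \<bullet> g x) x"
  unfolding has_grad_def by (auto intro!: derivative_eq_intros simp: algebra_simps inner_add_right inner_add_left)

lemma has_grad_sum_list:
  assumes "\<And>h. h \<in> set hs \<Longrightarrow> has_grad (f h) (p h) (q h) x"
  shows "has_grad (\<lambda>y. \<Sum>h\<leftarrow>hs. f h y) (\<Sum>h\<leftarrow>hs. p h) (\<Sum>h\<leftarrow>hs. q h) x"
  using assms by (induction hs) (auto intro!: has_grad_const has_grad_add)

lemma has_grad_square_sum:
  assumes "has_grad f p q x" "has_grad g p' q' x"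
  shows "has_grad (\<lambda>x. (f x :: real)^2 + (g x)^2) (2 * (f x * p + g x * p')) (2 * (f x * q + g x * q')) x"
  unfolding power2_eq_square
  by (rule has_grad_eq[OF has_grad_add[OF has_grad_mult[OF assms(1) assms(1)] has_grad_mult[OF assms(2) assms(2)]]])
    (simp_all add: algebra_simps)

lemma has_grad_pairing:
  assumes "has_grad f1 p q x" "has_grad g1 r u x" "has_grad f2 p' q' x" "has_grad g2 r' u' x"
  shows "has_grad (\<lambda>x. 2 * (f1 x * g1 x + f2 x * g2 x) :: real)
    (2 * (f1 x * r + p * g1 x + (f2 x * r' + p' * g2 x))) (2 * (f1 x * u + q * g1 x + (f2 x * u' + q' * g2 x))) x"
  by (rule has_grad_linear[OF bounded_linear_mult_right has_grad_add[OF has_grad_mult[OF assms(1,2)] has_grad_mult[OF assms(3,4)]]])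

lemma has_grad_coord: "has_grad (\<lambda>x. x $ 1) 1 0 (x :: real ^ 2)" "has_grad (\<lambda>x. x $ 2) 0 1 (x :: real ^ 2)"
  unfolding has_grad_def by (auto intro!: derivative_eq_intros bounded_linear.has_derivative[OF bounded_linear_vec_nth])

lemma has_grad_axis:
  fixes g :: "real ^ 2 \<Rightarrow> real"
  assumes "has_grad g p q (vector [s, r])"
  shows "((\<lambda>s. g (vector [s, r])) has_real_derivative p) (at s)"
    and "((\<lambda>r. g (vector [s, r])) has_real_derivative q) (at r)"
  using has_grad_compose[of g p q "\<lambda>s. s" s "\<lambda>_. r" 1 0] has_grad_compose[of g p q "\<lambda>_. s" r "\<lambda>r. r" 0 1] assms
  by (auto simp: has_real_derivative_iff_has_vector_derivative)

lemma vector_2_eta: "vector [x $ 1, x $ 2] = (x :: real ^ 2)"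
  by (simp add: vec_eq_iff forall_2)

text \<open>The second difference of \<open>f\<close> over a small square is \<open>h * h\<close>
  times a value of \<open>p2\<close> in the square and also \<open>h * h\<close> times a value of
  \<open>q1\<close> there: the mean value theorem is applied twice, in either order of the
  variables. Continuity at \<open>x\<close> forces the two limits to agree.\<close>

lemma mixed_partials_real:
  fixes f p q :: "real ^ 2 \<Rightarrow> real"
  assumes f: "\<And>y. has_grad f (p y) (q y) y"
    and p: "\<And>y. has_grad p (p1 y) (p2 y) y" and q: "\<And>y. has_grad q (q1 y) (q2 y) y"
    and c: "isCont p2 x" "isCont q1 x"
  shows "p2 x = q1 x"
proof (rule ccontr)
  assume ne: "p2 x \<noteq> q1 x"
  define e where "e = \<bar>p2 x - q1 x\<bar> / 2"
  have e: "e > 0" using ne unfolding e_def by simp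
  obtain d where d: "d > 0" "\<And>y. dist y x < d \<Longrightarrow> \<bar>p2 y - p2 x\<bar> < e" "\<And>y. dist y x < d \<Longrightarrow> \<bar>q1 y - q1 x\<bar> < e"
  proof -
    obtain d1 where "d1 > 0" "\<And>y. dist y x < d1 \<Longrightarrow> \<bar>p2 y - p2 x\<bar> < e"
      using c(1) e unfolding continuous_at_eps_delta dist_real_def by blast
    moreover obtain d2 where "d2 > 0" "\<And>y. dist y x < d2 \<Longrightarrow> \<bar>q1 y - q1 x\<bar> < e"
      using c(2) e unfolding continuous_at_eps_delta dist_real_def by blast
    ultimately show ?thesis using that[of "min d1 d2"] by auto
  qed
  \<comment> \<open>A third of \<open>d\<close> suffices because the distance is estimated by the
    sum of the two coordinate offsets, which stays below \<open>2 * h\<close>.\<close>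
  define a b h where "a = x $ 1" and "b = x $ 2" and "h = d / 3"
  have h: "h > 0" unfolding h_def using d by simp
  have near: "dist (vector [s, r]) x < d" if "a < s" "s < a + h" "b < r" "r < b + h" for s r
  proof -
    have "dist (vector [s, r]) x \<le> \<bar>s - a\<bar> + \<bar>r - b\<bar>"
      unfolding dist_norm a_def b_def using norm_le_l1_cart[of "vector [s, r] - x"] by (simp add: sum_2)
    then show ?thesis using that h unfolding h_def by linarith
  qed
  note d1 = has_grad_axis(1) and d2 = has_grad_axis(2)
  define D where "D = f (vector [a + h, b + h]) - f (vector [a + h, b]) - (f (vector [a, b + h]) - f (vector [a, b]))"
  have "\<exists>s r. a < s \<and> s < a + h \<and> b < r \<and> r < b + h \<and> D = h * h * p2 (vector [s, r])"
  proof -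
    obtain s where s: "a < s" "s < a + h" 
      and D1: "D = h * (p (vector [s, b + h]) - p (vector [s, b]))"
      using MVT2[of a "a + h" "\<lambda>s. f (vector [s, b + h]) - f (vector [s, b])" "\<lambda>s. p (vector [s, b + h]) - p (vector [s, b])"]
        DERIV_diff[OF d1[OF f] d1[OF f]] h unfolding D_def by auto
    obtain r where "b < r" "r < b + h" "p (vector [s, b + h]) - p (vector [s, b]) = h * p2 (vector [s, r])"
      using MVT2[of b "b + h" "\<lambda>r. p (vector [s, r])" "\<lambda>r. p2 (vector [s, r])"] d2[OF p] h by auto
    then show ?thesis using s D1 by (metis mult.assoc)
  qed
  then obtain s r where 1: "a < s" "s < a + h" "b < r" "r < b + h" "D = h * h * p2 (vector [s, r])" by blast
  have "\<exists>s r. a < s \<and> s < a + h \<and> b < r \<and> r < b + h \<and> D = h * h * q1 (vector [s, r])"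
  proof -
    obtain r where r: "b < r" "r < b + h" 
      and D1: "D = h * (q (vector [a + h, r]) - q (vector [a, r]))"
      using MVT2[of b "b + h" "\<lambda>r. f (vector [a + h, r]) - f (vector [a, r])" "\<lambda>r. q (vector [a + h, r]) - q (vector [a, r])"]
        DERIV_diff[OF d2[OF f] d2[OF f]] h unfolding D_def by auto
    obtain s where "a < s" "s < a + h" "q (vector [a + h, r]) - q (vector [a, r]) = h * q1 (vector [s, r])"
      using MVT2[of a "a + h" "\<lambda>s. q (vector [s, r])" "\<lambda>s. q1 (vector [s, r])"] d1[OF q] h by auto
    then show ?thesis using r D1 by (metis mult.assoc)
  qed
  then obtain s' r' where 2: "a < s'" "s' < a + h" "b < r'" "r' < b + h" "D = h * h * q1 (vector [s', r'])" by blast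
  have "p2 (vector [s, r]) = q1 (vector [s', r'])" using 1(5) 2(5) h by simp
  moreover have "\<bar>p2 (vector [s, r]) - p2 x\<bar> < e" using d(2) near 1 by blast
  moreover have "\<bar>q1 (vector [s', r']) - q1 x\<bar> < e" using d(3) near 2 by blast
  moreover have "\<bar>p2 x - q1 x\<bar> \<le> \<bar>z - p2 x\<bar> + \<bar>z - q1 x\<bar>" for z by linarith
  ultimately show False using e_def by (smt (verit) field_sum_of_halves)
qed

text \<open>The mean value theorem needs real values, so the real and imaginary parts are treated
  separately.\<close>

lemma mixed_partials:
  fixes f :: "real ^ 2 \<Rightarrow> complex"
  assumes f: "C_infinity f"
  shows "pderivative 2 (pderivative 1 f) = pderivative 1 (pderivative 2 f)"
proof
  fix x
  have *: "L (pderivative 2 (pderivative 1 f) x) = L (pderivative 1 (pderivative 2 f) x)"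
    if L: "bounded_linear L" for L :: "complex \<Rightarrow> real"
  proof (rule mixed_partials_real[where f = "\<lambda>y. L (f y)" and x = x
        and p = "\<lambda>y. L (pderivative 1 f y)" and q = "\<lambda>y. L (pderivative 2 f y)"
        and ?p1.0 = "\<lambda>y. L (pderivative 1 (pderivative 1 f) y)" and ?p2.0 = "\<lambda>y. L (pderivative 2 (pderivative 1 f) y)"
        and ?q1.0 = "\<lambda>y. L (pderivative 1 (pderivative 2 f) y)" and ?q2.0 = "\<lambda>y. L (pderivative 2 (pderivative 2 f) y)"])
    show "has_grad (\<lambda>y. L (f y)) (L (pderivative 1 f y)) (L (pderivative 2 f y)) y" for y
      by (rule has_grad_linear[OF L C_infinity_has_grad[OF f]])
    show "has_grad (\<lambda>y. L (pderivative 1 f y)) (L (pderivative 1 (pderivative 1 f) y)) (L (pderivative 2 (pderivative 1 f) y)) y"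
      "has_grad (\<lambda>y. L (pderivative 2 f y)) (L (pderivative 1 (pderivative 2 f) y)) (L (pderivative 2 (pderivative 2 f) y)) y" for y
      by (rule has_grad_linear[OF L C_infinity_has_grad[OF C_infinity_pderivative[OF f]]])+
    have "isCont (pderivative i (pderivative j f)) x" for i j
      using C_infinity_continuous[OF C_infinity_pderivative[OF C_infinity_pderivative[OF f]]]
      by (simp add: continuous_on_eq_continuous_at)
    then show "isCont (\<lambda>x. L (pderivative 2 (pderivative 1 f) x)) x" "isCont (\<lambda>x. L (pderivative 1 (pderivative 2 f) x)) x"
      using bounded_linear.continuous[OF L] by auto
  qed
  show "pderivative 2 (pderivative 1 f) x = pderivative 1 (pderivative 2 f) x"
    using *[OF bounded_linear_Re] *[OF bounded_linear_Im] by (rule complex_eqI)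
qed

section \<open>Bernstein estimates\<close>

text \<open>If \<open>f2\<close> were positive, \<open>f'\<close> would be positive just to the
  right of its zero \<open>z\<close>, and \<open>f\<close> would exceed its maximum there.\<close>

lemma second_derivative_local_max:
  fixes f f' :: "real \<Rightarrow> real"
  assumes f: "\<And>s. (f has_real_derivative f' s) (at s)"
    and f': "(f' has_real_derivative f2) (at z)"
    and d: "d > 0" "\<And>s. \<bar>z - s\<bar> < d \<Longrightarrow> f s \<le> f z"
  shows "f2 \<le> 0"
proof (rule ccontr)
  assume "\<not> f2 \<le> 0"
  then have "f2 > 0" by simp
  have 0: "f' z = 0" using DERIV_local_max[OF f d(1)] d(2) by blast
  obtain e where e: "e > 0" "\<And>h. 0 < h \<Longrightarrow> h < e \<Longrightarrow> f' z < f' (z + h)"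
    using DERIV_pos_inc_right[OF f' \<open>f2 > 0\<close>] by blast
  define h where "h = min d e / 2"
  have h: "0 < h" "h < d" "h < e" unfolding h_def using d e by auto
  obtain s where s: "z < s" "s < z + h" "f (z + h) - f z = (z + h - z) * f' s"
    using MVT2[of z "z + h" f f'] f h by auto
  have "f' s > 0" using e(2)[of "s - z"] s h 0 by auto
  then have "f (z + h) > f z" using s(3) h by (simp add: algebra_simps)
  moreover have "f (z + h) \<le> f z" using d(2)[of "z + h"] h by auto
  ultimately show False by simp
qed

lemma cutoff_second_derivative:
  fixes p g :: "real \<Rightarrow> real"
  assumes p: "\<And>s. (p has_real_derivative p1 s) (at s)" "\<And>s. (p1 has_real_derivative p2 s) (at s)"
    and g: "\<And>s. (g has_real_derivative g1 s) (at s)" "\<And>s. (g1 has_real_derivative g2 s) (at s)"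
    and F: "\<And>s. F s = (1 - ((s - a)^2 + c))^2 * p s + K * g s + \<kappa> * ((s - a)^2 + c)"
    and d: "d > 0" "\<And>s. \<bar>z - s\<bar> < d \<Longrightarrow> F s \<le> F z"
  shows "8 * (z - a)^2 * p z - 4 * (1 - ((z - a)^2 + c)) * p z - 8 * (1 - ((z - a)^2 + c)) * (z - a) * p1 z
    + (1 - ((z - a)^2 + c))^2 * p2 z + K * g2 z + 2 * \<kappa> \<le> 0"
proof (rule second_derivative_local_max[where f = F and z = z and d = d])
  show "(F has_real_derivative
     (- 4 * (1 - ((s - a)^2 + c)) * (s - a) * p s + (1 - ((s - a)^2 + c))^2 * p1 s + K * g1 s + 2 * \<kappa> * (s - a))) (at s)" for s
    unfolding F by (auto intro!: derivative_eq_intros p g simp: algebra_simps power2_eq_square)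
  show "((\<lambda>s. - 4 * (1 - ((s - a)^2 + c)) * (s - a) * p s + (1 - ((s - a)^2 + c))^2 * p1 s + K * g1 s + 2 * \<kappa> * (s - a))
    has_real_derivative 8 * (z - a)^2 * p z - 4 * (1 - ((z - a)^2 + c)) * p z - 8 * (1 - ((z - a)^2 + c)) * (z - a) * p1 z
    + (1 - ((z - a)^2 + c))^2 * p2 z + K * g2 z + 2 * \<kappa>) (at z)"
    by (auto intro!: derivative_eq_intros p g simp: algebra_simps power2_eq_square)
qed (use d in auto)

text \<open>Maximum principle for \<open>\<zeta>\<^sup>2 P + K g + \<kappa> |y - x|\<^sup>2\<close> with the cutoff \<open>\<zeta> = 1 - |y - x|\<^sup>2\<close>: the constant
  \<open>K\<close> lets \<open>\<Delta>g\<close> absorb the terms of order \<open>P\<close> that the cutoff produces.\<close>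

lemma bernstein:
  fixes P g :: "real ^ 2 \<Rightarrow> real"
  assumes P: "\<And>y. has_grad P (P1 y) (P2 y) y" "\<And>y. has_grad P1 (P11 y) (P12 y) y" "\<And>y. has_grad P2 (P21 y) (P22 y) y"
    and g: "\<And>y. has_grad g (g1 y) (g2 y) y" "\<And>y. has_grad g1 (g11 y) (g12 y) y" "\<And>y. has_grad g2 (g21 y) (g22 y) y"
    and nonneg: "\<And>y. 0 \<le> P y" "\<And>y. 0 \<le> T y" and grad: "\<And>y. (P1 y)^2 + (P2 y)^2 \<le> 4 * P y * T y"
    and C: "0 \<le> C" "0 < \<delta>"
    and lapP: "\<And>y. dist x y < 1 \<Longrightarrow> P11 y + P22 y \<ge> 2 * T y - C * (P y + \<delta>)"
    and lapg: "\<And>y. dist x y < 1 \<Longrightarrow> g11 y + g22 y \<ge> P y - \<delta>"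
    and gM: "\<And>y. dist x y \<le> 1 \<Longrightarrow> g y \<le> M"
  shows "P x \<le> (2 * C + 40) * (M - g x + \<delta>)"
proof -
  \<comment> \<open>At an interior maximum the terms of order \<open>P\<close> cost at most
    \<open>C\<close> from \<open>lapP\<close>, 8 from the second derivatives of the cutoff and 32
    from the cross term. The Laplacian \<open>4 * \<kappa>\<close> of the quadratic term outweighs
    the remaining errors \<open>(C + K) * \<delta>\<close>.\<close>
  define K where "K = C + 40"
  define \<kappa> where "\<kappa> = (C + K) * \<delta>"
  have K: "K > 0" "\<kappa> > 0" unfolding \<kappa>_def K_def using C by (auto intro!: mult_pos_pos)
  define a b where "a = x $ 1" and "b = x $ 2"
  define D where "D y = (y $ 1 - a)^2 + (y $ 2 - b)^2" for y :: "real ^ 2"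
  have D: "D y = (dist x y)^2" for y
    unfolding D_def a_def b_def dist_norm norm_vec_def L2_set_def 
    by (simp add: sum_2 power2_commute)
  define F where "F y = (1 - D y)^2 * P y + K * g y + \<kappa> * D y" for y
  have cont: "continuous_on UNIV P" "continuous_on UNIV g"
    using P(1) g(1) by (auto intro!: continuous_at_imp_continuous_on has_grad_continuous)
  have "continuous_on (cball x 1) F"
    unfolding F_def D_def
    by (intro continuous_intros continuous_on_subset[OF cont(1)] continuous_on_subset[OF cont(2)]) auto
  then obtain z where z: "z \<in> cball x 1" "\<And>y. y \<in> cball x 1 \<Longrightarrow> F y \<le> F z"
    using continuous_attains_sup[of "cball x 1" F] by auto
  have Dx: "D x = 0" unfolding D by simp
  \<comment> \<open>An interior maximum would give \<open>\<kappa> \<le> 0\<close>. On the bounding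
    circle the cutoff vanishes, so only \<open>K * g + \<kappa>\<close> remains there.\<close>
  have "dist x z \<ge> 1"
  proof (rule ccontr)
    assume "\<not> dist x z \<ge> 1"
    then have z1: "dist x z < 1" by simp
    define d where "d = 1 - dist x z"
    have d: "d > 0" unfolding d_def using z1 by simp
    define r q where "r = z $ 1" and "q = z $ 2"
    have zrq: "vector [r, q] = z" unfolding r_def q_def by (rule vector_2_eta)
    have near: "F y \<le> F z" if "dist z y < d" for y
      using z(2)[of y] that dist_triangle[of x y z] unfolding d_def by auto
    have Fv: "F (vector [s, t]) = (1 - ((s - a)^2 + (t - b)^2))^2 * P (vector [s, t]) + K * g (vector [s, t]) + \<kappa> * ((s - a)^2 + (t - b)^2)" for s t
      unfolding F_def D_def by simp
    have dv: "dist z (vector [s, q]) = \<bar>r - s\<bar>" "dist z (vector [r, t]) = \<bar>q - t\<bar>" for s t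
      unfolding zrq[symmetric] dist_norm norm_vec_def L2_set_def by (auto simp: sum_2)
    let ?\<zeta> = "1 - D z"
    have D': "D z = (r - a)^2 + (q - b)^2" unfolding D_def r_def q_def ..
    have A1: "8 * (r - a)^2 * P z - 4 * ?\<zeta> * P z - 8 * ?\<zeta> * (r - a) * P1 z + ?\<zeta>^2 * P11 z + K * g11 z + 2 * \<kappa> \<le> 0"
      using cutoff_second_derivative[where F = "\<lambda>s. F (vector [s, q])" and a = a and c = "(q - b)^2" and z = r and d = d
          and K = K and \<kappa> = \<kappa>, OF has_grad_axis(1)[OF P(1)] has_grad_axis(1)[OF P(2)] has_grad_axis(1)[OF g(1)] has_grad_axis(1)[OF g(2)] Fv d]
      unfolding zrq D' using near dv by auto
    have A2: "8 * (q - b)^2 * P z - 4 * ?\<zeta> * P z - 8 * ?\<zeta> * (q - b) * P2 z + ?\<zeta>^2 * P22 z + K * g22 z + 2 * \<kappa> \<le> 0"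
    proof -
      have Fv2: "F (vector [r, t]) = (1 - ((t - b)^2 + (r - a)^2))^2 * P (vector [r, t]) + K * g (vector [r, t]) + \<kappa> * ((t - b)^2 + (r - a)^2)" for t
        unfolding Fv by (simp add: add.commute)
      have mx: "F (vector [r, t]) \<le> F (vector [r, q])" if "\<bar>q - t\<bar> < d" for t
        using near dv that unfolding zrq by auto
      show ?thesis
        using cutoff_second_derivative[where F = "\<lambda>t. F (vector [r, t])" and a = b and c = "(r - a)^2" and z = q and d = d
            and K = K and \<kappa> = \<kappa>, OF has_grad_axis(2)[OF P(1)] has_grad_axis(2)[OF P(3)] has_grad_axis(2)[OF g(1)] has_grad_axis(2)[OF g(3)] Fv2 d mx]
        unfolding zrq D' by (simp add: add.commute)
    qed
    define m where "m = (r - a) * P1 z + (q - b) * P2 z"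
    have \<zeta>: "0 \<le> ?\<zeta>" "?\<zeta> \<le> 1" "0 \<le> D z" "D z \<le> 1"
      unfolding D using z1 by (auto simp: power_le_one)
    have m2: "m^2 \<le> 4 * D z * P z * T z"
    proof -
      have "m^2 \<le> D z * ((P1 z)^2 + (P2 z)^2)"
        unfolding m_def D' using sum_squares_bound[of "(r - a) * P2 z" "(q - b) * P1 z"]
        by (simp add: power2_eq_square algebra_simps)
      also have "\<dots> \<le> D z * (4 * P z * T z)" using \<zeta> grad by (intro mult_left_mono) auto
      finally show ?thesis by (simp add: algebra_simps)
    qed
    \<comment> \<open>The inequality \<open>4 v w \<le> (v + w)^2\<close>, with the weights chosen
      so that the \<open>T\<close> part is exactly the good term \<open>2 * T\<close> that
      \<open>lapP\<close> provides.\<close>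
    have "\<bar>8 * ?\<zeta> * m\<bar> \<le> \<bar>2 * ?\<zeta>^2 * T z + 32 * D z * P z\<bar>"
    proof (subst abs_le_square_iff)
      have "(8 * ?\<zeta> * m)^2 = 64 * ?\<zeta>^2 * m^2" by (simp only: power_mult_distrib) simp
      also have "\<dots> \<le> 64 * ?\<zeta>^2 * (4 * D z * P z * T z)" using m2 by (intro mult_left_mono) auto
      also have "\<dots> = 4 * (2 * ?\<zeta>^2 * T z) * (32 * D z * P z)" by simp
      also have "\<dots> \<le> (2 * ?\<zeta>^2 * T z + 32 * D z * P z)^2"
      proof -
        have "4 * v * w \<le> (v + w)^2" for v w :: real
          using sum_squares_bound[of v w] by (simp add: power2_sum)
        then show ?thesis .
      qed
      finally show "(8 * ?\<zeta> * m)^2 \<le> (2 * ?\<zeta>^2 * T z + 32 * D z * P z)^2" .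
    qed
    moreover have "0 \<le> 2 * ?\<zeta>^2 * T z + 32 * D z * P z" using \<zeta> nonneg by simp
    ultimately have m3: "8 * ?\<zeta> * m \<le> 2 * ?\<zeta>^2 * T z + 32 * D z * P z" by linarith
    have lP: "?\<zeta>^2 * (2 * T z - C * (P z + \<delta>)) \<le> ?\<zeta>^2 * (P11 z + P22 z)"
      using lapP[OF z1] by (intro mult_left_mono) auto
    have lP': "?\<zeta>^2 * (C * (P z + \<delta>)) \<le> C * (P z + \<delta>)"
      using C nonneg(1)[of z] \<zeta> by (intro mult_left_le_one_le) (auto simp: power_le_one)
    have DP: "D z * P z \<le> P z" "?\<zeta> * P z \<le> P z" "0 \<le> D z * P z"
      using \<zeta> nonneg(1)[of z] by (auto intro!: mult_left_le_one_le)
    have lg: "K * (P z - \<delta>) \<le> K * (g11 z + g22 z)"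
      using lapg[OF z1] K by (intro mult_left_mono) auto
    have sum: "8 * (D z * P z) - 8 * (?\<zeta> * P z) - 8 * ?\<zeta> * m + ?\<zeta>^2 * (P11 z + P22 z) + K * (g11 z + g22 z) + 4 * \<kappa> \<le> 0"
    proof -
      have "8 * (D z * P z) - 8 * (?\<zeta> * P z) - 8 * ?\<zeta> * m + ?\<zeta>^2 * (P11 z + P22 z) + K * (g11 z + g22 z) + 4 * \<kappa>
        = (8 * (r - a)^2 * P z - 4 * ?\<zeta> * P z - 8 * ?\<zeta> * (r - a) * P1 z + ?\<zeta>^2 * P11 z + K * g11 z + 2 * \<kappa>)
        + (8 * (q - b)^2 * P z - 4 * ?\<zeta> * P z - 8 * ?\<zeta> * (q - b) * P2 z + ?\<zeta>^2 * P22 z + K * g22 z + 2 * \<kappa>)"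
        unfolding m_def by (simp add: D' algebra_simps)
      then show ?thesis using A1 A2 by linarith
    qed
    have "?\<zeta>^2 * (2 * T z - C * (P z + \<delta>)) = 2 * ?\<zeta>^2 * T z - ?\<zeta>^2 * (C * (P z + \<delta>))" 
      by (simp add: algebra_simps)
    moreover have "C * (P z + \<delta>) = C * P z + C * \<delta>" "K * (P z - \<delta>) = C * P z + 40 * P z - K * \<delta>"
      "\<kappa> = C * \<delta> + K * \<delta>"
      unfolding K_def \<kappa>_def by (auto simp: algebra_simps)
    ultimately have "\<kappa> \<le> 0"
      using sum m3 lP lP' lg DP nonneg(1)[of z] K(2) by linarith
    then show False using K by simp
  qed
  then have "dist x z = 1" using z by auto
  then have Dz: "D z = 1" unfolding D by simp
  have "P x + K * g x = F x" unfolding F_def Dx by simp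
  also have "\<dots> \<le> F z" using z(2)[of x] by simp
  also have "\<dots> = K * g z + \<kappa>" unfolding F_def Dz by simp
  also have "\<dots> \<le> K * M + \<kappa>" using gM[of z] z K by (auto intro!: mult_left_mono)
  finally have "P x \<le> K * (M - g x) + (C + K) * \<delta>" unfolding \<kappa>_def by (simp add: algebra_simps)
  also have "K * (M - g x) \<le> (C + K) * (M - g x)"
    using gM[of x] C by (intro mult_right_mono) auto
  finally show ?thesis unfolding K_def by (simp add: algebra_simps)
qed

section \<open>Solutions of the Ginzburg--Landau equation\<close>

abbreviation pd :: "2 \<Rightarrow> (real ^ 2 \<Rightarrow> 'b::real_normed_vector) \<Rightarrow> real ^ 2 \<Rightarrow> 'b" where "pd \<equiv> pderivative"
abbreviation D1 :: "(real ^ 2 \<Rightarrow> 'b::real_normed_vector) \<Rightarrow> real ^ 2 \<Rightarrow> 'b" where "D1 \<equiv> pderivative 1"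
abbreviation D2 :: "(real ^ 2 \<Rightarrow> 'b::real_normed_vector) \<Rightarrow> real ^ 2 \<Rightarrow> 'b" where "D2 \<equiv> pderivative 2"

definition Lap :: "(real ^ 2 \<Rightarrow> 'b::real_normed_vector) \<Rightarrow> real ^ 2 \<Rightarrow> 'b"
  where "Lap f y = D1 (D1 f) y + D2 (D2 f) y"

section \<open>Bernstein's method for finite families of complex functions\<close>

lemma Cauchy_Schwarz_sum_list:
  fixes f g :: "'a \<Rightarrow> real"
  shows "(\<Sum>h\<leftarrow>hs. f h * g h)^2 \<le> (\<Sum>h\<leftarrow>hs. (f h)^2) * (\<Sum>h\<leftarrow>hs. (g h)^2)"
  using Cauchy_Schwarz_ineq_sum[of "\<lambda>i. f (hs ! i)" "\<lambda>i. g (hs ! i)" "{0..<length hs}"]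
  by (simp add: sum_list_sum_nth)

lemma Cauchy_Schwarz_inner_list:
  fixes f g :: "'a \<Rightarrow> complex"
  shows "(\<Sum>h\<leftarrow>hs. f h \<bullet> g h)^2 \<le> (\<Sum>h\<leftarrow>hs. f h \<bullet> f h) * (\<Sum>h\<leftarrow>hs. g h \<bullet> g h)"
proof -
  have "\<bar>\<Sum>h\<leftarrow>hs. f h \<bullet> g h\<bar> \<le> (\<Sum>h\<leftarrow>hs. norm (f h) * norm (g h))"
  proof (induction hs)
    case (Cons h hs)
    then show ?case using Cauchy_Schwarz_ineq2[of "f h" "g h"] by simp
  qed simp
  moreover have "0 \<le> (\<Sum>h\<leftarrow>hs. norm (f h) * norm (g h))"
    by (induction hs) auto
  ultimately have "(\<Sum>h\<leftarrow>hs. f h \<bullet> g h)^2 \<le> (\<Sum>h\<leftarrow>hs. norm (f h) * norm (g h))^2"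
    by (subst abs_le_square_iff[symmetric]) simp
  also have "\<dots> \<le> (\<Sum>h\<leftarrow>hs. (norm (f h))^2) * (\<Sum>h\<leftarrow>hs. (norm (g h))^2)"
    by (rule Cauchy_Schwarz_sum_list)
  finally show ?thesis by (simp add: power2_norm_eq_inner)
qed

lemma square_sum_derivatives:
  fixes hs :: "(real ^ 2 \<Rightarrow> complex) list"
  assumes sm: "\<And>h. h \<in> set hs \<Longrightarrow> C_infinity h"
  shows "has_grad (\<lambda>y. \<Sum>h\<leftarrow>hs. h y \<bullet> h y) (2 * (\<Sum>h\<leftarrow>hs. h y \<bullet> D1 h y)) (2 * (\<Sum>h\<leftarrow>hs. h y \<bullet> D2 h y)) y"
    and "has_grad (\<lambda>y. 2 * (\<Sum>h\<leftarrow>hs. h y \<bullet> pd i h y))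
       (2 * (\<Sum>h\<leftarrow>hs. h y \<bullet> D1 (pd i h) y + D1 h y \<bullet> pd i h y))
       (2 * (\<Sum>h\<leftarrow>hs. h y \<bullet> D2 (pd i h) y + D2 h y \<bullet> pd i h y)) y"
proof -
  have gr: "has_grad h (D1 h y) (D2 h y) y" "has_grad (pd i h) (D1 (pd i h) y) (D2 (pd i h) y) y"
    if "h \<in> set hs" for h
    using C_infinity_has_grad[OF sm[OF that]] C_infinity_has_grad[OF C_infinity_pderivative[OF sm[OF that]]] by auto
  show "has_grad (\<lambda>y. \<Sum>h\<leftarrow>hs. h y \<bullet> h y) (2 * (\<Sum>h\<leftarrow>hs. h y \<bullet> D1 h y)) (2 * (\<Sum>h\<leftarrow>hs. h y \<bullet> D2 h y)) y"
    by (rule has_grad_eq[OF has_grad_sum_list[OF has_grad_inner[OF gr(1) gr(1)]]])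
      (auto simp: inner_commute sum_list_addf sum_list_const_mult)
  have "has_grad (\<lambda>y. \<Sum>h\<leftarrow>hs. h y \<bullet> pd i h y)
       (\<Sum>h\<leftarrow>hs. h y \<bullet> D1 (pd i h) y + D1 h y \<bullet> pd i h y)
       (\<Sum>h\<leftarrow>hs. h y \<bullet> D2 (pd i h) y + D2 h y \<bullet> pd i h y) y"
    by (rule has_grad_sum_list[OF has_grad_inner[OF gr(1) gr(2)]])
  from has_grad_linear[OF bounded_linear_mult_right this, of 2]
  show "has_grad (\<lambda>y. 2 * (\<Sum>h\<leftarrow>hs. h y \<bullet> pd i h y))
       (2 * (\<Sum>h\<leftarrow>hs. h y \<bullet> D1 (pd i h) y + D1 h y \<bullet> pd i h y))
       (2 * (\<Sum>h\<leftarrow>hs. h y \<bullet> D2 (pd i h) y + D2 h y \<bullet> pd i h y)) y" .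
qed

text \<open>\<open>bernstein\<close> with \<open>P\<close> the sum of \<open>|h|^2\<close>,
  \<open>T\<close> the sum of \<open>|grad h|^2\<close> and \<open>g\<close> half the sum of
  \<open>|k|^2\<close>. In the applications \<open>hs\<close> lists the first derivatives of
  \<open>ks\<close>; \<open>hk\<close> keeps only the consequence that matters, namely that the
  Laplacian of \<open>g\<close> is \<open>P\<close> plus the sum of
  \<open>k \<bullet> Lap k\<close>.\<close>

lemma bernstein_family:
  fixes ks hs :: "(real ^ 2 \<Rightarrow> complex) list"
  assumes sm: "\<And>h. h \<in> set hs \<Longrightarrow> C_infinity h" "\<And>k. k \<in> set ks \<Longrightarrow> C_infinity k"
    and C: "0 \<le> C" "0 < \<delta>"
    and hk: "\<And>y. (\<Sum>h\<leftarrow>hs. h y \<bullet> h y) = (\<Sum>k\<leftarrow>ks. D1 k y \<bullet> D1 k y + D2 k y \<bullet> D2 k y)"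
    and lap_h: "\<And>y. dist x y < 1 \<Longrightarrow> 2 * (\<Sum>h\<leftarrow>hs. h y \<bullet> Lap h y) \<ge> - C * ((\<Sum>h\<leftarrow>hs. h y \<bullet> h y) + \<delta>)"
    and lap_k: "\<And>y. dist x y < 1 \<Longrightarrow> (\<Sum>k\<leftarrow>ks. k y \<bullet> Lap k y) \<ge> - \<delta>"
    and M: "\<And>y. dist x y \<le> 1 \<Longrightarrow> (\<Sum>k\<leftarrow>ks. k y \<bullet> k y) \<le> 2 * M"
  shows "(\<Sum>h\<leftarrow>hs. h x \<bullet> h x) \<le> (2 * C + 40) * (M - (\<Sum>k\<leftarrow>ks. k x \<bullet> k x) / 2 + \<delta>)"
proof -
  define T where "T y = (\<Sum>h\<leftarrow>hs. D1 h y \<bullet> D1 h y) + (\<Sum>h\<leftarrow>hs. D2 h y \<bullet> D2 h y)" for y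
  have nonneg: "0 \<le> (\<Sum>h\<leftarrow>hs. f h \<bullet> f h)" for f :: "_ \<Rightarrow> complex"
    by (induction hs) auto
  note half = has_grad_linear[OF bounded_linear_mult_right[of "1/2::real"]]
  note g = half[OF square_sum_derivatives(1)[OF sm(2)]]
    half[OF square_sum_derivatives(2)[OF sm(2), of ks 1]] half[OF square_sum_derivatives(2)[OF sm(2), of ks 2]]
  have "(\<Sum>h\<leftarrow>hs. h x \<bullet> h x) \<le> (2 * C + 40) * (M - 1/2 * (\<Sum>k\<leftarrow>ks. k x \<bullet> k x) + \<delta>)"
  proof (rule bernstein[where T = T and C = C and \<delta> = \<delta> and x = x and M = M,
        OF square_sum_derivatives(1)[OF sm(1)] square_sum_derivatives(2)[OF sm(1)]
          square_sum_derivatives(2)[OF sm(1)] g])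
    fix y
    show "0 \<le> (\<Sum>h\<leftarrow>hs. h y \<bullet> h y)" by (rule nonneg)
    show "0 \<le> T y" unfolding T_def by (intro add_nonneg_nonneg nonneg)
    show "(2 * (\<Sum>h\<leftarrow>hs. h y \<bullet> D1 h y))^2 + (2 * (\<Sum>h\<leftarrow>hs. h y \<bullet> D2 h y))^2 \<le> 4 * (\<Sum>h\<leftarrow>hs. h y \<bullet> h y) * T y"
      using Cauchy_Schwarz_inner_list[of "\<lambda>h. h y" "\<lambda>h. D1 h y" hs] Cauchy_Schwarz_inner_list[of "\<lambda>h. h y" "\<lambda>h. D2 h y" hs]
      unfolding T_def by (simp add: power_mult_distrib distrib_left)
    assume y: "dist x y < 1"
    show "2 * T y - C * ((\<Sum>h\<leftarrow>hs. h y \<bullet> h y) + \<delta>)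
      \<le> 2 * (\<Sum>h\<leftarrow>hs. h y \<bullet> D1 (D1 h) y + D1 h y \<bullet> D1 h y) + 2 * (\<Sum>h\<leftarrow>hs. h y \<bullet> D2 (D2 h) y + D2 h y \<bullet> D2 h y)"
      using lap_h[OF y] unfolding T_def Lap_def by (simp add: sum_list_addf inner_add_right)
    show "(\<Sum>h\<leftarrow>hs. h y \<bullet> h y) - \<delta> \<le> 1/2 * (2 * (\<Sum>k\<leftarrow>ks. k y \<bullet> D1 (D1 k) y + D1 k y \<bullet> D1 k y))
      + 1/2 * (2 * (\<Sum>k\<leftarrow>ks. k y \<bullet> D2 (D2 k) y + D2 k y \<bullet> D2 k y))"
      using lap_k[OF y] unfolding hk Lap_def by (simp add: sum_list_addf inner_add_right add_divide_distrib)
  next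
    fix y assume "dist x y \<le> 1"
    then show "1/2 * (\<Sum>k\<leftarrow>ks. k y \<bullet> k y) \<le> M" using M[of y] by simp
  qed (use C in auto)
  then show ?thesis by simp
qed

locale ginzburg_landau =
  fixes U :: "real ^ 2 \<Rightarrow> complex"
  assumes smooth: "C_infinity U"
    and equation: "\<And>x. Lap U x = - ((1 - (norm (U x))^2) *\<^sub>R U x)"
    and limit: "((\<lambda>x. norm (U x)) \<longlongrightarrow> 1) at_infinity"
begin

abbreviation "grad_sq x \<equiv> D1 U x \<bullet> D1 U x + D2 U x \<bullet> D2 U x"

abbreviation "hess_sq x \<equiv> D1 (D1 U) x \<bullet> D1 (D1 U) x + D2 (D1 U) x \<bullet> D2 (D1 U) x
    + D1 (D2 U) x \<bullet> D1 (D2 U) x + D2 (D2 U) x \<bullet> D2 (D2 U) x"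

definition "\<xi> x = 1 - (norm (U x))^2"

section \<open>Differentiated equation and decay of the gradient\<close>

lemma smooth': "C_infinity (D1 U)" "C_infinity (D2 U)"
    "C_infinity (pd i (D1 U))" "C_infinity (pd i (D2 U))"
  using smooth by (auto intro!: C_infinity_pderivative)

lemma mixed: "D2 (D1 U) = D1 (D2 U)" "D2 (D1 (pd i U)) = D1 (D2 (pd i U))"
  by (intro mixed_partials smooth C_infinity_pderivative)+

lemma grad: "has_grad U (D1 U x) (D2 U x) x"
   "has_grad (pd i U) (D1 (pd i U) x) (D2 (pd i U) x) x"
   "has_grad (pd i (pd j U)) (D1 (pd i (pd j U)) x) (D2 (pd i (pd j U)) x) x"
  using smooth by (auto intro!: C_infinity_has_grad C_infinity_pderivative)

lemma Lap_U: "Lap U = (\<lambda>x. - (\<xi> x *\<^sub>R U x))"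
  using equation unfolding \<xi>_def by auto

lemma grad_\<xi>: "has_grad \<xi> (- 2 * (U x \<bullet> D1 U x)) (- 2 * (U x \<bullet> D2 U x)) x"
proof -
  have "\<xi> = (\<lambda>x. 1 - U x \<bullet> U x)" unfolding \<xi>_def by (simp add: power2_norm_eq_inner)
  then show ?thesis
    by (auto intro!: has_grad_eq[OF has_grad_diff[OF has_grad_const has_grad_inner[OF grad(1) grad(1)]]]
        simp: inner_commute)
qed

definition "dLap i x = (2 * (U x \<bullet> pd i U x)) *\<^sub>R U x - \<xi> x *\<^sub>R pd i U x"

lemma pderivative_Lap: "D1 (Lap U) = dLap 1" "D2 (Lap U) = dLap 2"
proof -
  have "has_grad (\<lambda>x. - (\<xi> x *\<^sub>R U x)) (dLap 1 x) (dLap 2 x) x" for x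
    unfolding dLap_def
    by (auto intro!: has_grad_eq[OF has_grad_minus[OF has_grad_scaleR[OF grad_\<xi> grad(1)]]])
  then show "D1 (Lap U) = dLap 1" "D2 (Lap U) = dLap 2"
    unfolding Lap_U by (auto intro!: ext has_grad_pderivative)
qed

text \<open>Partial derivatives commute with the Laplacian by \<open>mixed\<close>, so these are
  derivatives of the right side of the equation.\<close>

lemma Lap_derivatives: "Lap (D1 U) = dLap 1" "Lap (D2 U) = dLap 2"
proof -
  have L: "pd i (Lap U) x = pd i (D1 (D1 U)) x + pd i (D2 (D2 U)) x" if "i = 1 \<or> i = 2" for i x
  proof -
    have "has_grad (\<lambda>y. D1 (D1 U) y + D2 (D2 U) y)
      (D1 (D1 (D1 U)) x + D1 (D2 (D2 U)) x) (D2 (D1 (D1 U)) x + D2 (D2 (D2 U)) x) x"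
      by (intro has_grad_add grad)
    from has_grad_pderivative[OF this] that
    show ?thesis unfolding Lap_def[abs_def] by auto
  qed
  show "Lap (D1 U) = dLap 1"
    unfolding pderivative_Lap(1)[symmetric] by (rule ext) (simp add: L Lap_def mixed)
  show "Lap (D2 U) = dLap 2"
    unfolding pderivative_Lap(2)[symmetric] by (rule ext) (simp add: L Lap_def mixed(1,2)[symmetric])
qed

lemma \<xi>_tendsto: "(\<xi> \<longlongrightarrow> 0) at_infinity"
proof -
  have "((\<lambda>x. 1 - (norm (U x))^2) \<longlongrightarrow> 1 - 1^2) at_infinity"
    by (intro tendsto_intros limit)
  then show ?thesis unfolding \<xi>_def by simp
qed

lemma eventually_unit_ball:
  fixes Q :: "real ^ 2 \<Rightarrow> bool"
  assumes "eventually Q at_infinity"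
  shows "eventually (\<lambda>x. \<forall>y. dist x y \<le> 1 \<longrightarrow> Q y) at_infinity"
proof -
  obtain b where b: "\<And>x. norm x \<ge> b \<Longrightarrow> Q x" using assms unfolding eventually_at_infinity by blast
  show ?thesis unfolding eventually_at_infinity
  proof (intro exI allI impI)
    fix x y :: "real ^ 2" assume "b + 1 \<le> norm x" "dist x y \<le> 1"
    then show "Q y" using b[of y] norm_triangle_ineq2[of x "x - y"] unfolding dist_norm by simp
  qed
qed

lemma U_dLap: "U x \<bullet> Lap U x = - \<xi> x * (norm (U x))^2" 
  unfolding Lap_U by (simp add: power2_norm_eq_inner)

lemma dLap_inner: "pd i U x \<bullet> dLap i x = 2 * (U x \<bullet> pd i U x)^2 - \<xi> x * (pd i U x \<bullet> pd i U x)"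
  unfolding dLap_def by (simp add: inner_diff_right power2_eq_square inner_commute)

text \<open>Bernstein bounds the squared gradient at \<open>x\<close> by the oscillation of
  \<open>|U|^2\<close> on the unit disc around \<open>x\<close>, plus the size of
  \<open>\<xi>\<close> there, and both vanish at infinity because \<open>|U|\<close> tends to 1. The
  result is 42 * 3 d = 126 d.\<close>

lemma gradient_tendsto_0:
  "((\<lambda>x. grad_sq x) \<longlongrightarrow> 0) at_infinity"
proof (rule tendstoI)
  fix e :: real assume e: "e > 0"
  define d where "d = min (1/2) (e / 200)"
  have d: "0 < d" "d \<le> 1/2" "d * 200 \<le> e" unfolding d_def using e by auto
  have "eventually (\<lambda>x. \<bar>\<xi> x\<bar> < d) at_infinity"
    using tendstoD[OF \<xi>_tendsto d(1)] by simp
  from eventually_unit_ball[OF this]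
  show "\<forall>\<^sub>F x in at_infinity. dist (grad_sq x) 0 < e"
  proof eventually_elim
    case (elim x)
    then have \<xi>: "\<bar>\<xi> y\<bar> < d" if "dist x y \<le> 1" for y using that by blast
    have xx: "\<bar>\<xi> x\<bar> < d" using \<xi>[of x] by simp
    have "(\<Sum>h\<leftarrow>[D1 U, D2 U]. h x \<bullet> h x) \<le> (2 * 1 + 40) * ((1 + d) / 2 - (\<Sum>k\<leftarrow>[U]. k x \<bullet> k x) / 2 + 2 * d)"
    proof (rule bernstein_family)
      fix y assume y: "dist x y < 1"
      then have y1: "\<bar>\<xi> y\<bar> < d" using \<xi>[of y] by simp
      have "\<xi> y * (pd i U y \<bullet> pd i U y) \<le> 1/2 * (pd i U y \<bullet> pd i U y)" for i
        using y1 d by (intro mult_right_mono) auto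
      note half = this
      have arith: "- 1 * (A + (B + 0) + 2 * d) \<le> 2 * (2 * p - a + (2 * q - b + 0))"
        if "a \<le> 1/2 * A" "b \<le> 1/2 * B" "0 \<le> p" "0 \<le> q" for A B a b p q
        using that d(1) by (simp add: algebra_simps)
      show "- 1 * ((\<Sum>h\<leftarrow>[D1 U, D2 U]. h y \<bullet> h y) + 2 * d) \<le> 2 * (\<Sum>h\<leftarrow>[D1 U, D2 U]. h y \<bullet> Lap h y)"
        unfolding Lap_derivatives list.map sum_list.Cons sum_list.Nil dLap_inner
        by (intro arith half zero_le_power2)
      have "(norm (U y))^2 = 1 - \<xi> y" unfolding \<xi>_def by simp
      then have n: "(norm (U y))^2 \<le> 2" using y1 d by linarith
      have "\<xi> y * (norm (U y))^2 \<le> \<bar>\<xi> y\<bar> * 2"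
        using n by (intro mult_mono) auto
      then show "- (2 * d) \<le> (\<Sum>k\<leftarrow>[U]. k y \<bullet> Lap k y)"
        using y1 by (simp add: U_dLap)
    next
      fix y assume "dist x y \<le> 1"
      then show "(\<Sum>k\<leftarrow>[U]. k y \<bullet> k y) \<le> 2 * ((1 + d) / 2)"
        using \<xi>[of y] unfolding \<xi>_def power2_norm_eq_inner by simp
    qed (use d smooth smooth' in auto)
    also have "(1 + d) / 2 - (\<Sum>k\<leftarrow>[U]. k x \<bullet> k x) / 2 + 2 * d \<le> 3 * d"
      using xx unfolding \<xi>_def power2_norm_eq_inner by (auto simp: abs_less_iff field_simps)
    finally have "grad_sq x \<le> 126 * d" by simp
    also have "\<dots> < e" using d by linarith
    finally show ?case by simp
  qed
qed


section \<open>Decay of the second derivatives\<close>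

definition "ddLap j i x = (2 * (U x \<bullet> pd i U x)) *\<^sub>R pd j U x
  + (2 * (U x \<bullet> pd j (pd i U) x + pd j U x \<bullet> pd i U x)) *\<^sub>R U x
  - (\<xi> x *\<^sub>R pd j (pd i U) x + (- 2 * (U x \<bullet> pd j U x)) *\<^sub>R pd i U x)"

lemma pderivative_dLap: "D1 (dLap i) = ddLap 1 i" "D2 (dLap i) = ddLap 2 i"
proof -
  have "has_grad (dLap i) (ddLap 1 i x) (ddLap 2 i x) x" for x
    unfolding dLap_def[abs_def] ddLap_def
    by (intro has_grad_diff has_grad_scaleR grad grad_\<xi> has_grad_linear[OF bounded_linear_mult_right] has_grad_inner)
  then show "D1 (dLap i) = ddLap 1 i" "D2 (dLap i) = ddLap 2 i"
    by (auto intro!: ext has_grad_pderivative)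
qed

lemma Lap_second_derivatives:
  "Lap (D1 (D1 U)) = ddLap 1 1" "Lap (D2 (D1 U)) = ddLap 2 1" "Lap (D1 (D2 U)) = ddLap 1 2" "Lap (D2 (D2 U)) = ddLap 2 2"
proof -
  have smooth'': "C_infinity (pd i U)" for i by (rule C_infinity_pderivative[OF smooth])
  have L: "pd j (Lap (pd i U)) x = pd j (D1 (D1 (pd i U))) x + pd j (D2 (D2 (pd i U))) x"
    if "j = 1 \<or> j = 2" for i j x
  proof -
    have "has_grad (\<lambda>y. D1 (D1 (pd i U)) y + D2 (D2 (pd i U)) y)
      (D1 (D1 (D1 (pd i U))) x + D1 (D2 (D2 (pd i U))) x)
      (D2 (D1 (D1 (pd i U))) x + D2 (D2 (D2 (pd i U))) x) x"
      by (intro has_grad_add C_infinity_has_grad C_infinity_pderivative smooth)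
    from has_grad_pderivative[OF this] that
    show ?thesis unfolding Lap_def[abs_def] by auto
  qed
  have m: "D2 (D1 (D1 (pd i U))) = D1 (D1 (D2 (pd i U)))" "D1 (D2 (D2 (pd i U))) = D2 (D2 (D1 (pd i U)))" for i
    using mixed_partials[OF smooth''[of i]] mixed_partials[OF C_infinity_pderivative[OF smooth''[of i]]] by metis+
  have 1: "D1 (Lap (pd i U)) = Lap (D1 (pd i U))" and 2: "D2 (Lap (pd i U)) = Lap (D2 (pd i U))" for i
    by (auto simp: L Lap_def m intro!: ext)
  show "Lap (D1 (D1 U)) = ddLap 1 1" "Lap (D2 (D1 U)) = ddLap 2 1" "Lap (D1 (D2 U)) = ddLap 1 2" "Lap (D2 (D2 U)) = ddLap 2 2"
    unfolding 1[symmetric] 2[symmetric] Lap_derivatives pderivative_dLap by simp_all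
qed

text \<open>The three trilinear terms are each at most \<open>2 * d^2 * |h|\<close>, hence at most
  \<open>d^4 + |h|^2\<close>, where \<open>h\<close> is the second derivative. The term
  \<open>2 * (u \<bullet> h)^2\<close> has the good sign, and the \<open>\<xi>\<close> term costs
  another half of \<open>|h|^2\<close>. The factor 2 in front of each product gives 6, and 6 + 1/2
  is rounded up to 7.\<close>

lemma ddLap_inner:
  assumes "norm (U x) \<le> 2" "\<bar>\<xi> x\<bar> \<le> 1/2"
    "norm (pd i U x) \<le> d" "norm (pd j U x) \<le> d" 
  shows "pd j (pd i U) x \<bullet> ddLap j i x \<ge>
    - (7 * (pd j (pd i U) x \<bullet> pd j (pd i U) x) + 6 * d^4)"
proof -
  define h a b u where "h = pd j (pd i U) x" and "a = pd i U x"
    and "b = pd j U x" and "u = U x"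
  have n: "norm u \<le> 2" "norm a \<le> d" "norm b \<le> d" using assms unfolding u_def a_def b_def by auto
  have d0: "0 \<le> d" using n(2) norm_ge_zero[of a] by linarith
  have exp: "h \<bullet> ddLap j i x = 2 * (u \<bullet> a) * (h \<bullet> b) + 2 * (u \<bullet> h)^2 + 2 * (b \<bullet> a) * (h \<bullet> u) - \<xi> x * (h \<bullet> h) + 2 * (u \<bullet> b) * (h \<bullet> a)"
    unfolding ddLap_def h_def a_def b_def u_def
    by (simp add: inner_add_right inner_diff_right inner_commute power2_eq_square algebra_simps)
  have e: "\<bar>(p \<bullet> q) * (h \<bullet> r)\<bar> \<le> 2 * (d * d) * norm h" if "norm p * norm q * norm r \<le> 2 * (d * d)" for p q r
  proof -
    have "\<bar>(p \<bullet> q) * (h \<bullet> r)\<bar> \<le> (norm p * norm q) * (norm h * norm r)"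
      unfolding abs_mult by (intro mult_mono Cauchy_Schwarz_ineq2) auto
    also have "\<dots> = (norm p * norm q * norm r) * norm h" by simp
    also have "\<dots> \<le> 2 * (d * d) * norm h" using that by (intro mult_right_mono) auto
    finally show ?thesis .
  qed
  have t: "norm u * norm a * norm b \<le> 2 * (d * d)"
    unfolding mult.assoc using n d0 by (intro mult_mono) auto
  have "\<bar>(u \<bullet> a) * (h \<bullet> b)\<bar> \<le> 2 * (d * d) * norm h" "\<bar>(b \<bullet> a) * (h \<bullet> u)\<bar> \<le> 2 * (d * d) * norm h"
     "\<bar>(u \<bullet> b) * (h \<bullet> a)\<bar> \<le> 2 * (d * d) * norm h"
    by (rule e, use t in \<open>simp add: mult_ac\<close>)+
  moreover have "2 * (d * d) * norm h \<le> d^4 + h \<bullet> h"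
    using sum_squares_bound[of "d * d" "norm h"] by (simp add: power2_norm_eq_inner power4_eq_xxxx power2_eq_square[of "d * d"] mult.assoc)
  moreover have "\<xi> x * (h \<bullet> h) \<le> 1/2 * (h \<bullet> h)"
    using assms(2) by (intro mult_right_mono) auto
  moreover have "- (7 * H + 6 * D) \<le> 2 * p + 2 * s + 2 * q - z + 2 * r"
    if "\<bar>p\<bar> \<le> w" "\<bar>q\<bar> \<le> w" "\<bar>r\<bar> \<le> w" "w \<le> D + H" "z \<le> 1/2 * H" "0 \<le> H" "0 \<le> s" for p q r s w z D H :: real
    using that by (simp add: algebra_simps)
  ultimately have "- (7 * (h \<bullet> h) + 6 * d^4) \<le> 2 * ((u \<bullet> a) * (h \<bullet> b)) + 2 * (u \<bullet> h)^2 + 2 * ((b \<bullet> a) * (h \<bullet> u)) - \<xi> x * (h \<bullet> h) + 2 * ((u \<bullet> b) * (h \<bullet> a))"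
    by (meson inner_ge_zero zero_le_power2)
  then show ?thesis using exp unfolding h_def by (simp add: mult.assoc)
qed

text \<open>The same argument one derivative higher: the oscillation of the squared gradient is now
  small by \<open>gradient_tendsto_0\<close>. Each first derivative is at most
  \<open>sqrt d\<close>, so \<open>d^4\<close> in \<open>ddLap_inner\<close> becomes
  \<open>d * d\<close>, which \<open>\<delta> = 2 * d\<close> absorbs.\<close>

lemma second_gradient_tendsto_0:
  "((\<lambda>x. hess_sq x) \<longlongrightarrow> 0) at_infinity"
proof (rule tendstoI)
  fix e :: real assume e: "e > 0"
  define d where "d = min (1/2) (e / 400)"
  have d: "0 < d" "d \<le> 1/2" "d * 400 \<le> e" unfolding d_def using e by auto
  have "eventually (\<lambda>x. \<bar>\<xi> x\<bar> < d) at_infinity"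
    using tendstoD[OF \<xi>_tendsto d(1)] by simp
  moreover have "eventually (\<lambda>x. \<bar>grad_sq x\<bar> < d) at_infinity"
    using tendstoD[OF gradient_tendsto_0 d(1)] by simp
  ultimately have "eventually (\<lambda>x. \<bar>\<xi> x\<bar> < d \<and> \<bar>grad_sq x\<bar> < d) at_infinity"
    by (rule eventually_conj)
  from eventually_unit_ball[OF this]
  show "\<forall>\<^sub>F x in at_infinity. dist (hess_sq x) 0 < e"
  proof eventually_elim
    case (elim x)
    then have \<xi>: "\<bar>\<xi> y\<bar> < d" and g: "grad_sq y < d" if "dist x y \<le> 1" for y using that by force+
    have "(\<Sum>h\<leftarrow>[D1 (D1 U), D2 (D1 U), D1 (D2 U), D2 (D2 U)]. h x \<bullet> h x)
       \<le> (2 * 20 + 40) * (d / 2 - (\<Sum>k\<leftarrow>[D1 U, D2 U]. k x \<bullet> k x) / 2 + 2 * d)"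
    proof (rule bernstein_family)
      fix y assume y: "dist x y < 1"
      then have y1: "\<bar>\<xi> y\<bar> < d" "grad_sq y < d" using \<xi>[of y] g[of y] by auto
      have n: "norm (U y) \<le> 2"
      proof -
        have "(norm (U y))^2 = 1 - \<xi> y" unfolding \<xi>_def by simp
        then have "(norm (U y))^2 \<le> 2^2" using y1 d by simp
        then show ?thesis by (rule power2_le_imp_le) simp
      qed
      have "pd i U y \<bullet> pd i U y \<le> d" if "i = 1 \<or> i = 2" for i
        using y1(2) inner_ge_zero[of "D1 U y"] inner_ge_zero[of "D2 U y"] that by (auto simp del: inner_ge_zero)
      then have n1: "norm (pd i U y) \<le> sqrt d" if "i = 1 \<or> i = 2" for i
        using that by (auto simp: norm_eq_sqrt_inner intro!: real_sqrt_le_mono)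
      have sd: "(sqrt d)^4 = d * d" using d(1) by (simp add: power4_eq_xxxx)
      have dd: "d * d \<le> 1/2 * d" using d by (intro mult_right_mono) auto
      have "pd j (pd i U) y \<bullet> ddLap j i y \<ge>
          - (7 * (pd j (pd i U) y \<bullet> pd j (pd i U) y) + 6 * (d * d))" if "i = 1 \<or> i = 2" "j = 1 \<or> j = 2" for i j
        using ddLap_inner[OF n _ n1[OF that(1)] n1[OF that(2)]] y1 d unfolding sd by auto
      note k = this
      have arith: "- 20 * (A + (B + (C + (D + 0))) + 2 * d) \<le> 2 * (a + (b + (c + (r + 0))))"
        if "a \<ge> - (7 * A + 6 * E)" "b \<ge> - (7 * B + 6 * E)" "c \<ge> - (7 * C + 6 * E)" "r \<ge> - (7 * D + 6 * E)"
          "0 \<le> A" "0 \<le> B" "0 \<le> C" "0 \<le> D" "E \<le> 1/2 * d" for A B C D E a b c r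
        using that d(1) by (simp add: algebra_simps)
      show "- 20 * ((\<Sum>h\<leftarrow>[D1 (D1 U), D2 (D1 U), D1 (D2 U), D2 (D2 U)]. h y \<bullet> h y) + 2 * d)
        \<le> 2 * (\<Sum>h\<leftarrow>[D1 (D1 U), D2 (D1 U), D1 (D2 U), D2 (D2 U)]. h y \<bullet> Lap h y)"
        unfolding Lap_second_derivatives list.map sum_list.Cons sum_list.Nil
        by (intro arith[OF _ _ _ _ _ _ _ _ dd] k inner_ge_zero) auto
      have "\<xi> y * (pd i U y \<bullet> pd i U y) \<le> 1/2 * (pd i U y \<bullet> pd i U y)" for i
        using y1 d by (intro mult_right_mono) auto
      note half = this
      have arith: "- (2 * d) \<le> (2 * p - a + (2 * q - b + 0))"
        if "a \<le> 1/2 * A" "b \<le> 1/2 * B" "0 \<le> p" "0 \<le> q" "A + B < d" for A B a b p q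
        using that d(1) by linarith
      show "- (2 * d) \<le> (\<Sum>k\<leftarrow>[D1 U, D2 U]. k y \<bullet> Lap k y)"
        unfolding Lap_derivatives list.map sum_list.Cons sum_list.Nil dLap_inner
        by (rule arith[OF half half zero_le_power2 zero_le_power2 y1(2)])
    next
      fix y assume "dist x y \<le> 1"
      then show "(\<Sum>k\<leftarrow>[D1 U, D2 U]. k y \<bullet> k y) \<le> 2 * (d / 2)"
        using g[of y] by simp
    qed (use d smooth smooth' in \<open>auto\<close>)
    also have "\<dots> \<le> (2 * 20 + 40) * (d / 2 + 2 * d)"
      by (intro mult_left_mono) auto
    finally have "hess_sq x \<le> 200 * d" by simp
    also have "\<dots> < e" using d by linarith
    finally show ?case by (simp add: abs_less_iff)
  qed
qed

end

section \<open>Wirtinger's inequality\<close>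

text \<open>Picone's identity with the comparison function \<open>cos (l (x - m))\<close>. Taking \<open>l < 1\<close> keeps it positive up
  to the end points; the sharp constant is recovered by letting \<open>l\<close> tend to \<open>1\<close>.\<close>

lemma wirtinger_dirichlet:
  fixes f f' :: "real \<Rightarrow> real"
  assumes ab: "b = a + pi"
    and f: "\<And>x. (f has_real_derivative f' x) (at x)" and c: "continuous_on UNIV f'"
    and 0: "f a = 0" "f b = 0"
  shows "integral {a..b} (\<lambda>x. (f x)^2) \<le> integral {a..b} (\<lambda>x. (f' x)^2)"
proof (rule field_le_mult_one_interval)
  \<comment> \<open>It suffices to prove the inequality with a factor \<open>z < 1\<close> on the
    left; \<open>z\<close> is the square of the frequency \<open>l\<close>.\<close>
  fix z :: real assume z: "0 < z" "z < 1"
  define l where "l = sqrt z"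
  have l: "0 < l" "l < 1" "l^2 = z" unfolding l_def using z by auto
  define m where "m = a + pi / 2"
  \<comment> \<open>The logarithmic derivative of \<open>cos (l * (x - m))\<close>, a solution of
    the Riccati equation \<open>\<psi>' = - z - \<psi>^2\<close>. With it the square of
    \<open>f' - f * \<psi>\<close> differs from \<open>f'^2 - z * f^2\<close> by the derivative of
    \<open>f^2 * \<psi>\<close>, whose integral vanishes.\<close>
  define \<psi> where "\<psi> x = - l * tan (l * (x - m))" for x
  have cos: "cos (l * (x - m)) \<noteq> 0" if "x \<in> {a..b}" for x
  proof -
    have "x - m \<le> pi / 2" "- (x - m) \<le> pi / 2" using that unfolding m_def ab by auto
    then have "\<bar>x - m\<bar> \<le> pi / 2" by (rule abs_leI)
    then have "\<bar>l * (x - m)\<bar> \<le> l * (pi / 2)" unfolding abs_mult using l by simp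
    also have "\<dots> < 1 * (pi / 2)" using l by (intro mult_strict_right_mono) auto
    finally have "cos (l * (x - m)) > 0" by (intro cos_gt_zero_pi) (auto simp: abs_less_iff)
    then show ?thesis by simp
  qed
  have d\<psi>: "(\<psi> has_real_derivative - z - (\<psi> x)^2) (at x)" if "x \<in> {a..b}" for x
  proof -
    have "(\<psi> has_real_derivative - l * (inverse ((cos (l * (x - m)))^2) * l)) (at x)"
      unfolding \<psi>_def using cos[OF that] by (auto intro!: derivative_eq_intros)
    moreover have "inverse ((cos (l * (x - m)))^2) = 1 + (tan (l * (x - m)))^2"
      using tan_sec[OF cos[OF that]] by (simp add: power_inverse)
    ultimately show ?thesis unfolding \<psi>_def l(3)[symmetric]
      by (simp add: power2_eq_square algebra_simps)
  qed
  have cf: "continuous_on UNIV f" using f by (intro continuous_at_imp_continuous_on) (auto intro: DERIV_isCont)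
  have "((\<lambda>x. 2 * f x * f' x * \<psi> x + (f x)^2 * (- z - (\<psi> x)^2)) has_integral (f b)^2 * \<psi> b - (f a)^2 * \<psi> a) {a..b}"
  proof (rule fundamental_theorem_of_calculus)
    show "a \<le> b" unfolding ab by simp
    fix x assume x: "x \<in> {a..b}"
    have "((\<lambda>x. (f x)^2 * \<psi> x) has_real_derivative 2 * f x * f' x * \<psi> x + (f x)^2 * (- z - (\<psi> x)^2)) (at x)"
      by (auto intro!: derivative_eq_intros f d\<psi>[OF x] simp: algebra_simps)
    then show "((\<lambda>x. (f x)^2 * \<psi> x) has_vector_derivative 2 * f x * f' x * \<psi> x + (f x)^2 * (- z - (\<psi> x)^2)) (at x within {a..b})"
      by (simp add: has_real_derivative_iff_has_vector_derivative has_vector_derivative_at_within)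
  qed
  then have I0: "((\<lambda>x. 2 * f x * f' x * \<psi> x + (f x)^2 * (- z - (\<psi> x)^2)) has_integral 0) {a..b}"
    using 0 by simp
  have I1: "((\<lambda>x. (f' x)^2 - z * (f x)^2) has_integral
      (integral {a..b} (\<lambda>x. (f' x)^2) - z * integral {a..b} (\<lambda>x. (f x)^2))) {a..b}"
    by (intro has_integral_diff has_integral_mult_right integrable_integral integrable_continuous_real
        continuous_intros continuous_on_subset[OF c] continuous_on_subset[OF cf]) auto
  have "0 \<le> integral {a..b} (\<lambda>x. (f' x)^2) - z * integral {a..b} (\<lambda>x. (f x)^2)"
  proof (rule has_integral_le[OF I0 I1])
    fix x assume "x \<in> {a..b}"
    have "0 \<le> (f' x - f x * \<psi> x)^2" by simp
    then show "2 * f x * f' x * \<psi> x + (f x)^2 * (- z - (\<psi> x)^2) \<le> (f' x)^2 - z * (f x)^2"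
      by (simp add: power2_eq_square algebra_simps)
  qed
  then show "z * integral {a..b} (\<lambda>x. (f x)^2) \<le> integral {a..b} (\<lambda>x. (f' x)^2)" by simp
qed

lemma integral_periodic:
  fixes f :: "real \<Rightarrow> real"
  assumes c: "continuous_on UNIV f" and p: "\<And>x. f (x + 2 * pi) = f x" and a: "0 \<le> a" "a \<le> 2 * pi"
  shows "integral {a..a + 2 * pi} f = integral {0..2 * pi} f"
proof -
  have int: "f integrable_on {u..v}" for u v
    by (intro integrable_continuous_real continuous_on_subset[OF c]) auto
  have "integral {2 * pi..a + 2 * pi} f = integral {0 + 2 * pi..a + 2 * pi} f" by simp
  also have "\<dots> = integral {0..a} (\<lambda>x. f (x + 2 * pi))"
    using integral_shift_Icc_real[of 0 a f "2 * pi"] by (simp add: o_def add.commute)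
  finally have 1: "integral {2 * pi..a + 2 * pi} f = integral {0..a} f" using p by simp
  have "integral {a..2 * pi} f + integral {2 * pi..a + 2 * pi} f = integral {a..a + 2 * pi} f"
    using a by (intro Henstock_Kurzweil_Integration.integral_combine int) auto
  moreover have "integral {0..a} f + integral {a..2 * pi} f = integral {0..2 * pi} f"
    using a by (intro Henstock_Kurzweil_Integration.integral_combine int) auto
  ultimately show ?thesis using 1 by simp
qed

text \<open>The constant \<open>k\<close> is not the mean but a value that \<open>f\<close> takes at
  two antipodal points \<open>a\<close> and \<open>a + pi\<close>. Such points exist because
  \<open>f (x + pi) - f x\<close> changes sign over half a period. Then \<open>f - k\<close>
  vanishes at both ends of two half periods, and the Dirichlet inequality applies to each.\<close>

lemma wirtinger_periodic:
  fixes f f' :: "real \<Rightarrow> real"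
  assumes f: "\<And>x. (f has_real_derivative f' x) (at x)" and c: "continuous_on UNIV f'"
    and p: "\<And>x. f (x + 2 * pi) = f x"
  obtains k where "integral {0..2 * pi} (\<lambda>x. (f x - k)^2) \<le> integral {0..2 * pi} (\<lambda>x. (f' x)^2)"
proof -
  have cf: "continuous_on UNIV f" using f by (intro continuous_at_imp_continuous_on) (auto intro: DERIV_isCont)
  define g where "g x = f (x + pi) - f x" for x
  have cg: "continuous_on {0..pi} g" unfolding g_def
    by (intro continuous_intros continuous_on_compose2[OF cf] continuous_on_subset[OF cf]) auto
  have "g pi = - g 0" unfolding g_def using p[of 0] by (simp add: algebra_simps)
  then have "\<exists>a\<ge>0. a \<le> pi \<and> g a = 0"
    using IVT'[of g 0 0 pi] IVT2'[of g pi 0 0] cg by (cases "g 0 \<le> 0") auto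
  then obtain a where a: "0 \<le> a" "a \<le> pi" "f (a + pi) = f a" unfolding g_def by auto
  define k where "k = f a"
  define h where "h x = f x - k" for x
  have h: "\<And>x. (h has_real_derivative f' x) (at x)" unfolding h_def
    by (auto intro!: derivative_eq_intros f)
  have h0: "h a = 0" "h (a + pi) = 0" "h (a + pi + pi) = 0"
    unfolding h_def k_def using a p[of a] by (auto simp: add.assoc)
  have ch: "continuous_on UNIV h" unfolding h_def by (intro continuous_intros cf)
  have f'p: "f' (x + 2 * pi) = f' x" for x
  proof -
    have "((\<lambda>x. f (x + 2 * pi)) has_real_derivative f' (x + 2 * pi)) (at x)"
      using DERIV_shift[of f "f' (x + 2 * pi)" x "2 * pi"] f by simp
    then have "(f has_real_derivative f' (x + 2 * pi)) (at x)" using p by simp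
    then show ?thesis using f DERIV_unique by blast
  qed
  have int: "(\<lambda>x. (g x)^2) integrable_on {u..v}" if "continuous_on UNIV g" for u v and g :: "real \<Rightarrow> real"
    by (intro integrable_continuous_real continuous_intros continuous_on_subset[OF that]) auto
  have comb: "integral {a..a + pi} (\<lambda>x. (g x)^2) + integral {a + pi..a + pi + pi} (\<lambda>x. (g x)^2) = integral {a..a + 2 * pi} (\<lambda>x. (g x)^2)"
    if "continuous_on UNIV g" for g :: "real \<Rightarrow> real"
    using Henstock_Kurzweil_Integration.integral_combine[of a "a + pi" "a + 2 * pi" "\<lambda>x. (g x)^2"] int[OF that] by (simp add: add.assoc)
  have per: "integral {a..a + 2 * pi} (\<lambda>x. (g x)^2) = integral {0..2 * pi} (\<lambda>x. (g x)^2)"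
    if "continuous_on UNIV g" "\<And>x. g (x + 2 * pi) = g x" for g :: "real \<Rightarrow> real"
    using a that by (intro integral_periodic continuous_intros) auto
  have "integral {a..a + pi} (\<lambda>x. (h x)^2) \<le> integral {a..a + pi} (\<lambda>x. (f' x)^2)"
    by (rule wirtinger_dirichlet[OF refl h c h0(1,2)])
  moreover have "integral {a + pi..a + pi + pi} (\<lambda>x. (h x)^2) \<le> integral {a + pi..a + pi + pi} (\<lambda>x. (f' x)^2)"
    by (rule wirtinger_dirichlet[OF refl h c h0(2,3)])
  ultimately have "integral {0..2 * pi} (\<lambda>x. (h x)^2) \<le> integral {0..2 * pi} (\<lambda>x. (f' x)^2)"
    using comb[OF ch] comb[OF c] per[OF ch] per[OF c] f'p p unfolding h_def by simp
  then show ?thesis using that[of k] unfolding h_def by simp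
qed

text \<open>Up to sign the left integral is twice the area enclosed by the loop
  \<open>(f, g)\<close>. Integration by parts turns it into the integral of
  \<open>2 * (g - k) * f'\<close>, and Wirtinger's inequality is needed for \<open>g\<close>
  alone.\<close>

lemma isoperimetric_inequality:
  fixes f g f' g' :: "real \<Rightarrow> real"
  assumes f: "\<And>x. (f has_real_derivative f' x) (at x)" "continuous_on UNIV f'" "\<And>x. f (x + 2 * pi) = f x"
    and g: "\<And>x. (g has_real_derivative g' x) (at x)" "continuous_on UNIV g'" "\<And>x. g (x + 2 * pi) = g x"
  shows "\<bar>integral {0..2 * pi} (\<lambda>x. g x * f' x - f x * g' x)\<bar> \<le> integral {0..2 * pi} (\<lambda>x. (f' x)^2 + (g' x)^2)"
proof -
  obtain k where k: "integral {0..2 * pi} (\<lambda>x. (g x - k)^2) \<le> integral {0..2 * pi} (\<lambda>x. (g' x)^2)"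
    using wirtinger_periodic[OF g] by blast
  have cf: "continuous_on S f" "continuous_on S g" "continuous_on S f'" "continuous_on S g'" for S
    using f(1) g(1) by (auto intro!: continuous_at_imp_continuous_on DERIV_isCont continuous_on_subset[OF f(2)] continuous_on_subset[OF g(2)])
  \<comment> \<open>The derivative of the periodic function \<open>f * (g - k) - k * f\<close>.
    Adding it changes no integral and turns \<open>g * f' - f * g'\<close> into
    \<open>2 * (g - k) * f'\<close>.\<close>
  have "((\<lambda>x. f' x * (g x - k) + f x * g' x - k * f' x) has_integral
     (f (2 * pi) * (g (2 * pi) - k) - k * f (2 * pi) - (f 0 * (g 0 - k) - k * f 0))) {0..2 * pi}"
  proof (rule fundamental_theorem_of_calculus)
    fix x
    have "((\<lambda>x. f x * (g x - k) - k * f x) has_real_derivative f' x * (g x - k) + f x * g' x - k * f' x) (at x)"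
      by (auto intro!: derivative_eq_intros f g)
    then show "((\<lambda>x. f x * (g x - k) - k * f x) has_vector_derivative f' x * (g x - k) + f x * g' x - k * f' x) (at x within {0..2 * pi})"
      by (simp add: has_real_derivative_iff_has_vector_derivative has_vector_derivative_at_within)
  qed simp
  then have I0: "((\<lambda>x. f' x * (g x - k) + f x * g' x - k * f' x) has_integral 0) {0..2 * pi}"
    using f(3)[of 0] g(3)[of 0] by simp
  have I1: "((\<lambda>x. g x * f' x - f x * g' x) has_integral integral {0..2 * pi} (\<lambda>x. g x * f' x - f x * g' x)) {0..2 * pi}"
    by (intro integrable_integral integrable_continuous_real continuous_intros cf)
  have "((\<lambda>x. (g x * f' x - f x * g' x) + (f' x * (g x - k) + f x * g' x - k * f' x)) has_integral
     integral {0..2 * pi} (\<lambda>x. g x * f' x - f x * g' x) + 0) {0..2 * pi}"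
    by (rule has_integral_add[OF I1 I0])
  then have I2: "((\<lambda>x. 2 * (g x - k) * f' x) has_integral integral {0..2 * pi} (\<lambda>x. g x * f' x - f x * g' x)) {0..2 * pi}"
    by (simp add: algebra_simps)
  have I3: "((\<lambda>x. (f' x)^2 + (g x - k)^2) has_integral integral {0..2 * pi} (\<lambda>x. (f' x)^2) + integral {0..2 * pi} (\<lambda>x. (g x - k)^2)) {0..2 * pi}"
    by (intro has_integral_add integrable_integral integrable_continuous_real continuous_intros cf)
  have "integral {0..2 * pi} (\<lambda>x. g x * f' x - f x * g' x) \<le> integral {0..2 * pi} (\<lambda>x. (f' x)^2) + integral {0..2 * pi} (\<lambda>x. (g x - k)^2)"
  proof (rule has_integral_le[OF I2 I3])
    show "2 * (g x - k) * f' x \<le> (f' x)^2 + (g x - k)^2" for x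
      using sum_squares_bound[of "g x - k" "f' x"] by simp
  qed
  moreover have "- integral {0..2 * pi} (\<lambda>x. g x * f' x - f x * g' x) \<le> integral {0..2 * pi} (\<lambda>x. (f' x)^2) + integral {0..2 * pi} (\<lambda>x. (g x - k)^2)"
  proof (rule has_integral_le[OF has_integral_neg[OF I2] I3])
    show "- (2 * (g x - k) * f' x) \<le> (f' x)^2 + (g x - k)^2" for x
      using sum_squares_bound[of "g x - k" "- f' x"] by simp
  qed
  moreover have "integral {0..2 * pi} (\<lambda>x. (f' x)^2 + (g' x)^2) = integral {0..2 * pi} (\<lambda>x. (f' x)^2) + integral {0..2 * pi} (\<lambda>x. (g' x)^2)"
    by (intro Henstock_Kurzweil_Integration.integral_add integrable_continuous_real continuous_intros cf)
  ultimately show ?thesis using k by simp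
qed

section \<open>Circle integrals\<close>

definition pol :: "real \<Rightarrow> real \<Rightarrow> real ^ 2"
  where "pol t \<theta> = vector [exp t * cos \<theta>, exp t * sin \<theta>]"

lemma pol_nth [simp]: "pol t \<theta> $ 1 = exp t * cos \<theta>" "pol t \<theta> $ 2 = exp t * sin \<theta>"
  unfolding pol_def by simp_all

lemma norm_real2: "(norm (x :: real ^ 2))^2 = (x $ 1)^2 + (x $ 2)^2"
  unfolding norm_vec_def L2_set_def by (simp add: sum_2)

lemma norm_pol [simp]: "norm (pol t \<theta>) = exp t"
proof -
  have "(norm (pol t \<theta>))^2 = (exp t)^2 * ((cos \<theta>)^2 + (sin \<theta>)^2)"
    unfolding norm_real2 pol_nth by (simp only: power_mult_distrib distrib_left)
  then have "(norm (pol t \<theta>))^2 = (exp t)^2" by simp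
  then show ?thesis by (rule power2_eq_imp_eq) auto
qed

lemma pol_periodic [simp]: "pol t (\<theta> + 2 * pi) = pol t \<theta>"
  unfolding pol_def by simp

lemma pol_eq: "pol t \<theta> = (exp t * cos \<theta>) *\<^sub>R axis 1 1 + (exp t * sin \<theta>) *\<^sub>R axis 2 1"
  by (simp add: vec_eq_iff forall_2 axis_def)

lemma continuous_on_pol:
  fixes f g :: "'a::t2_space \<Rightarrow> real"
  shows "continuous_on S f \<Longrightarrow> continuous_on S g \<Longrightarrow> continuous_on S (\<lambda>x. pol (f x) (g x))"
  unfolding pol_eq by (intro continuous_intros)

lemma pol_deriv:
  fixes g :: "real ^ 2 \<Rightarrow> real"
  assumes "has_grad g p q (pol t \<theta>)"
  shows "((\<lambda>t. g (pol t \<theta>)) has_real_derivative (pol t \<theta> $ 1 * p + pol t \<theta> $ 2 * q)) (at t)"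
    and "((\<lambda>\<theta>. g (pol t \<theta>)) has_real_derivative (- pol t \<theta> $ 2 * p + pol t \<theta> $ 1 * q)) (at \<theta>)"
proof -
  have "((\<lambda>t. exp t * cos \<theta>) has_real_derivative exp t * cos \<theta>) (at t)"
    "((\<lambda>t. exp t * sin \<theta>) has_real_derivative exp t * sin \<theta>) (at t)"
    "((\<lambda>\<theta>. exp t * cos \<theta>) has_real_derivative - (exp t * sin \<theta>)) (at \<theta>)"
    "((\<lambda>\<theta>. exp t * sin \<theta>) has_real_derivative exp t * cos \<theta>) (at \<theta>)"
    by (auto intro!: derivative_eq_intros)
  from has_grad_compose[OF assms[unfolded pol_def] this(1,2)] has_grad_compose[OF assms[unfolded pol_def] this(3,4)]
  show "((\<lambda>t. g (pol t \<theta>)) has_real_derivative (pol t \<theta> $ 1 * p + pol t \<theta> $ 2 * q)) (at t)"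
    and "((\<lambda>\<theta>. g (pol t \<theta>)) has_real_derivative (- pol t \<theta> $ 2 * p + pol t \<theta> $ 1 * q)) (at \<theta>)"
    unfolding pol_def by (simp_all add: has_real_derivative_iff_has_vector_derivative)
qed

lemma polar_coordinates:
  assumes "norm x = exp t"
  obtains a where "0 \<le> a" "a < 2 * pi" "x = pol t a"
proof -
  have "(x $ 1)^2 + (x $ 2)^2 = (exp t)^2" using norm_real2[of x] assms by simp
  then have "(x $ 1 / exp t)^2 + (x $ 2 / exp t)^2 = 1"
    by (simp add: power_divide add_divide_distrib[symmetric])
  then obtain a where a: "0 \<le> a" "a < 2 * pi" "x $ 1 / exp t = cos a" "x $ 2 / exp t = sin a"
    by (rule sincos_total_2pi)
  then have "x = pol t a" by (simp add: vec_eq_iff forall_2 field_simps)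
  with a show ?thesis using that by blast
qed

definition circ :: "(real ^ 2 \<Rightarrow> real) \<Rightarrow> real \<Rightarrow> real"
  where "circ g t = integral {0..2 * pi} (\<lambda>\<theta>. g (pol t \<theta>))"

abbreviation exterior :: "real \<Rightarrow> (real ^ 2) set"
  where "exterior R \<equiv> {x. R < norm x}"

lemma open_exterior: "open (exterior R)"
  by (intro open_Collect_less continuous_intros)

lemma continuous_circ:
  assumes "continuous_on (exterior R) g" "R < exp t"
  shows "continuous_on S (\<lambda>\<theta>. g (pol t \<theta>))"
  by (intro continuous_on_compose2[OF assms(1)] continuous_on_pol continuous_intros) (use assms(2) in auto)

lemma integrable_circ:
  fixes g :: "real ^ 2 \<Rightarrow> real"
  assumes "continuous_on (exterior R) g" "R < exp t"
  shows "(\<lambda>\<theta>. g (pol t \<theta>)) integrable_on {0..2 * pi}"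
  by (rule integrable_continuous_real) (rule continuous_circ[OF assms])

lemma circ_mono:
  assumes "continuous_on (exterior R) g" "continuous_on (exterior R) h" "R < exp t"
    and "\<And>x. norm x = exp t \<Longrightarrow> g x \<le> h x"
  shows "circ g t \<le> circ h t"
  unfolding circ_def by (intro integral_le integrable_circ[of R] assms) auto

lemma circ_add:
  assumes "continuous_on (exterior R) g" "continuous_on (exterior R) h" "R < exp t"
  shows "circ (\<lambda>x. g x + h x) t = circ g t + circ h t"
  unfolding circ_def by (intro Henstock_Kurzweil_Integration.integral_add integrable_circ[of R] assms)

lemma circ_diff:
  assumes "continuous_on (exterior R) g" "continuous_on (exterior R) h" "R < exp t"
  shows "circ (\<lambda>x. g x - h x) t = circ g t - circ h t"
  unfolding circ_def by (intro Henstock_Kurzweil_Integration.integral_diff integrable_circ[of R] assms)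

lemma circ_cmult: "circ (\<lambda>x. c * g x) t = c * circ g t"
  unfolding circ_def by simp

lemma circ_const: "circ (\<lambda>x. c) t = 2 * pi * c"
  unfolding circ_def by simp

lemma circ_cong: "(\<And>x. norm x = exp t \<Longrightarrow> g x = h x) \<Longrightarrow> circ g t = circ h t"
  unfolding circ_def by (intro integral_cong) auto

lemma circ_nonneg:
  assumes "continuous_on (exterior R) g" "R < exp t" "\<And>x. norm x = exp t \<Longrightarrow> 0 \<le> g x"
  shows "0 \<le> circ g t"
  unfolding circ_def by (intro integral_nonneg integrable_circ[of R] assms) auto

lemma circ_abs:
  assumes "continuous_on (exterior R) g" "R < exp t" "\<And>x. norm x = exp t \<Longrightarrow> \<bar>g x\<bar> \<le> c"
  shows "\<bar>circ g t\<bar> \<le> 2 * pi * c"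
proof -
  have "circ g t \<le> circ (\<lambda>x. c) t" "circ (\<lambda>x. - c) t \<le> circ g t"
    using assms(3) by (auto intro!: circ_mono[of R] assms continuous_intros simp: abs_le_iff minus_le_iff)
  then show ?thesis unfolding circ_const by auto
qed

lemma has_grad_continuous_on:
  assumes "\<And>x. x \<in> exterior R \<Longrightarrow> has_grad g (g1 x) (g2 x) x"
  shows "continuous_on (exterior R) g"
  using has_grad_continuous[OF assms] by (intro continuous_at_imp_continuous_on) auto

lemma circ_deriv:
  assumes g: "\<And>x. x \<in> exterior R \<Longrightarrow> has_grad g (g1 x) (g2 x) x"
    and c: "continuous_on (exterior R) g1" "continuous_on (exterior R) g2"
    and t: "R < exp t" and R: "0 < R"
  shows "(circ g has_real_derivative circ (\<lambda>x. x $ 1 * g1 x + x $ 2 * g2 x) t) (at t)"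
proof -
  define T where "T = {s. R < exp s}"
  have T: "T = {ln R<..}" unfolding T_def using R exp_less_cancel_iff[of "ln R"] by auto
  have tT: "t \<in> T" unfolding T_def using t by simp
  have "((\<lambda>t. integral (cbox 0 (2 * pi)) (\<lambda>\<theta>. g (pol t \<theta>))) has_field_derivative
     integral (cbox 0 (2 * pi)) (\<lambda>\<theta>. pol t \<theta> $ 1 * g1 (pol t \<theta>) + pol t \<theta> $ 2 * g2 (pol t \<theta>))) (at t within T)"
  proof (rule leibniz_rule_field_derivative[OF _ _ _ tT])
    fix s \<theta> :: real assume s: "s \<in> T"
    have "has_grad g (g1 (pol s \<theta>)) (g2 (pol s \<theta>)) (pol s \<theta>)" using g s unfolding T_def by auto
    from pol_deriv(1)[OF this]
    show "((\<lambda>s. g (pol s \<theta>)) has_field_derivative pol s \<theta> $ 1 * g1 (pol s \<theta>) + pol s \<theta> $ 2 * g2 (pol s \<theta>)) (at s within T)"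
      by (rule has_field_derivative_at_within)
  next
    fix s assume "s \<in> T"
    then show "(\<lambda>\<theta>. g (pol s \<theta>)) integrable_on cbox 0 (2 * pi)"
      using integrable_circ[OF has_grad_continuous_on[OF g], of R s] unfolding T_def by auto
  next
    show "continuous_on (T \<times> cbox 0 (2 * pi)) (\<lambda>(s, \<theta>). pol s \<theta> $ 1 * g1 (pol s \<theta>) + pol s \<theta> $ 2 * g2 (pol s \<theta>))"
      unfolding split_beta pol_nth
      by (intro continuous_intros continuous_on_compose2[OF c(1)] continuous_on_compose2[OF c(2)] continuous_on_pol) (auto simp: T_def)
    show "convex T" unfolding T by simp
  qed
  moreover have "at t within T = at t"
    using tT unfolding T by (intro at_within_open) auto
  ultimately show ?thesis unfolding circ_def by simp
qed

text \<open>The integrand is the angular derivative of \<open>g\<close>, which integrates to zero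
  around a circle.\<close>

lemma circ_rotation:
  assumes g: "\<And>x. x \<in> exterior R \<Longrightarrow> has_grad g (g1 x) (g2 x) x" and t: "R < exp t"
  shows "circ (\<lambda>x. - x $ 2 * g1 x + x $ 1 * g2 x) t = 0"
proof -
  have "((\<lambda>\<theta>. - pol t \<theta> $ 2 * g1 (pol t \<theta>) + pol t \<theta> $ 1 * g2 (pol t \<theta>)) has_integral g (pol t (2 * pi)) - g (pol t 0)) {0..2 * pi}"
  proof (rule fundamental_theorem_of_calculus)
    fix \<theta> :: real
    have "has_grad g (g1 (pol t \<theta>)) (g2 (pol t \<theta>)) (pol t \<theta>)" using g t by auto
    from pol_deriv(2)[OF this]
    show "((\<lambda>\<theta>. g (pol t \<theta>)) has_vector_derivative (- pol t \<theta> $ 2 * g1 (pol t \<theta>) + pol t \<theta> $ 1 * g2 (pol t \<theta>))) (at \<theta> within {0..2 * pi})"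
      by (simp add: has_real_derivative_iff_has_vector_derivative has_vector_derivative_at_within)
  qed simp
  moreover have "pol t (2 * pi) = pol t 0" unfolding pol_def by simp
  ultimately show ?thesis unfolding circ_def by (simp add: integral_unique)
qed

lemma circ_scale: "circ (\<lambda>x. (norm x)^2 * g x) t = exp (2*t) * circ g t"
proof -
  have "circ (\<lambda>x. (norm x)^2 * g x) t = circ (\<lambda>x. exp (2*t) * g x) t"
    by (rule circ_cong) (simp add: exp_double)
  then show ?thesis by (simp add: circ_cmult)
qed

lemma circ_linear:
  fixes g h :: "real ^ 2 \<Rightarrow> real"
  assumes "continuous_on (exterior R) g" "continuous_on (exterior R) h" "R < exp t"
  shows "circ (\<lambda>x. g x + c * h x) t = circ g t + c * circ h t" "circ (\<lambda>x. g x - c * h x) t = circ g t - c * circ h t"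
  using circ_add[OF assms(1) _ assms(3), of "\<lambda>x. c * h x"] circ_diff[OF assms(1) _ assms(3), of "\<lambda>x. c * h x"] assms(2)
  by (simp_all add: circ_cmult continuous_on_mult_left)

text \<open>In the variables \<open>t\<close> and \<open>\<theta>\<close> the operator
  \<open>r^2\<close> times the Laplacian is the sum of the two pure second derivatives, and the
  angular one integrates to zero.\<close>

lemma circ_second_deriv:
  assumes g: "\<And>x. x \<in> exterior R \<Longrightarrow> has_grad g (g1 x) (g2 x) x"
    and g1: "\<And>x. x \<in> exterior R \<Longrightarrow> has_grad g1 (g11 x) (g12 x) x"
    and g2: "\<And>x. x \<in> exterior R \<Longrightarrow> has_grad g2 (g21 x) (g22 x) x"
    and c: "continuous_on (exterior R) g11" "continuous_on (exterior R) g12" "continuous_on (exterior R) g21" "continuous_on (exterior R) g22"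
    and t: "R < exp t" and R: "0 < R"
  shows "(circ (\<lambda>x. x $ 1 * g1 x + x $ 2 * g2 x) has_real_derivative circ (\<lambda>x. (norm x)^2 * (g11 x + g22 x)) t) (at t)"
proof -
  note c1 = has_grad_continuous_on[OF g1] and c2 = has_grad_continuous_on[OF g2]
  have h: "has_grad (\<lambda>x. x $ 1 * g1 x + x $ 2 * g2 x)
     (g1 x + x $ 1 * g11 x + x $ 2 * g21 x) (x $ 1 * g12 x + g2 x + x $ 2 * g22 x) x" if "x \<in> exterior R" for x
    using that by (intro has_grad_eq[OF has_grad_add[OF has_grad_mult[OF has_grad_coord(1) g1] has_grad_mult[OF has_grad_coord(2) g2]]]) auto
  have k: "has_grad (\<lambda>x. - (x $ 2 * g1 x) + x $ 1 * g2 x)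
     (- (x $ 2 * g11 x) + g2 x + x $ 1 * g21 x) (- g1 x - x $ 2 * g12 x + x $ 1 * g22 x) x" if "x \<in> exterior R" for x
    using that by (intro has_grad_eq[OF has_grad_add[OF has_grad_minus[OF has_grad_mult[OF has_grad_coord(2) g1]] has_grad_mult[OF has_grad_coord(1) g2]]]) auto
  have "circ (\<lambda>x. (norm x)^2 * (g11 x + g22 x)) t
    = circ (\<lambda>x. (x $ 1 * (g1 x + x $ 1 * g11 x + x $ 2 * g21 x) + x $ 2 * (x $ 1 * g12 x + g2 x + x $ 2 * g22 x))
       + (- x $ 2 * (- (x $ 2 * g11 x) + g2 x + x $ 1 * g21 x) + x $ 1 * (- g1 x - x $ 2 * g12 x + x $ 1 * g22 x))) t"
    unfolding norm_real2 by (rule circ_cong) (simp add: power2_eq_square algebra_simps)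
  also have "\<dots> = circ (\<lambda>x. x $ 1 * (g1 x + x $ 1 * g11 x + x $ 2 * g21 x) + x $ 2 * (x $ 1 * g12 x + g2 x + x $ 2 * g22 x)) t"
    by (subst circ_add[of R]) (use circ_rotation[OF k t] t in \<open>auto intro!: continuous_intros c c1 c2\<close>)
  finally show ?thesis
    by (simp only:) (intro circ_deriv[OF h _ _ t R] continuous_intros c c1 c2)
qed

text \<open>A value on the circle exceeds the mean by at most the total variation. The factor
  \<open>1 / (2 * pi)\<close> of the mean is dropped, which is allowed because \<open>g\<close> is
  nonnegative.\<close>

lemma circ_sup:
  fixes g :: "real ^ 2 \<Rightarrow> real"
  assumes g: "\<And>x. x \<in> exterior R \<Longrightarrow> has_grad g (g1 x) (g2 x) x"
    and c: "continuous_on (exterior R) g1" "continuous_on (exterior R) g2"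
    and t: "R < exp t" and x: "norm x = exp t" and n: "\<And>x. x \<in> exterior R \<Longrightarrow> 0 \<le> g x"
  shows "g x \<le> circ g t + circ (\<lambda>x. \<bar>- x $ 2 * g1 x + x $ 1 * g2 x\<bar>) t"
proof -
  define d where "d \<theta> = - pol t \<theta> $ 2 * g1 (pol t \<theta>) + pol t \<theta> $ 1 * g2 (pol t \<theta>)" for \<theta>
  note cg = has_grad_continuous_on[OF g]
  have dd: "((\<lambda>\<theta>. g (pol t \<theta>)) has_real_derivative d \<theta>) (at \<theta>)" for \<theta>
  proof -
    have "has_grad g (g1 (pol t \<theta>)) (g2 (pol t \<theta>)) (pol t \<theta>)" using g t by auto
    from pol_deriv(2)[OF this] show ?thesis unfolding d_def by simp
  qed
  have cd: "continuous_on S d" for S unfolding d_def pol_nth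
    by (intro continuous_intros continuous_circ[OF c(1) t] continuous_circ[OF c(2) t])
  have int: "d integrable_on {u..v}" "(\<lambda>\<theta>. \<bar>d \<theta>\<bar>) integrable_on {u..v}" for u v
    by (auto intro!: integrable_continuous_real cd continuous_intros)
  define I where "I = integral {0..2 * pi} (\<lambda>\<theta>. \<bar>d \<theta>\<bar>)"
  have le: "g (pol t a) \<le> g (pol t b) + I" if "a \<in> {0..2 * pi}" "b \<in> {0..2 * pi}" for a b
  proof -
    have *: "\<bar>g (pol t v) - g (pol t u)\<bar> \<le> I" if "0 \<le> u" "u \<le> v" "v \<le> 2 * pi" for u v
    proof -
      have "(d has_integral g (pol t v) - g (pol t u)) {u..v}"
        using dd by (intro fundamental_theorem_of_calculus that)
          (auto simp: has_real_derivative_iff_has_vector_derivative intro: has_vector_derivative_at_within)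
      then have "g (pol t v) - g (pol t u) = integral {u..v} d" by (simp add: integral_unique)
      moreover have "\<bar>integral {u..v} d\<bar> \<le> integral {u..v} (\<lambda>\<theta>. \<bar>d \<theta>\<bar>)"
        using integral_norm_bound_integral[OF int(1) int(2), of u v] by simp
      moreover have "integral {u..v} (\<lambda>\<theta>. \<bar>d \<theta>\<bar>) \<le> I"
        unfolding I_def using that by (intro integral_subset_le int) auto
      ultimately show ?thesis by linarith
    qed
    show ?thesis using *[of a b] *[of b a] that by (cases "a \<le> b") auto
  qed
  obtain a where a: "0 \<le> a" "a < 2 * pi" and xa: "x = pol t a" by (rule polar_coordinates[OF x])
  have ig: "(\<lambda>\<theta>. g (pol t \<theta>)) integrable_on {0..2 * pi}" by (rule integrable_circ[OF cg t])
  have "2 * pi * g x = integral {0..2 * pi} (\<lambda>\<theta>. g x)" by simp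
  also have "\<dots> \<le> integral {0..2 * pi} (\<lambda>\<theta>. g (pol t \<theta>) + I)"
    using le[of a] a xa by (intro integral_le integrable_add ig) auto
  also have "\<dots> = circ g t + 2 * pi * I"
    unfolding circ_def by (subst Henstock_Kurzweil_Integration.integral_add[OF ig]) auto
  finally have 1: "2 * pi * (g x - I) \<le> circ g t" by (simp add: algebra_simps)
  have "0 \<le> circ g t" using t n by (intro circ_nonneg[OF cg]) auto
  have "g x - I \<le> circ g t"
  proof (cases "0 \<le> g x - I")
    case True
    have "1 * (g x - I) \<le> 2 * pi * (g x - I)"
      using True pi_gt3 by (intro mult_right_mono) auto
    then show ?thesis using 1 by simp
  qed (use \<open>0 \<le> circ g t\<close> in simp)
  moreover have "I = circ (\<lambda>x. \<bar>- x $ 2 * g1 x + x $ 1 * g2 x\<bar>) t"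
    unfolding I_def d_def circ_def ..
  ultimately show ?thesis by simp
qed

section \<open>Differential inequalities for circle integrals\<close>

lemma nondecreasing_le_limit:
  fixes f f' :: "real \<Rightarrow> real"
  assumes d: "\<And>t. t \<ge> T \<Longrightarrow> (f has_real_derivative f' t) (at t)"
    and n: "\<And>t. t \<ge> T \<Longrightarrow> 0 \<le> f' t"
    and l: "(f \<longlongrightarrow> l) at_top"
  shows "f T \<le> l"
proof (rule tendsto_lowerbound[OF l])
  show "\<forall>\<^sub>F t in at_top. f T \<le> f t"
    using eventually_ge_at_top[of T]
  proof eventually_elim
    case (elim t)
    then show ?case
      using d n by (intro DERIV_nonneg_imp_nondecreasing[OF elim]) auto
  qed
qed simp

lemma exp_neg_tendsto_0:
  fixes c :: real
  assumes "c < 0"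
  shows "((\<lambda>t. exp (c * t)) \<longlongrightarrow> 0) at_top"
proof -
  have "filterlim (\<lambda>t. c * t) at_bot at_top"
    using assms by (simp add: filterlim_tendsto_neg_mult_at_bot[OF tendsto_const _ filterlim_ident])
  then show ?thesis by (rule filterlim_compose[OF exp_at_bot])
qed

lemma bounded_times_tendsto_0:
  fixes f g :: "real \<Rightarrow> real"
  assumes "\<And>t. t \<ge> T \<Longrightarrow> \<bar>f t\<bar> \<le> g t" "(g \<longlongrightarrow> 0) at_top"
  shows "(f \<longlongrightarrow> 0) at_top"
proof (rule Lim_null_comparison[OF _ assms(2)])
  show "\<forall>\<^sub>F t in at_top. norm (f t) \<le> g t"
    using eventually_ge_at_top[of T] by (rule eventually_mono) (use assms(1) in auto)
qed

text \<open>\<open>Q\<close> is the flux described above, and \<open>Y\<close>, \<open>A\<close>, \<open>X\<close> are the circle integrals of \<open>|s|\<^sup>2\<close>, \<open>|v|\<^sup>2\<close> and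
  \<open>(1 - |u|\<^sup>2)\<^sup>2\<close>. The suffixes \<open>1\<close> and \<open>2\<close> denote derivatives.\<close>

locale decay_system =
  fixes Q Q1 Y Y1 Y2 A A1 X X1 X2 a :: "real \<Rightarrow> real" and t0 C0 \<epsilon> :: real
  assumes dQ: "\<And>t. t \<ge> t0 \<Longrightarrow> (Q has_real_derivative Q1 t) (at t)"
    and dY: "\<And>t. t \<ge> t0 \<Longrightarrow> (Y has_real_derivative Y1 t) (at t)"
    and dY1: "\<And>t. t \<ge> t0 \<Longrightarrow> (Y1 has_real_derivative Y2 t) (at t)"
    and dA: "\<And>t. t \<ge> t0 \<Longrightarrow> (A has_real_derivative A1 t) (at t)"
    and dX: "\<And>t. t \<ge> t0 \<Longrightarrow> (X has_real_derivative X1 t) (at t)"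
    and dX1: "\<And>t. t \<ge> t0 \<Longrightarrow> (X1 has_real_derivative X2 t) (at t)"
    and nonneg: "\<And>t. t \<ge> t0 \<Longrightarrow> 0 \<le> Y t" "\<And>t. t \<ge> t0 \<Longrightarrow> 0 \<le> A t"
      "\<And>t. t \<ge> t0 \<Longrightarrow> 0 \<le> X t" "\<And>t. t \<ge> t0 \<Longrightarrow> 0 \<le> a t"
    and eps: "0 \<le> \<epsilon>" "\<epsilon> \<le> 1/100"
    and t0: "10 \<le> t0" and C0: "0 \<le> C0"
    and crude: "\<And>t. t \<ge> t0 \<Longrightarrow> \<bar>Q t\<bar> \<le> C0 * exp t" "\<And>t. t \<ge> t0 \<Longrightarrow> \<bar>Y t\<bar> \<le> C0 * exp t"
      "\<And>t. t \<ge> t0 \<Longrightarrow> \<bar>Y1 t\<bar> \<le> C0 * exp t"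
      "\<And>t. t \<ge> t0 \<Longrightarrow> \<bar>X1 t\<bar> \<le> C0 * exp t" "\<And>t. t \<ge> t0 \<Longrightarrow> \<bar>X t\<bar> \<le> C0"
    and A_lim: "(A \<longlongrightarrow> 0) at_top"
    and Q_growth: "\<And>t. t \<ge> t0 \<Longrightarrow> a t - \<epsilon> * (exp (2*t) * Y t) \<le> Q1 t"
    and Q_bound: "\<And>t. t \<ge> t0 \<Longrightarrow> \<bar>Q t\<bar> \<le> (1/2 + \<epsilon>) * a t + \<epsilon> * (exp (2*t) * Y t)"
    and Y_growth: "\<And>t. t \<ge> t0 \<Longrightarrow> exp (2*t) * Y t - \<epsilon> * a t \<le> Y2 t"
    and Q_le: "\<And>t. t \<ge> t0 \<Longrightarrow> 2 * Q t \<le> A1 t + \<epsilon> * (A t + exp (2*t) * Y t)"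
    and A_growth: "\<And>t k. t \<ge> t0 \<Longrightarrow> k > 0 \<Longrightarrow> \<bar>A1 t\<bar> \<le> k * A t + a t / k"
    and X_growth: "\<And>t. t \<ge> t0 \<Longrightarrow> exp (2*t) * (2 * X t - 5 * (A t * (2 * A t + a t))) \<le> X2 t"
begin

abbreviation "B t \<equiv> exp (2*t) * Y t"

lemma exp2: "exp (2*t) \<ge> (20::real)" if "t \<ge> t0"
  using exp_ge_add_one_self[of "2*t"] that t0 by linarith

lemma B_ge: "20 * Y t \<le> B t" if "t \<ge> t0"
  using mult_right_mono[OF exp2[OF that] nonneg(1)[OF that]] by simp

text \<open>With \<open>Y1\<close> included the errors in \<open>Q_growth\<close> and
  \<open>Y_growth\<close> absorb each other: \<open>Q1 + Y2\<close> is at least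
  \<open>(1 - \<epsilon>) * (a + B)\<close>, so \<open>H\<close> is nonincreasing.\<close>

definition "H t = - Q t - Y1 t"

text \<open>The weight \<open>exp (-3 t)\<close> beats the crude growth bounds. Here \<open>Q\<close> is controlled by \<open>A'\<close> instead of \<open>a\<close>,
  which is where \<open>v \<rightarrow> 0\<close> excludes the growing alternative.\<close>

lemma H_lower:
  assumes T: "T \<ge> t0" and \<alpha>: "\<And>t. t \<ge> T \<Longrightarrow> A t \<le> \<alpha>"
  shows "H T \<ge> - (5/3) * \<alpha>"
proof -
  \<comment> \<open>Under \<open>d/dt - 3\<close> the summand \<open>3 * Y\<close> removes
    \<open>Y1\<close> and leaves \<open>- 9 * Y\<close>, which \<open>B\<close> dominates. The
    summand \<open>3/2 * A\<close> supplies the \<open>A1\<close> that pays for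
    \<open>- 3 * Q\<close> by \<open>Q_le\<close>. The constant becomes \<open>5 * \<alpha>\<close>
    and covers the remaining \<open>A\<close> terms, of total coefficient slightly above
    9/2.\<close>
  define f where "f t = exp (-3*t) * (Q t + Y1 t + 3 * Y t + 3/2 * A t - 5/3 * \<alpha>)" for t
  define f' where "f' t = -3 * exp (-3*t) * (Q t + Y1 t + 3 * Y t + 3/2 * A t - 5/3 * \<alpha>)
     + exp (-3*t) * (Q1 t + Y2 t + 3 * Y1 t + 3/2 * A1 t)" for t
  have df: "(f has_real_derivative f' t) (at t)" if "t \<ge> T" for t
    unfolding f_def f'_def
    using that T by (auto intro!: derivative_eq_intros dQ dY dY1 dA)
  have "0 \<le> f' t" if "t \<ge> T" for t
  proof -
    have tt: "t \<ge> t0" using that T by simp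
    have "f' t = exp (-3*t) * (Q1 t + Y2 t + 3/2 * A1 t - 3 * Q t - 9 * Y t - 9/2 * A t + 5 * \<alpha>)"
      unfolding f'_def by (simp add: algebra_simps)
    moreover have "0 \<le> Q1 t + Y2 t + 3/2 * A1 t - 3 * Q t - 9 * Y t - 9/2 * A t + 5 * \<alpha>"
    proof -
      have "\<epsilon> * B t \<le> 1/100 * B t" "\<epsilon> * a t \<le> 1/100 * a t" "\<epsilon> * A t \<le> 1/100 * A t"
        using mult_right_mono[OF eps(2), of "B t"] mult_right_mono[OF eps(2), of "a t"]
          mult_right_mono[OF eps(2), of "A t"] nonneg[OF tt] by auto
      then show ?thesis
        using Q_growth[OF tt] Y_growth[OF tt] Q_le[OF tt] B_ge[OF tt] \<alpha>[OF that] nonneg[OF tt]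
        by (simp add: algebra_simps)
    qed
    ultimately show ?thesis by simp
  qed
  moreover have "(f \<longlongrightarrow> 0) at_top"
  proof (rule bounded_times_tendsto_0)
    fix t assume "t \<ge> T"
    then have tt: "t \<ge> t0" using T by simp
    have e: "1 \<le> exp t" using tt t0 by simp
    have \<alpha>0: "0 \<le> A t" "A t \<le> \<alpha>" using \<alpha>[OF \<open>t \<ge> T\<close>] nonneg[OF tt] by auto
    have \<alpha>1: "\<alpha> \<le> \<alpha> * exp t"
      using \<alpha>0 e mult_left_mono[OF e, of \<alpha>] by simp
    have "\<bar>Q t + Y1 t + 3 * Y t + 3/2 * A t - 5/3 * \<alpha>\<bar> \<le> C0 * exp t + C0 * exp t + 3 * (C0 * exp t) + 4 * \<alpha>"
      using crude[OF tt] \<alpha>0 by linarith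
    also have "\<dots> \<le> (5 * C0 + 4 * \<alpha>) * exp t"
      using \<alpha>1 by (simp add: algebra_simps)
    finally have "\<bar>f t\<bar> \<le> exp (-3*t) * ((5 * C0 + 4 * \<alpha>) * exp t)"
      unfolding f_def abs_mult by (simp add: mult_left_mono)
    also have "\<dots> = (5 * C0 + 4 * \<alpha>) * exp (-2*t)"
      by (simp add: exp_add[symmetric] mult.left_commute)
    finally show "\<bar>f t\<bar> \<le> (5 * C0 + 4 * \<alpha>) * exp (-2*t)" .
  next
    show "((\<lambda>t. (5 * C0 + 4 * \<alpha>) * exp (-2*t)) \<longlongrightarrow> 0) at_top"
      using tendsto_mult[OF tendsto_const exp_neg_tendsto_0[of "-2"], of "5 * C0 + 4 * \<alpha>"] by simp
  qed
  ultimately have "f T \<le> 0" using df nondecreasing_le_limit by blast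
  then have "Q T + Y1 T + 3 * Y T + 3/2 * A T - 5/3 * \<alpha> \<le> 0"
    unfolding f_def by (simp add: mult_le_0_iff)
  then show ?thesis using nonneg(1,2)[OF T] unfolding H_def by linarith
qed

lemma dH: "t \<ge> t0 \<Longrightarrow> (H has_real_derivative (- Q1 t - Y2 t)) (at t)"
  unfolding H_def by (auto intro!: derivative_eq_intros dQ dY1)

lemma eps_le: 
  assumes "t \<ge> t0" shows "\<epsilon> * B t \<le> 1/100 * B t" "\<epsilon> * a t \<le> 1/100 * a t" "0 \<le> B t" "0 \<le> a t"
  using mult_right_mono[OF eps(2), of "B t"] mult_right_mono[OF eps(2), of "a t"] nonneg[OF assms] by auto

text \<open>\<open>H\<close> is nonincreasing, and \<open>H_lower\<close> applied at a late time,
  where \<open>A\<close> is small, bounds its later values from below by an arbitrarily small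
  negative number.\<close>

lemma H_nonneg: 
  assumes T: "T \<ge> t0" shows "0 \<le> H T"
proof (rule field_le_epsilon)
  fix e :: real assume "e > 0"
  then have "eventually (\<lambda>t. A t < 3/5 * e) at_top"
    using order_tendstoD(2)[OF A_lim, of "3/5*e"] by simp
  then obtain T1 where T1: "\<And>t. t \<ge> T1 \<Longrightarrow> A t < 3/5 * e"
    unfolding eventually_at_top_linorder by blast
  define S where "S = max T T1"
  have "H S \<ge> - (5/3) * (3/5 * e)"
    using T T1 unfolding S_def by (intro H_lower) (auto simp: less_imp_le)
  moreover have "H S \<le> H T"
  proof (rule DERIV_nonpos_imp_nonincreasing[of T S H])
    show "T \<le> S" unfolding S_def by simp
    fix t assume "T \<le> t"
    then have tt: "t \<ge> t0" using T by simp
    show "\<exists>y. (H has_real_derivative y) (at t) \<and> y \<le> 0"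
    proof (intro exI conjI)
      show "(H has_real_derivative - Q1 t - Y2 t) (at t)" by (rule dH[OF tt])
      show "- Q1 t - Y2 t \<le> 0"
        using Q_growth[OF tt] Y_growth[OF tt] eps_le[OF tt] by linarith
    qed
  qed
  ultimately show "0 \<le> H T + e" by simp
qed

text \<open>The summand \<open>m * Y\<close> cancels the term \<open>- m * Y1\<close> that the
  weight produces from \<open>H\<close>, so \<open>M1\<close> contains no \<open>Y1\<close>.\<close>

definition "M m t = exp (m * t) * (H t + m * Y t)"
definition "M1 m t = exp (m * t) * (- m * Q t + m^2 * Y t - Q1 t - Y2 t)"

lemma dM: "t \<ge> t0 \<Longrightarrow> (M m has_real_derivative M1 m t) (at t)"
  unfolding M_def M1_def
  by (auto intro!: derivative_eq_intros dH dY) (simp add: H_def algebra_simps power2_eq_square)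

text \<open>The term \<open>m |Q| \<le> m (1/2 + \<epsilon>) a\<close> is absorbed by \<open>Q' \<ge> a - \<dots>\<close> as long as \<open>m < 2\<close>.\<close>

lemma M1_le:
  assumes m: "0 \<le> m" "m \<le> 9/5" and t: "t \<ge> t0"
  shows "M1 m t \<le> - (1/20) * (exp (m * t) * a t)"
proof -
  have "- m * Q t \<le> m * ((1/2 + \<epsilon>) * a t + \<epsilon> * B t)"
    using mult_left_mono[of "- Q t" "(1/2 + \<epsilon>) * a t + \<epsilon> * B t" m] Q_bound[OF t] m(1) by auto
  also have "\<dots> \<le> (9/5) * ((1/2 + \<epsilon>) * a t + \<epsilon> * B t)"
    using m eps nonneg[OF t] by (intro mult_right_mono) auto
  finally have 1: "- m * Q t \<le> (9/5) * ((1/2 + \<epsilon>) * a t + \<epsilon> * B t)" .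
  have "m^2 * Y t \<le> (9/5)^2 * Y t"
    using m nonneg[OF t] by (intro mult_right_mono power_mono) auto
  then have 2: "m^2 * Y t \<le> 4 * Y t" using nonneg(1)[OF t] by (simp add: power2_eq_square)
  \<comment> \<open>For \<open>m = 9/5\<close> the coefficient of \<open>a\<close> is at most 9/5 *
    51/100 - 99/100 = - 9/125, which is below - 1/20. The terms in \<open>Y\<close> are dominated by
    \<open>B\<close>, which is at least \<open>20 * Y\<close>.\<close>
  have "- m * Q t + m^2 * Y t - Q1 t - Y2 t \<le> - (1/20) * a t"
    using 1 2 eps_le[OF t] B_ge[OF t] Q_growth[OF t] Y_growth[OF t]
    by (simp add: algebra_simps)
  then have "exp (m * t) * (- m * Q t + m^2 * Y t - Q1 t - Y2 t) \<le> exp (m * t) * (- (1/20) * a t)"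
    by (intro mult_left_mono) auto
  then show ?thesis unfolding M1_def by (simp add: algebra_simps)
qed

lemma M_nonneg: "0 \<le> m \<Longrightarrow> t \<ge> t0 \<Longrightarrow> 0 \<le> M m t"
  unfolding M_def using H_nonneg[of t] nonneg[of t] by simp

text \<open>\<open>M (9/5)\<close> is nonincreasing, hence bounded by its initial value; a smaller
  weight gains the exponential factor.\<close>

lemma M_bound: 
  obtains C where "C \<ge> 0" "\<And>m t. 0 \<le> m \<Longrightarrow> m \<le> 9/5 \<Longrightarrow> t \<ge> t0 \<Longrightarrow> M m t \<le> C * exp ((m - 9/5) * t)"
proof
  show "0 \<le> M (9/5) t0" using M_nonneg by simp
  fix m t :: real assume m: "0 \<le> m" "m \<le> 9/5" and t: "t \<ge> t0"
  have "M (9/5) t \<le> M (9/5) t0"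
  proof (rule DERIV_nonpos_imp_nonincreasing[OF t])
    fix s assume s: "t0 \<le> s"
    have "0 \<le> exp (9/5 * s) * a s" using nonneg[OF s] by simp
    then show "\<exists>y. (M (9/5) has_real_derivative y) (at s) \<and> y \<le> 0"
      using M1_le[of "9/5" s] s by (intro exI[of _ "M1 (9/5) s"] conjI dM) auto
  qed
  have "M m t \<le> exp (m * t) * (H t + 9/5 * Y t)"
    unfolding M_def using m nonneg[OF t] by (intro mult_left_mono add_left_mono mult_right_mono) auto
  also have "\<dots> = exp ((m - 9/5) * t) * M (9/5) t"
  proof -
    have "exp (m * t) = exp ((m - 9/5) * t) * exp (9/5 * t)"
      by (simp add: exp_add[symmetric] left_diff_distrib)
    then show ?thesis unfolding M_def by (simp add: mult.assoc)
  qed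
  also have "\<dots> \<le> exp ((m - 9/5) * t) * M (9/5) t0"
    using \<open>M (9/5) t \<le> M (9/5) t0\<close> by (intro mult_left_mono) auto
  finally show "M m t \<le> M (9/5) t0 * exp ((m - 9/5) * t)" by (simp add: mult.commute)
qed

text \<open>\<open>A_growth\<close> is used with \<open>k = exp (- m * t)\<close>. Then
  \<open>k * A\<close> has rate \<open>m + \<alpha>\<close>, while
  \<open>a / k = exp (m * t) * a\<close> is at most \<open>- 20 * M1 m\<close>, and
  \<open>M m\<close> has rate \<open>9/5 - m\<close>. The chosen \<open>m\<close> makes the two
  rates equal. The function \<open>f\<close> collects these bounds into a nondecreasing quantity
  with limit 0.\<close>

lemma A_improve:
  assumes al: "0 \<le> \<alpha>" "\<alpha> < 9/5" and C: "C \<ge> 0" "\<And>t. t \<ge> t0 \<Longrightarrow> A t \<le> C * exp (- \<alpha> * t)"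
  obtains C' where "C' \<ge> 0" "\<And>t. t \<ge> t0 \<Longrightarrow> A t \<le> C' * exp (- (9/10 + \<alpha>/2) * t)"
proof -
  define m where "m = (9/5 - \<alpha>) / 2"
  have m: "0 < m" "m \<le> 9/10" "m + \<alpha> = 9/10 + \<alpha>/2" "m - 9/5 = - (9/10 + \<alpha>/2)" "0 < m + \<alpha>"
    unfolding m_def using al by (auto simp: field_simps)
  obtain C1 where C1: "C1 \<ge> 0" "\<And>m t. 0 \<le> m \<Longrightarrow> m \<le> 9/5 \<Longrightarrow> t \<ge> t0 \<Longrightarrow> M m t \<le> C1 * exp ((m - 9/5) * t)"
    using M_bound by blast
  define f where "f t = A t - 20 * M m t - C / (m + \<alpha>) * exp (- (m + \<alpha>) * t)" for t
  have lim: "((\<lambda>t. K * exp (- (m + \<alpha>) * t)) \<longlongrightarrow> 0) at_top" for K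
  proof -
    have "- (m + \<alpha>) < 0" using m(5) by simp
    from tendsto_mult[OF tendsto_const[of K] exp_neg_tendsto_0[OF this]] show ?thesis by simp
  qed
  have fle: "f T \<le> 0" if T: "T \<ge> t0" for T
  proof (rule nondecreasing_le_limit[of T f "\<lambda>t. A1 t - 20 * M1 m t + C * exp (- (m + \<alpha>) * t)"])
    fix t assume "t \<ge> T"
    then have t: "t \<ge> t0" using T by simp
    show "(f has_real_derivative (A1 t - 20 * M1 m t + C * exp (- (m + \<alpha>) * t))) (at t)"
    proof -
      have c: "C / (m + \<alpha>) * (- (m + \<alpha>)) = - C" using m(5) by (simp add: field_simps)
      have "((\<lambda>t. C / (m + \<alpha>) * exp (- (m + \<alpha>) * t)) has_real_derivative
          C / (m + \<alpha>) * (exp (- (m + \<alpha>) * t) * (- (m + \<alpha>)))) (at t)"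
        by (rule derivative_eq_intros refl | simp)+
      moreover have "C / (m + \<alpha>) * (exp (- (m + \<alpha>) * t) * (- (m + \<alpha>))) = - C * exp (- (m + \<alpha>) * t)"
        using c by (metis mult.assoc mult.commute)
      ultimately have "((\<lambda>t. C / (m + \<alpha>) * exp (- (m + \<alpha>) * t)) has_real_derivative
          - C * exp (- (m + \<alpha>) * t)) (at t)" by simp
      from DERIV_diff[OF DERIV_diff[OF dA[OF t] DERIV_cmult[OF dM[OF t], of 20]] this]
      show ?thesis unfolding f_def by simp
    qed
    have "A1 t \<ge> - (exp (- m * t) * A t + a t / exp (- m * t))"
      using A_growth[OF t, of "exp (- m * t)"] by auto
    moreover have "exp (- m * t) * A t \<le> exp (- m * t) * (C * exp (- \<alpha> * t))"
      using C(2)[OF t] by (intro mult_left_mono) auto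
    moreover have "exp (- m * t) * (C * exp (- \<alpha> * t)) = C * exp (- (m + \<alpha>) * t)"
      by (simp add: algebra_simps exp_add[symmetric])
    moreover have "a t / exp (- m * t) = exp (m * t) * a t"
      by (simp add: exp_minus divide_inverse)
    moreover have "exp (m * t) * a t \<le> -20 * M1 m t"
      using M1_le[of m t] m t by auto
    ultimately show "0 \<le> A1 t - 20 * M1 m t + C * exp (- (m + \<alpha>) * t)" by linarith
  next
    have "(M m \<longlongrightarrow> 0) at_top"
    proof (rule bounded_times_tendsto_0[OF _ lim[of C1]])
      fix t assume "t0 \<le> t"
      then show "\<bar>M m t\<bar> \<le> C1 * exp (- (m + \<alpha>) * t)"
        using C1(2)[of m t] M_nonneg[of m t] m(1,2) unfolding m(4) m(3)[symmetric] by auto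
    qed
    then show "(f \<longlongrightarrow> 0) at_top" 
      unfolding f_def
      using tendsto_diff[OF tendsto_diff[OF A_lim tendsto_mult_right_zero[of "M m" at_top 20]] lim[of "C / (m + \<alpha>)"]]
      by simp
  qed
  show ?thesis
  proof (rule that)
    show "0 \<le> 20 * C1 + C / (m + \<alpha>)" using C1 C m by simp
    fix t assume t: "t \<ge> t0"
    show "A t \<le> (20 * C1 + C / (m + \<alpha>)) * exp (- (9/10 + \<alpha>/2) * t)"
    proof -
      have "M m t \<le> C1 * exp (- (m + \<alpha>) * t)"
        using C1(2)[of m t] m(1,2) t unfolding m(4) m(3)[symmetric] by auto
      then have "A t \<le> (20 * C1 + C / (m + \<alpha>)) * exp (- (m + \<alpha>) * t)"
        using fle[OF t] unfolding f_def distrib_right by linarith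
      then show ?thesis unfolding m(3) .
    qed
  qed
qed

text \<open>Boundedness is the rate 0, and the rounds give 9/10, 27/20 and 63/40. The third round is
  needed: with 27/20 the final rate of \<open>X\<close> would be 27/10 - 2 + 1 = 17/10, which is
  less than 2.\<close>

lemma A_decay: 
  obtains C where "C \<ge> 0" "\<And>t. t \<ge> t0 \<Longrightarrow> A t \<le> C * exp (- (63/40) * t)"
proof -
  have cont: "continuous_on {t0..S} A" for S
    using dA by (intro continuous_at_imp_continuous_on ballI) (auto intro!: DERIV_isCont)
  have "eventually (\<lambda>t. A t < 1) at_top"
    using order_tendstoD(2)[OF A_lim, of 1] by simp
  then obtain S where S: "\<And>t. t \<ge> S \<Longrightarrow> A t < 1"
    unfolding eventually_at_top_linorder by blast
  have "bounded (A ` {t0..S})"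
    by (rule compact_imp_bounded[OF compact_continuous_image[OF cont[of S] compact_Icc]])
  then obtain K where "\<forall>x\<in>A ` {t0..S}. norm x \<le> K"
    unfolding bounded_iff by blast
  then have K: "\<And>t. t \<in> {t0..S} \<Longrightarrow> A t \<le> K" by (auto simp: abs_le_iff)
  have b: "A t \<le> max K 1 * exp (- 0 * t)" if "t \<ge> t0" for t
    using S[of t] K[of t] that by (cases "t \<ge> S") auto
  have step: "\<exists>C'\<ge>0. \<forall>t\<ge>t0. A t \<le> C' * exp (- (9/10 + \<alpha>/2) * t)"
    if "0 \<le> \<alpha>" "\<alpha> < 9/5" "\<exists>C\<ge>0. \<forall>t\<ge>t0. A t \<le> C * exp (- \<alpha> * t)" for \<alpha>
    using A_improve that by metis
  have "\<exists>C\<ge>0. \<forall>t\<ge>t0. A t \<le> C * exp (- 0 * t)"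
    using b by (intro exI[of _ "max K 1"]) auto
  from step[OF _ _ this] have "\<exists>C\<ge>0. \<forall>t\<ge>t0. A t \<le> C * exp (- (9/10) * t)" by simp
  from step[OF _ _ this] have "\<exists>C\<ge>0. \<forall>t\<ge>t0. A t \<le> C * exp (- (27/20) * t)" by simp
  from step[OF _ _ this] have "\<exists>C\<ge>0. \<forall>t\<ge>t0. A t \<le> C * exp (- (63/40) * t)" by simp
  then show ?thesis using that by blast
qed

text \<open>The forcing \<open>A * a\<close> is known only as the derivative of a decaying function
  \<open>N\<close>. Therefore the operator \<open>X'' - exp (2 t) * X\<close> is essentially
  factored into \<open>d/dt - exp t\<close> and \<open>d/dt + exp t\<close>. The first factor, with
  the crude bounds, yields \<open>X' + exp t * X \<le> N\<close>; the second is then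
  integrated.\<close>

lemma X_decay: 
  obtains C where "C \<ge> 0" "\<And>t. t \<ge> t0 \<Longrightarrow> X t \<le> C * exp (- (43/20) * t)"
proof -
  obtain C1 where C1: "C1 \<ge> 0" "\<And>t. t \<ge> t0 \<Longrightarrow> A t \<le> C1 * exp (- (63/40) * t)"
    using A_decay by blast
  obtain C2 where C2: "C2 \<ge> 0" "\<And>m t. 0 \<le> m \<Longrightarrow> m \<le> 9/5 \<Longrightarrow> t \<ge> t0 \<Longrightarrow> M m t \<le> C2 * exp ((m - 9/5) * t)"
    using M_bound by blast
  \<comment> \<open>\<open>- N1\<close> dominates the forcing. The factor 23/2 = 10 * 23/20 covers
    the 10 in front of \<open>A * A\<close>, and 100 = 5 * 20 comes from \<open>M1_le\<close> at
    \<open>m = 17/40 = 2 - 63/40\<close>.\<close>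
  define N where "N t = 10 * C1^2 * exp (- (23/20) * t) + 100 * C1 * M (17/40) t" for t
  define N1 where "N1 t = - 23/2 * C1^2 * exp (- (23/20) * t) + 100 * C1 * M1 (17/40) t" for t
  have dN: "(N has_real_derivative N1 t) (at t)" if "t \<ge> t0" for t
    unfolding N_def N1_def using that by (auto intro!: derivative_eq_intros dM)
  have N_le: "N t \<le> (10 * C1^2 + 100 * C1 * C2) * exp (- (23/20) * t)" and N_nonneg: "0 \<le> N t" if "t \<ge> t0" for t
  proof -
    have "M (17/40) t \<le> C2 * exp (- (23/20) * t)"
    proof -
      have "M (17/40) t \<le> C2 * exp ((17/40 - 9/5) * t)" using that by (intro C2(2)) auto
      also have "\<dots> \<le> C2 * exp (- (23/20) * t)"
        using C2(1) that t0 by (intro mult_left_mono) auto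
      finally show ?thesis .
    qed
    then have "100 * C1 * M (17/40) t \<le> 100 * C1 * (C2 * exp (- (23/20) * t))"
      using C1 by (intro mult_left_mono) auto
    then show "N t \<le> (10 * C1^2 + 100 * C1 * C2) * exp (- (23/20) * t)"
      unfolding N_def by (simp add: algebra_simps)
    show "0 \<le> N t" unfolding N_def using C1(1) M_nonneg[of "17/40" t] that by simp
  qed
  have N1_le: "exp (2*t) * (5 * (A t * (2 * A t + a t))) \<le> - N1 t" if t: "t \<ge> t0" for t
  proof -
    have "A t * A t \<le> (C1 * exp (- (63/40) * t)) * (C1 * exp (- (63/40) * t))"
      using C1 nonneg[OF t] t by (intro mult_mono) auto
    also have "\<dots> = C1^2 * exp (- (63/20) * t)"
      by (simp add: power2_eq_square exp_add[symmetric] algebra_simps)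
    finally have "exp (2*t) * (A t * A t) \<le> exp (2*t) * (C1^2 * exp (- (63/20) * t))"
      by (intro mult_left_mono) auto
    also have "\<dots> = C1^2 * exp (- (23/20) * t)"
      by (simp add: exp_add[symmetric] algebra_simps)
    finally have 1: "exp (2*t) * (A t * A t) \<le> C1^2 * exp (- (23/20) * t)" .
    have "exp (2*t) * (A t * a t) \<le> exp (2*t) * ((C1 * exp (- (63/40) * t)) * a t)"
      using C1 nonneg[OF t] t by (intro mult_left_mono mult_right_mono) auto
    also have "\<dots> = C1 * (exp (17/40 * t) * a t)"
      by (simp add: exp_add[symmetric] algebra_simps)
    also have "\<dots> \<le> C1 * (- 20 * M1 (17/40) t)"
      using C1 M1_le[of "17/40" t] t by (intro mult_left_mono) auto
    finally have 2: "exp (2*t) * (A t * a t) \<le> C1 * (- 20 * M1 (17/40) t)" .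
    have 3: "0 \<le> C1\<^sup>2 * exp (- (23/20) * t)" by simp
    have "exp (2*t) * (5 * (A t * (2 * A t + a t))) = 10 * (exp (2*t) * (A t * A t)) + 5 * (exp (2*t) * (A t * a t))"
      by (simp add: algebra_simps)
    also have "\<dots> \<le> - N1 t" unfolding N1_def using 1 2 3 by linarith
    finally show ?thesis .
  qed
  have N_mono: "N t \<le> N t0" if t: "t \<ge> t0" for t
  proof (rule DERIV_nonpos_imp_nonincreasing[OF t])
    fix s assume s: "t0 \<le> s"
    have "0 \<le> A s * (2 * A s + a s)" using nonneg(2,4)[OF s] by simp
    then have "0 \<le> exp (2 * s) * (5 * (A s * (2 * A s + a s)))" by simp
    then have "N1 s \<le> 0" using N1_le[OF s] by linarith
    then show "\<exists>y. (N has_real_derivative y) (at s) \<and> y \<le> 0"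
      using dN[OF s] by blast
  qed
  \<comment> \<open>The surplus \<open>2 * X\<close> in \<open>X_growth\<close> and the sign of
    \<open>N\<close> give \<open>p' \<ge> exp t * p\<close>. A positive value of \<open>p\<close>
    would thus grow like \<open>exp (exp t)\<close>, against the bound of order
    \<open>exp t\<close>.\<close>
  define p where "p t = X1 t - N t + exp t * X t" for t
  define p1 where "p1 t = X2 t - N1 t + (exp t * X t + exp t * X1 t)" for t
  have dp: "(p has_real_derivative p1 t) (at t)" if "t \<ge> t0" for t
    unfolding p_def p1_def using that by (auto intro!: derivative_eq_intros dX dX1 dN)
  have p1: "exp t * p t \<le> p1 t" if t: "t \<ge> t0" for t
  proof -
    have "exp t * (exp t * X t) = exp (2*t) * X t" by (simp add: exp_add[symmetric] mult.assoc[symmetric])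
    moreover have "0 \<le> exp (2*t) * X t" "0 \<le> exp t * X t" "0 \<le> exp t * N t"
      using nonneg[OF t] N_nonneg[OF t] by auto
    moreover have "exp t * p t = exp t * X1 t - exp t * N t + exp t * (exp t * X t)"
      unfolding p_def by (simp add: algebra_simps)
    moreover have "exp (2*t) * (2 * X t - 5 * (A t * (2 * A t + a t))) =
        2 * (exp (2*t) * X t) - exp (2*t) * (5 * (A t * (2 * A t + a t)))"
      by (simp add: algebra_simps)
    ultimately show ?thesis
      using X_growth[OF t] N1_le[OF t] unfolding p1_def by linarith
  qed
  have p_nonpos: "p T \<le> 0" if T: "T \<ge> t0" for T
  proof (rule ccontr)
    assume np: "\<not> p T \<le> 0"
    define g where "g t = exp (- exp t) * p t" for t
    have g: "g T \<le> g t" if tT: "t \<ge> T" for t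
    proof (rule DERIV_nonneg_imp_nondecreasing[OF tT])
      fix s assume s: "T \<le> s"
      have "exp (- exp s) * (p1 s - exp s * p s) \<ge> 0"
        using p1[of s] s T by simp
      moreover have "(g has_real_derivative exp (- exp s) * (p1 s - exp s * p s)) (at s)"
        unfolding g_def using s T by (auto intro!: derivative_eq_intros dp simp: algebra_simps)
      ultimately show "\<exists>y. (g has_real_derivative y) (at s) \<and> y \<ge> 0" by blast
    qed
    have "((\<lambda>t. - g t) \<longlongrightarrow> 0) at_top"
    proof (rule bounded_times_tendsto_0)
      fix t assume "t \<ge> t0"
      have "N t \<le> N t0" by (rule N_mono[OF \<open>t0 \<le> t\<close>])
      moreover have "N t0 \<le> N t0 * exp t"
        using N_nonneg[of t0] \<open>t0 \<le> t\<close> t0 mult_left_mono[of 1 "exp t" "N t0"] by simp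
      moreover have "\<bar>exp t * X t\<bar> \<le> exp t * C0"
        unfolding abs_mult using crude(5)[OF \<open>t0 \<le> t\<close>] by (simp add: mult_left_mono)
      ultimately have "\<bar>p t\<bar> \<le> (2 * C0 + N t0) * exp t"
        unfolding p_def using crude[OF \<open>t0 \<le> t\<close>] N_nonneg[OF \<open>t0 \<le> t\<close>] by (simp add: algebra_simps)
      then have "\<bar>- g t\<bar> \<le> exp (- exp t) * ((2 * C0 + N t0) * exp t)"
        unfolding g_def abs_minus_cancel abs_mult by (simp add: mult_left_mono)
      also have "\<dots> = (2 * C0 + N t0) * (exp t * exp (- exp t))" by simp
      finally show "\<bar>- g t\<bar> \<le> (2 * C0 + N t0) * (exp t * exp (- exp t))" .
    next
      have "((\<lambda>t::real. exp t ^ 1 / exp (exp t)) \<longlongrightarrow> 0) at_top"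
        by (rule filterlim_compose[OF tendsto_power_div_exp_0 exp_at_top])
      then have "((\<lambda>t::real. exp t * exp (- exp t)) \<longlongrightarrow> 0) at_top"
        by (simp add: exp_minus divide_inverse)
      from tendsto_mult[OF tendsto_const this]
      show "((\<lambda>t. (2 * C0 + N t0) * (exp t * exp (- exp t))) \<longlongrightarrow> 0) at_top" by fastforce
    qed
    then have "(g \<longlongrightarrow> 0) at_top" using tendsto_minus by force
    then have "g T \<le> 0"
      by (rule tendsto_lowerbound) (auto intro: eventually_mono[OF eventually_ge_at_top[of T] g])
    then show False using np unfolding g_def by (simp add: mult_le_0_iff)
  qed
  define C where "C = 10 * C1^2 + 100 * C1 * C2"
  have C: "0 \<le> C" unfolding C_def using C1 C2 by simp
  \<comment> \<open>The part \<open>2 * C\<close> lets half of \<open>D\<close> dominate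
    \<open>N\<close>, and leaves enough to pay for the derivative of the comparison function. The
    other part makes the comparison hold at \<open>t0\<close>.\<close>
  define D where "D = 2 * C + X t0 * exp (43/20 * t0)"
  have D: "0 \<le> D" "2 * C \<le> D" unfolding D_def using C nonneg(3)[of t0] by auto
  have "X t \<le> D * exp (- (43/20) * t)" if tt: "t \<ge> t0" for t
  proof -
    \<comment> \<open>\<open>exp (exp t)\<close> is the integrating factor of
      \<open>d/dt + exp t\<close>.\<close>
    define h where "h t = exp (exp t) * (X t - D * exp (- (43/20) * t))" for t
    have "h t \<le> h t0"
    proof (rule DERIV_nonpos_imp_nonincreasing[OF tt])
      fix s assume s: "t0 \<le> s"
      let ?d = "exp (exp s) * (exp s * X s - D * (exp s * exp (- (43/20) * s)) + X1 s + 43/20 * (D * exp (- (43/20) * s)))"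
      have "(h has_real_derivative ?d) (at s)"
        unfolding h_def using s by (auto intro!: derivative_eq_intros dX simp: algebra_simps)
      moreover have "?d \<le> 0"
      proof -
        have e: "exp s * exp (- (43/20) * s) = exp (- (23/20) * s)" by (simp add: exp_add[symmetric])
        have "exp s \<ge> 10" using exp_ge_add_one_self[of s] s t0 by linarith
        then have "10 * (D * exp (- (43/20) * s)) \<le> exp s * (D * exp (- (43/20) * s))"
          using D by (intro mult_right_mono) auto
        also have "\<dots> = D * exp (- (23/20) * s)" using e by (simp add: mult.left_commute)
        finally have 1: "10 * (D * exp (- (43/20) * s)) \<le> D * exp (- (23/20) * s)" .
        have "exp s * X s + X1 s \<le> N s" using p_nonpos[OF s] unfolding p_def by simp
        also have "\<dots> \<le> C * exp (- (23/20) * s)" using N_le[OF s] unfolding C_def by simp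
        finally have "2 * (exp s * X s + X1 s) \<le> (2 * C) * exp (- (23/20) * s)" by simp
        also have "\<dots> \<le> D * exp (- (23/20) * s)" using D by (intro mult_right_mono) auto
        finally have 2: "2 * (exp s * X s + X1 s) \<le> D * exp (- (23/20) * s)" .
        have 3: "0 \<le> D * exp (- (43/20) * s)" using D by simp
        have "exp s * X s - D * (exp s * exp (- (43/20) * s)) + X1 s + 43/20 * (D * exp (- (43/20) * s)) \<le> 0"
        proof -
          define z where "z = D * exp (- (23/20) * s)"
          define y where "y = D * exp (- (43/20) * s)"
          define x where "x = exp s * X s"
          have "10 * y \<le> z" "2 * (x + X1 s) \<le> z" "0 \<le> y" using 1 2 3 unfolding z_def y_def x_def by simp_all
          then have "x - z + X1 s + 43/20 * y \<le> 0" by (simp add: field_simps)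
          then show ?thesis unfolding e z_def y_def x_def .
        qed
        then show ?thesis by (simp add: mult_le_0_iff)
      qed
      ultimately show "\<exists>y. (h has_real_derivative y) (at s) \<and> y \<le> 0" by blast
    qed
    also have "h t0 \<le> 0"
    proof -
      have "D * exp (- (43/20) * t0) = 2 * C * exp (- (43/20) * t0) + X t0"
        unfolding D_def by (simp add: algebra_simps exp_minus)
      moreover have "0 \<le> 2 * C * exp (- (43/20) * t0)" using C by simp
      ultimately show ?thesis unfolding h_def by (simp add: mult_le_0_iff)
    qed
    finally show ?thesis unfolding h_def by (simp add: mult_le_0_iff)
  qed
  then show ?thesis using D that by blast
qed

end

section \<open>Pointwise inequalities\<close>

lemma small_triple:
  fixes a b c \<eta> :: real
  assumes "\<bar>c\<bar> \<le> \<eta>"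
  shows "\<bar>a * b * c\<bar> \<le> \<eta> / 2 * (a^2 + b^2)"
proof -
  have "\<bar>a * b\<bar> \<le> (a^2 + b^2) / 2"
    using sum_squares_bound[of a b] sum_squares_bound[of "-a" b] by (simp add: abs_le_iff)
  then have "\<bar>a * b\<bar> * \<bar>c\<bar> \<le> (a^2 + b^2) / 2 * \<eta>"
    using assms by (intro mult_mono) auto
  then show ?thesis by (simp add: abs_mult mult_ac)
qed

lemma square_bound:
  fixes x \<eta> :: real
  assumes "\<bar>x\<bar> \<le> \<eta>" shows "x^2 \<le> \<eta>^2"
  using power_mono[OF assms abs_ge_zero, of 2] by simp

lemma Cauchy2:
  fixes a b c d :: real
  shows "(a * b + c * d)^2 \<le> (a^2 + c^2) * (b^2 + d^2)"
  using zero_le_power2[of "a * d - b * c"] by (simp add: power2_eq_square algebra_simps)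

text \<open>The left side is the squared divergence of \<open>v\<close> when
  \<open>div v = - 2 s \<bullet> v\<close>.\<close>

lemma divergence_bound:
  fixes s1 s2 v1 v2 :: real
  assumes "\<bar>v1\<bar> \<le> 1/1000" "\<bar>v2\<bar> \<le> 1/1000"
  shows "4 * (s1 * v1 + s2 * v2)^2 \<le> 1/100000 * (s1^2 + s2^2)"
proof -
  have "v1^2 + v2^2 \<le> (1/1000)^2 + (1/1000)^2"
    using assms by (intro add_mono square_bound)
  then have "(s1^2 + s2^2) * (v1^2 + v2^2) \<le> (s1^2 + s2^2) * (2 / 1000000)"
    by (intro mult_left_mono) (auto simp: power2_eq_square)
  then have "4 * (s1 * v1 + s2 * v2)^2 \<le> 4 * ((s1^2 + s2^2) * (2 / 1000000))"
    using Cauchy2[of s1 v1 s2 v2] by linarith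
  also have "\<dots> \<le> 1/100000 * (s1^2 + s2^2)"
    using mult_right_mono[of "8/1000000" "1/100000" "s1^2 + s2^2"] by simp
  finally show ?thesis .
qed

text \<open>Minus twice the determinant of a symmetric matrix is its squared Frobenius norm minus
  its squared trace, and the trace is the small divergence.\<close>

lemma gradient_growth:
  fixes s1 s2 v1 v2 V11 V12 V22 :: real
  assumes "\<bar>v1\<bar> \<le> 1/1000" "\<bar>v2\<bar> \<le> 1/1000"
    and "V11 + V22 = - 2 * (s1 * v1 + s2 * v2)"
  shows "V11^2 + 2 * V12^2 + V22^2 - 1/100 * (s1^2 + s2^2) \<le> - 2 * (V11 * V22 - V12^2)"
proof -
  have "- 2 * (V11 * V22 - V12^2) = V11^2 + 2 * V12^2 + V22^2 - (V11 + V22)^2"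
    by (simp add: power2_eq_square algebra_simps)
  moreover have "(V11 + V22)^2 = 4 * (s1 * v1 + s2 * v2)^2" unfolding assms(3) by (simp only: power_mult_distrib) simp
  moreover have "N - 1/100 * S \<le> D" if "D = N - T" "T = Z" "Z \<le> 1/100000 * S" "0 \<le> S" for N S D T Z :: real
    using that by simp
  ultimately show ?thesis using divergence_bound[OF assms(1,2), of s1 s2] sum_power2_ge_zero[of s1 s2] by blast
qed

text \<open>Cauchy-Schwarz between the symmetric matrix \<open>V\<close> and the rank-one matrix of
  the vector \<open>(- y, x)\<close>, written as a sum of squares.\<close>

lemma quadratic_form_bound:
  fixes x y V11 V12 V22 :: real
  shows "(y^2 * V11 - 2 * x * y * V12 + x^2 * V22)^2 \<le> (x^2 + y^2)^2 * (V11^2 + 2 * V12^2 + V22^2)"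
proof -
  have "(x^2 + y^2)^2 * (V11^2 + 2 * V12^2 + V22^2) - (y^2 * V11 - 2 * x * y * V12 + x^2 * V22)^2
    = (x^2 * V11 - y^2 * V22)^2 + 2 * (x * y * V11 + y^2 * V12)^2 + 2 * (x * y * V22 + x^2 * V12)^2"
    by (simp add: power2_eq_square algebra_simps)
  then show ?thesis by (smt (verit) zero_le_power2)
qed

text \<open>A trace-free symmetric 2x2 matrix satisfies \<open>|V p|^2 = |p|^2 * |V|^2 / 2\<close>;
  this is the origin of the factor 1/2 in the bound on \<open>Q\<close>. In general Cayley-Hamilton
  adds the terms with the trace \<open>T\<close> in \<open>id\<close>.\<close>

lemma rotation_bound:
  fixes x y s1 s2 v1 v2 V11 V12 V22 :: real
  assumes v: "\<bar>v1\<bar> \<le> 1/1000" "\<bar>v2\<bar> \<le> 1/1000"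
    and tr: "V11 + V22 = - 2 * (s1 * v1 + s2 * v2)" and xy: "x^2 + y^2 > 0"
  shows "(- y * V11 + x * V12)^2 + (- y * V12 + x * V22)^2
    \<le> (x^2 + y^2) * ((1/2 + 1/100) * (V11^2 + 2 * V12^2 + V22^2) + 1/100 * (s1^2 + s2^2))"
proof -
  define r N T z where "r = x^2 + y^2" and "N = V11^2 + 2 * V12^2 + V22^2" and "T = V11 + V22"
    and "z = y^2 * V11 - 2 * x * y * V12 + x^2 * V22"
  have r: "r > 0" using xy unfolding r_def .
  have id: "(- y * V11 + x * V12)^2 + (- y * V12 + x * V22)^2 = r * N / 2 - r * T^2 / 2 + T * z"
    unfolding r_def N_def T_def z_def by (simp add: power2_eq_square field_simps)
  have "z^2 \<le> r^2 * N" unfolding z_def r_def N_def by (rule quadratic_form_bound)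
  have "T * z \<le> r * (1/100 * N + 25 * T^2)"
  proof -
    \<comment> \<open>Young's inequality weighted so that \<open>N\<close> receives only 1/100; the
      large weight 25 falls on the squared trace, which is tiny.\<close>
    have "0 \<le> (z / (10 * r) - 5 * T)^2 * r" using r by simp
    also have "\<dots> = z^2 / (100 * r) - T * z + 25 * T^2 * r"
      using r by (simp add: power2_eq_square field_simps)
    finally have "T * z \<le> z^2 / (100 * r) + 25 * T^2 * r" by simp
    moreover have "z^2 / (100 * r) \<le> r * N / 100"
      using \<open>z^2 \<le> r^2 * N\<close> r by (simp add: field_simps power2_eq_square)
    ultimately show ?thesis by (simp add: algebra_simps)
  qed
  moreover have "25 * T^2 \<le> 1/100 * (s1^2 + s2^2)"
  proof -
    have "T^2 = 4 * (s1 * v1 + s2 * v2)^2" unfolding T_def tr by (simp only: power_mult_distrib) simp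
    moreover have "25 * T' \<le> 1/100 * S" if "T' = Z" "Z \<le> 1/100000 * S" "0 \<le> S" for T' Z S :: real
      using that by simp
    ultimately show ?thesis using divergence_bound[OF v, of s1 s2] sum_power2_ge_zero[of s1 s2] by blast
  qed
  moreover have "0 \<le> r * T^2 / 2" using r by simp
  ultimately have "r * N / 2 - r * T^2 / 2 + T * z \<le> r * N / 2 + r * (1/100 * N + 1/100 * (s1^2 + s2^2))"
    using r mult_left_mono[of "1/100 * N + 25 * T^2" "1/100 * N + 1/100 * (s1^2 + s2^2)" r] by linarith
  also have "\<dots> = r * ((1/2 + 1/100) * N + 1/100 * (s1^2 + s2^2))" by (simp add: algebra_simps)
  finally show ?thesis unfolding id unfolding r_def N_def .
qed

text \<open>With \<open>p1\<close>, \<open>p2\<close> the Laplacians of \<open>s1\<close>,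
  \<open>s2\<close>, the right side is the Laplacian of \<open>|s|^2\<close>. The mass term
  contributes \<open>4 * (1 - \<xi>) * |s|^2\<close>, which dominates every product containing a
  small factor.\<close>

lemma modulus_growth:
  fixes \<xi> s1 s2 v1 v2 S11 S12 S22 V11 V12 V22 p1 p2 :: real
  assumes small: "\<bar>\<xi>\<bar> \<le> 1/1000" "\<bar>v1\<bar> \<le> 1/1000" "\<bar>v2\<bar> \<le> 1/1000" "\<bar>S11\<bar> \<le> 1/1000" "\<bar>S12\<bar> \<le> 1/1000" "\<bar>S22\<bar> \<le> 1/1000"
    and p1: "p1 = 2 * (1 - \<xi>) * s1 - 2 * (s1 * S11 + s2 * S12) + 2 * (v1 * V11 + v2 * V12)"
    and p2: "p2 = 2 * (1 - \<xi>) * s2 - 2 * (s1 * S12 + s2 * S22) + 2 * (v1 * V12 + v2 * V22)"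
  shows "s1^2 + s2^2 - 1/100 * (V11^2 + 2 * V12^2 + V22^2)
    \<le> 2 * (S11^2 + 2 * S12^2 + S22^2) + 2 * (s1 * p1 + s2 * p2)"
proof -
  have eq: "s1 * p1 + s2 * p2 = 2 * ((1 - \<xi>) * (s1^2 + s2^2))
     - 2 * (s1 * s1 * S11 + 2 * (s1 * s2 * S12) + s2 * s2 * S22)
     + 2 * (s1 * V11 * v1 + s1 * V12 * v2 + s2 * V12 * v1 + s2 * V22 * v2)"
    unfolding p1 p2 by (simp add: power2_eq_square algebra_simps)
  have lin: "a + b - 1/100 * (c + 2 * d + e) \<le> 2 * (f + 2 * g + h) + 2 * (2 * m - 2 * (t1 + 2 * t2 + t3) + 2 * (t4 + t5 + t6 + t7))"
    if "t1 \<le> 1/1000 / 2 * (a + a)" "t2 \<le> 1/1000 / 2 * (a + b)" "t3 \<le> 1/1000 / 2 * (b + b)"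
      "- t4 \<le> 1/1000 / 2 * (a + c)" "- t5 \<le> 1/1000 / 2 * (a + d)" "- t6 \<le> 1/1000 / 2 * (b + d)" "- t7 \<le> 1/1000 / 2 * (b + e)"
      "(999/1000) * (a + b) \<le> m" "0 \<le> a" "0 \<le> b" "0 \<le> c" "0 \<le> d" "0 \<le> e" "0 \<le> f" "0 \<le> g" "0 \<le> h"
    for a b c d e f g h m t1 t2 t3 t4 t5 t6 t7 :: real
    using that by (simp add: field_simps)
  have "(1 - \<xi>) * (s1^2 + s2^2) \<ge> (999/1000) * (s1^2 + s2^2)"
    using small(1) by (intro mult_right_mono) auto
  then show ?thesis unfolding eq
    by (intro lin abs_le_D1[OF small_triple] abs_le_D2[OF small_triple] small zero_le_power2)
qed

text \<open>For a divergence-free symmetric Jacobian the left side equals the radial derivative of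
  \<open>|v|^2\<close>. The deviation is \<open>- 2 (div v) (v \<bullet> x)\<close>, quadratic in
  \<open>v\<close> and linear in \<open>s\<close>.\<close>

lemma flux_bound:
  fixes x y s1 s2 v1 v2 V11 V12 V22 :: real
  assumes v: "\<bar>v1\<bar> \<le> 1/1000" "\<bar>v2\<bar> \<le> 1/1000"
    and tr: "V11 + V22 = - 2 * (s1 * v1 + s2 * v2)"
  shows "2 * (v2 * (- y * V11 + x * V12) - v1 * (- y * V12 + x * V22))
    \<le> x * (2 * (v1 * V11 + v2 * V12)) + y * (2 * (v1 * V12 + v2 * V22))
      + 1/100 * (v1^2 + v2^2 + (x^2 + y^2) * (s1^2 + s2^2))"
proof -
  have "2 * (v2 * (- y * V11 + x * V12) - v1 * (- y * V12 + x * V22))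
    = x * (2 * (v1 * V11 + v2 * V12)) + y * (2 * (v1 * V12 + v2 * V22)) - 2 * (V11 + V22) * (v1 * x + v2 * y)"
    by (simp add: algebra_simps)
  also have "2 * (V11 + V22) * (v1 * x + v2 * y) = 
    - 4 * ((s1 * x) * v1 * v1 + (s1 * y) * v2 * v1 + (s2 * x) * v1 * v2 + (s2 * y) * v2 * v2)"
    unfolding tr by (simp add: algebra_simps)
  finally have "2 * (v2 * (- y * V11 + x * V12) - v1 * (- y * V12 + x * V22))
    = x * (2 * (v1 * V11 + v2 * V12)) + y * (2 * (v1 * V12 + v2 * V22))
     + 4 * ((s1 * x) * v1 * v1 + (s1 * y) * v2 * v1 + (s2 * x) * v1 * v2 + (s2 * y) * v2 * v2)" by simp
  note eq = this
  have lin: "4 * (p + q + r + t) \<le> 1/100 * (v1^2 + v2^2 + (x^2 + y^2) * (s1^2 + s2^2))"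
    if "\<bar>p\<bar> \<le> 1/1000 / 2 * ((s1 * x)^2 + v1^2)" "\<bar>q\<bar> \<le> 1/1000 / 2 * ((s1 * y)^2 + v2^2)"
      "\<bar>r\<bar> \<le> 1/1000 / 2 * ((s2 * x)^2 + v1^2)" "\<bar>t\<bar> \<le> 1/1000 / 2 * ((s2 * y)^2 + v2^2)" for p q r t
  proof -
    have "(x^2 + y^2) * (s1^2 + s2^2) = (s1 * x)^2 + (s1 * y)^2 + (s2 * x)^2 + (s2 * y)^2"
      by (simp add: power2_eq_square algebra_simps)
    moreover have "4 * (p + q + r + t) \<le> 1/100 * (e + f + (a + b + c + d))"
      if "\<bar>p\<bar> \<le> 1/1000 / 2 * (a + e)" "\<bar>q\<bar> \<le> 1/1000 / 2 * (b + f)" "\<bar>r\<bar> \<le> 1/1000 / 2 * (c + e)" "\<bar>t\<bar> \<le> 1/1000 / 2 * (d + f)"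
        "0 \<le> a" "0 \<le> b" "0 \<le> c" "0 \<le> d" "0 \<le> e" "0 \<le> f" for a b c d e f :: real
      using that by (simp add: abs_le_iff)
    ultimately show ?thesis using that by simp
  qed
  show ?thesis unfolding eq
    by (intro add_left_mono lin small_triple v)
qed

lemma matrix_vector_bound:
  fixes x y V11 V12 V22 :: real
  shows "(x * V11 + y * V12)^2 + (x * V12 + y * V22)^2 \<le> (x^2 + y^2) * (V11^2 + 2 * V12^2 + V22^2)"
  using Cauchy2[of x V11 y V12] Cauchy2[of x V12 y V22] by (simp add: algebra_simps)

lemma young_product:
  fixes v1 v2 m1 m2 k :: real
  assumes "k > 0"
  shows "\<bar>2 * (v1 * m1 + v2 * m2)\<bar> \<le> k * (v1^2 + v2^2) + (m1^2 + m2^2) / k"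
proof -
  have *: "\<bar>2 * (v * m)\<bar> \<le> k * v^2 + m^2 / k" for v m
  proof -
    have "0 \<le> (k * v - m)^2 / k" "0 \<le> (k * v + m)^2 / k" using assms by auto
    moreover have "(k * v - m)^2 / k = k * v^2 + m^2 / k - 2 * (v * m)" "(k * v + m)^2 / k = k * v^2 + m^2 / k + 2 * (v * m)"
      using assms by (auto simp: power2_eq_square field_simps)
    ultimately show ?thesis by (simp add: abs_le_iff)
  qed
  show ?thesis using *[of v1 m1] *[of v2 m2] by (simp add: distrib_left add_divide_distrib abs_le_iff)
qed

text \<open>Here \<open>s\<close> and \<open>v\<close> stand for the squared lengths of the two
  fields, and the right side is the Laplacian of \<open>\<xi>^2\<close>. The gradient term absorbs
  the product of \<open>\<xi>\<close> and \<open>s\<close>; Young's inequality treats the product of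
  \<open>\<xi>\<close> and \<open>v\<close> and leaves \<open>2 * \<xi>^2\<close>.\<close>

lemma potential_growth:
  fixes \<xi> s v :: real
  assumes "\<bar>\<xi>\<bar> \<le> 1/1000" "0 \<le> s"
  shows "2 * \<xi>^2 - 5 * v^2 \<le> 2 * ((- 2 * (1 - \<xi>))^2 * s) + 2 * \<xi> * (2 * (1 - \<xi>) * (\<xi> - s - v))"
proof -
  define k where "k = 1 - \<xi>"
  have k: "999/1000 \<le> k" "k \<le> 1001/1000" unfolding k_def using assms by auto
  have "\<bar>\<xi>\<bar> * k \<le> 1/1000 * 2" using assms k by (intro mult_mono) auto
  moreover have "\<xi> * k \<le> \<bar>\<xi>\<bar> * k" using k by (intro mult_right_mono) auto
  ultimately have "\<xi> * k \<le> 1/500" by simp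
  then have "4 * (\<xi> * k) * s \<le> 4 * (1/500) * s" using assms by (intro mult_right_mono) auto
  moreover have "(999/1000)^2 * s \<le> k^2 * s" using k assms by (intro mult_right_mono power_mono) auto
  moreover have "4 * (999/1000) * \<xi>^2 \<le> 4 * k * \<xi>^2" using k by (intro mult_right_mono) auto
  moreover have "4 * k * (\<xi> * v) \<le> 19/10 * \<xi>^2 + 5 * v^2"
  proof -
    have "k * (2 * \<bar>\<xi> * v\<bar>) \<le> 1001/1000 * (2 * \<bar>\<xi> * v\<bar>)" using k by (intro mult_right_mono) auto
    moreover have "k * (\<xi> * v) \<le> k * \<bar>\<xi> * v\<bar>" using k by (intro mult_left_mono) auto
    moreover have "4 * \<bar>\<xi> * v\<bar> * (1001/1000) \<le> 19/10 * \<xi>^2 + 5 * v^2"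
    proof -
      have "2 * (137/100 * \<bar>\<xi>\<bar>) * (2 * \<bar>v\<bar>) \<le> (137/100 * \<bar>\<xi>\<bar>)^2 + (2 * \<bar>v\<bar>)^2" by (rule sum_squares_bound)
      then have "548/100 * \<bar>\<xi> * v\<bar> \<le> 18769/10000 * \<xi>^2 + 4 * v^2"
        by (simp add: power_mult_distrib abs_mult power2_eq_square)
      have "4 * a * (1001/1000) \<le> 19/10 * b + 5 * c" if "548/100 * a \<le> 18769/10000 * b + 4 * c" "0 \<le> a" "0 \<le> b" "0 \<le> c" for a b c :: real
        using that by simp
      from this[OF _ abs_ge_zero zero_le_power2 zero_le_power2] \<open>548/100 * \<bar>\<xi> * v\<bar> \<le> 18769/10000 * \<xi>^2 + 4 * v^2\<close>
      show ?thesis by blast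
    qed
    ultimately show ?thesis by linarith
  qed
  moreover have "2 * ((- 2 * (1 - \<xi>))^2 * s) + 2 * \<xi> * (2 * (1 - \<xi>) * (\<xi> - s - v))
    = 8 * (k^2 * s) + 4 * k * \<xi>^2 - 4 * (\<xi> * k) * s - 4 * k * (\<xi> * v)"
    unfolding k_def[symmetric] by (simp add: power2_eq_square algebra_simps)
  moreover have "2 * q - 5 * w \<le> 8 * p + n - t - u"
    if "t \<le> 4 * (1/500) * s" "(999/1000)^2 * s \<le> p" "4 * (999/1000) * q \<le> n" "u \<le> 19/10 * q + 5 * w" "0 \<le> q" for t p n u q w :: real
    using that assms(2) by (simp add: power2_eq_square)
  ultimately show ?thesis by simp
qed

section \<open>The logarithmic gradient near infinity\<close>

text \<open>\<open>S\<close> and \<open>V\<close> are the symmetric Jacobians of \<open>s\<close> and \<open>v\<close>; the letters \<open>A\<close>, \<open>B\<close>, \<open>C\<close>, \<open>D\<close> stand for their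
  derivatives with index \<open>111\<close>, \<open>112\<close>, \<open>122\<close>, \<open>222\<close>.\<close>

locale exterior_fields =
  fixes R :: real and \<xi> s1 s2 v1 v2 S11 S12 S22 SA SB SC SD V11 V12 V22 VA VB VC VD :: "real ^ 2 \<Rightarrow> real"
  assumes R: "0 < R"
    and grad_s: "\<And>x. x \<in> exterior R \<Longrightarrow> has_grad s1 (S11 x) (S12 x) x" "\<And>x. x \<in> exterior R \<Longrightarrow> has_grad s2 (S12 x) (S22 x) x"
    and grad_S: "\<And>x. x \<in> exterior R \<Longrightarrow> has_grad S11 (SA x) (SB x) x" "\<And>x. x \<in> exterior R \<Longrightarrow> has_grad S12 (SB x) (SC x) x"
      "\<And>x. x \<in> exterior R \<Longrightarrow> has_grad S22 (SC x) (SD x) x"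
    and grad_v: "\<And>x. x \<in> exterior R \<Longrightarrow> has_grad v1 (V11 x) (V12 x) x" "\<And>x. x \<in> exterior R \<Longrightarrow> has_grad v2 (V12 x) (V22 x) x"
    and grad_V: "\<And>x. x \<in> exterior R \<Longrightarrow> has_grad V11 (VA x) (VB x) x" "\<And>x. x \<in> exterior R \<Longrightarrow> has_grad V12 (VB x) (VC x) x"
      "\<And>x. x \<in> exterior R \<Longrightarrow> has_grad V22 (VC x) (VD x) x"
    and cont: "continuous_on (exterior R) SA" "continuous_on (exterior R) SB" "continuous_on (exterior R) SC" "continuous_on (exterior R) SD"
      "continuous_on (exterior R) VA" "continuous_on (exterior R) VB" "continuous_on (exterior R) VC" "continuous_on (exterior R) VD"
    and grad_\<xi>: "\<And>x. x \<in> exterior R \<Longrightarrow> has_grad \<xi> (- 2 * (1 - \<xi> x) * s1 x) (- 2 * (1 - \<xi> x) * s2 x) x"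
    and div_v: "\<And>x. x \<in> exterior R \<Longrightarrow> V11 x + V22 x = - 2 * (s1 x * v1 x + s2 x * v2 x)"
    and div_s: "\<And>x. x \<in> exterior R \<Longrightarrow> S11 x + S22 x = - \<xi> x - ((s1 x)^2 + (s2 x)^2) + ((v1 x)^2 + (v2 x)^2)"
    and lap_s: "\<And>x. x \<in> exterior R \<Longrightarrow> SA x + SC x = 2 * (1 - \<xi> x) * s1 x - 2 * (s1 x * S11 x + s2 x * S12 x) + 2 * (v1 x * V11 x + v2 x * V12 x)"
      "\<And>x. x \<in> exterior R \<Longrightarrow> SB x + SD x = 2 * (1 - \<xi> x) * s2 x - 2 * (s1 x * S12 x + s2 x * S22 x) + 2 * (v1 x * V12 x + v2 x * V22 x)"
    and small: "\<And>x. x \<in> exterior R \<Longrightarrow> \<bar>\<xi> x\<bar> \<le> 1/1000"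
      "\<And>x. x \<in> exterior R \<Longrightarrow> \<bar>s1 x\<bar> \<le> 1/1000" "\<And>x. x \<in> exterior R \<Longrightarrow> \<bar>s2 x\<bar> \<le> 1/1000"
      "\<And>x. x \<in> exterior R \<Longrightarrow> \<bar>v1 x\<bar> \<le> 1/1000" "\<And>x. x \<in> exterior R \<Longrightarrow> \<bar>v2 x\<bar> \<le> 1/1000"
      "\<And>x. x \<in> exterior R \<Longrightarrow> \<bar>S11 x\<bar> \<le> 1/1000" "\<And>x. x \<in> exterior R \<Longrightarrow> \<bar>S12 x\<bar> \<le> 1/1000" "\<And>x. x \<in> exterior R \<Longrightarrow> \<bar>S22 x\<bar> \<le> 1/1000"
      "\<And>x. x \<in> exterior R \<Longrightarrow> \<bar>V11 x\<bar> \<le> 1/1000" "\<And>x. x \<in> exterior R \<Longrightarrow> \<bar>V12 x\<bar> \<le> 1/1000" "\<And>x. x \<in> exterior R \<Longrightarrow> \<bar>V22 x\<bar> \<le> 1/1000"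
    and v_limit: "((\<lambda>x. (v1 x)^2 + (v2 x)^2) \<longlongrightarrow> 0) at_infinity"
begin

lemmas continuous = cont grad_s[THEN has_grad_continuous_on] grad_S[THEN has_grad_continuous_on]
  grad_v[THEN has_grad_continuous_on] grad_V[THEN has_grad_continuous_on] grad_\<xi>[THEN has_grad_continuous_on]

abbreviation "nv1 x \<equiv> 2 * (v1 x * V11 x + v2 x * V12 x)"
abbreviation "nv2 x \<equiv> 2 * (v1 x * V12 x + v2 x * V22 x)"
abbreviation "ns1 x \<equiv> 2 * (s1 x * S11 x + s2 x * S12 x)"
abbreviation "ns2 x \<equiv> 2 * (s1 x * S12 x + s2 x * S22 x)"
abbreviation "ns11 x \<equiv> 2 * (s1 x * SA x + S11 x * S11 x + (s2 x * SB x + S12 x * S12 x))"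
abbreviation "ns22 x \<equiv> 2 * (s1 x * SC x + S12 x * S12 x + (s2 x * SD x + S22 x * S22 x))"
abbreviation "n\<xi>1 x \<equiv> 2 * (\<xi> x * (- 2 * (1 - \<xi> x) * s1 x))"
abbreviation "n\<xi>2 x \<equiv> 2 * (\<xi> x * (- 2 * (1 - \<xi> x) * s2 x))"

definition "Dv x = (V11 x)^2 + 2 * (V12 x)^2 + (V22 x)^2"
definition "nv x = (v1 x)^2 + (v2 x)^2"
definition "ns x = (s1 x)^2 + (s2 x)^2"

lemma Dv_nonneg: "0 \<le> Dv x" "0 \<le> nv x" "0 \<le> ns x"
  unfolding Dv_def nv_def ns_def by auto

lemma cont_sq: "continuous_on (exterior R) Dv" "continuous_on (exterior R) nv" "continuous_on (exterior R) ns"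
  unfolding Dv_def nv_def ns_def by (auto intro!: continuous_intros continuous)

text \<open>The flux density \<open>v2 * d_\<theta> v1 - v1 * d_\<theta> v2\<close>.\<close>

definition "J x = v2 x * (- x $ 2 * V11 x + x $ 1 * V12 x) - v1 x * (- x $ 2 * V12 x + x $ 1 * V22 x)"

lemma cont_J: "continuous_on (exterior R) J"
  unfolding J_def by (intro continuous_intros continuous)

definition "a t = exp (2*t) * circ Dv t"
definition "Q = circ J"
definition "Q1 = circ (\<lambda>x. (norm x)^2 * (- 2 * (V11 x * V22 x - (V12 x)^2)))"
definition "Y = circ ns"
definition "Y1 = circ (\<lambda>x. x $ 1 * (ns1 x) + x $ 2 * (ns2 x))"
definition "Y2 = circ (\<lambda>x. (norm x)^2 * (ns11 x
    + ns22 x))"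
definition "A = circ nv"
definition "A1 = circ (\<lambda>x. x $ 1 * (nv1 x) + x $ 2 * (nv2 x))"
definition "X = circ (\<lambda>x. (\<xi> x)^2)"
definition "X1 = circ (\<lambda>x. x $ 1 * (n\<xi>1 x) + x $ 2 * (n\<xi>2 x))"
text \<open>The Laplacian of \<open>\<xi>\<close>, with \<open>div s\<close> eliminated by
  \<open>div_s\<close>; \<open>lap\<xi>2\<close> is that of \<open>\<xi>^2\<close>.\<close>

definition "lap\<xi> x = 2 * (1 - \<xi> x) * (\<xi> x - ns x - nv x)"
abbreviation "lap\<xi>2 x \<equiv> 2 * ((- 2 * (1 - \<xi> x))^2 * ns x) + 2 * \<xi> x * lap\<xi> x"
definition "X2 = circ (\<lambda>x. (norm x)^2 * (lap\<xi>2 x))"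

lemma dY: "R < exp t \<Longrightarrow> (Y has_real_derivative Y1 t) (at t)"
  unfolding Y_def Y1_def ns_def[abs_def]
  by (intro circ_deriv[of R] has_grad_square_sum grad_s continuous_intros continuous R)

lemma dY1: "R < exp t \<Longrightarrow> (Y1 has_real_derivative Y2 t) (at t)"
  unfolding Y1_def Y2_def
proof (rule circ_second_deriv[where R = R])
  fix x assume x: "x \<in> exterior R"
  show "has_grad (\<lambda>x. (s1 x)^2 + (s2 x)^2) (ns1 x) (ns2 x) x"
    by (intro has_grad_square_sum grad_s x)
  show "has_grad (\<lambda>x. ns1 x)
      (ns11 x)
      (2 * (s1 x * SB x + S12 x * S11 x + (s2 x * SC x + S22 x * S12 x))) x"
    by (intro has_grad_pairing grad_s grad_S x)
  show "has_grad (\<lambda>x. ns2 x)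
      (2 * (s1 x * SB x + S11 x * S12 x + (s2 x * SC x + S12 x * S22 x)))
      (ns22 x) x"
    by (intro has_grad_pairing grad_s grad_S x)
qed (intro continuous_intros continuous R | assumption)+

lemma dA: "R < exp t \<Longrightarrow> (A has_real_derivative A1 t) (at t)"
  unfolding A_def A1_def nv_def[abs_def]
  by (intro circ_deriv[of R] has_grad_square_sum grad_v continuous_intros continuous R)

lemma grad_\<xi>2: "x \<in> exterior R \<Longrightarrow> has_grad (\<lambda>x. (\<xi> x)^2) (n\<xi>1 x) (n\<xi>2 x) x"
  unfolding power2_eq_square
  by (rule has_grad_eq[OF has_grad_mult[OF grad_\<xi> grad_\<xi>]]) (simp_all add: algebra_simps)

lemma dX: "R < exp t \<Longrightarrow> (X has_real_derivative X1 t) (at t)"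
  unfolding X_def X1_def
  by (intro circ_deriv[of R] grad_\<xi>2 continuous_intros continuous R)

lemma grad_grad_\<xi>:
  assumes x: "x \<in> exterior R" and s: "has_grad s p q x"
  defines "z1 \<equiv> - 2 * (1 - \<xi> x) * s1 x" and "z2 \<equiv> - 2 * (1 - \<xi> x) * s2 x"
  shows "has_grad (\<lambda>x. 2 * (\<xi> x * (- 2 * (1 - \<xi> x) * s x)))
    (2 * (\<xi> x * (- 2 * (1 - \<xi> x) * p + 2 * z1 * s x) + z1 * (- 2 * (1 - \<xi> x) * s x)))
    (2 * (\<xi> x * (- 2 * (1 - \<xi> x) * q + 2 * z2 * s x) + z2 * (- 2 * (1 - \<xi> x) * s x))) x"
  unfolding z1_def z2_def
  by (rule has_grad_eq[OF has_grad_linear[OF bounded_linear_mult_right has_grad_mult[OF grad_\<xi>[OF x]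
     has_grad_mult[OF has_grad_linear[OF bounded_linear_mult_right has_grad_diff[OF has_grad_const grad_\<xi>[OF x]]] s]]]])
   (simp_all add: algebra_simps)

lemma dX1: "R < exp t \<Longrightarrow> (X1 has_real_derivative X2 t) (at t)"
proof -
  assume t: "R < exp t"
  define z1 where "z1 x = - 2 * (1 - \<xi> x) * s1 x" for x
  define z2 where "z2 x = - 2 * (1 - \<xi> x) * s2 x" for x
  have "(X1 has_real_derivative circ (\<lambda>x. (norm x)^2 * (
     2 * (\<xi> x * (- 2 * (1 - \<xi> x) * S11 x + 2 * z1 x * s1 x) + z1 x * (- 2 * (1 - \<xi> x) * s1 x))
   + 2 * (\<xi> x * (- 2 * (1 - \<xi> x) * S22 x + 2 * z2 x * s2 x) + z2 x * (- 2 * (1 - \<xi> x) * s2 x)))) t) (at t)"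
    unfolding X1_def z1_def z2_def
    by (rule circ_second_deriv[where R = R, OF grad_\<xi>2 grad_grad_\<xi>[OF _ grad_s(1)] grad_grad_\<xi>[OF _ grad_s(2)]])
      (intro continuous_intros continuous R t | assumption)+
  also have "circ (\<lambda>x. (norm x)^2 * (
     2 * (\<xi> x * (- 2 * (1 - \<xi> x) * S11 x + 2 * z1 x * s1 x) + z1 x * (- 2 * (1 - \<xi> x) * s1 x))
   + 2 * (\<xi> x * (- 2 * (1 - \<xi> x) * S22 x + 2 * z2 x * s2 x) + z2 x * (- 2 * (1 - \<xi> x) * s2 x)))) t = X2 t"
    unfolding X2_def
  proof (rule circ_cong)
    fix x :: "real ^ 2" assume "norm x = exp t"
    then have x: "x \<in> exterior R" using t by simp
    have *: "S11 x = - \<xi> x - ((s1 x)^2 + (s2 x)^2) + ((v1 x)^2 + (v2 x)^2) - S22 x" using div_s[OF x] by simp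
    have "2 * (\<xi> x * (- 2 * (1 - \<xi> x) * S11 x + 2 * z1 x * s1 x) + z1 x * (- 2 * (1 - \<xi> x) * s1 x))
      + 2 * (\<xi> x * (- 2 * (1 - \<xi> x) * S22 x + 2 * z2 x * s2 x) + z2 x * (- 2 * (1 - \<xi> x) * s2 x))
      = lap\<xi>2 x"
      unfolding z1_def z2_def lap\<xi>_def ns_def nv_def * by (simp add: power2_eq_square algebra_simps)
    then show "(norm x)^2 * (2 * (\<xi> x * (- 2 * (1 - \<xi> x) * S11 x + 2 * z1 x * s1 x) + z1 x * (- 2 * (1 - \<xi> x) * s1 x))
      + 2 * (\<xi> x * (- 2 * (1 - \<xi> x) * S22 x + 2 * z2 x * s2 x) + z2 x * (- 2 * (1 - \<xi> x) * s2 x)))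
      = (norm x)^2 * (lap\<xi>2 x)" by simp
  qed
  finally show ?thesis .
qed

text \<open>Subtracting the angular derivative of \<open>K\<close> from the radial derivative of
  \<open>J\<close> cancels all second derivatives of \<open>v\<close> and leaves minus twice
  \<open>r^2\<close> times the Jacobian determinant.\<close>

lemma dQ: 
  assumes t: "R < exp t" 
  shows "(Q has_real_derivative Q1 t) (at t)"
proof -
  \<comment> \<open>The analogue of \<open>J\<close> with the radial derivative in place of the
    angular one.\<close>
  define K where "K x = v2 x * (x $ 1 * V11 x + x $ 2 * V12 x) - v1 x * (x $ 1 * V12 x + x $ 2 * V22 x)" for x
  define J1 where "J1 x = (v2 x * (- x $ 2 * VA x + (x $ 1 * VB x + V12 x)) + V12 x * (- x $ 2 * V11 x + x $ 1 * V12 x))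
      - (v1 x * (- x $ 2 * VB x + (x $ 1 * VC x + V22 x)) + V11 x * (- x $ 2 * V12 x + x $ 1 * V22 x))" for x
  define J2 where "J2 x = (v2 x * ((- x $ 2 * VB x - V11 x) + x $ 1 * VC x) + V22 x * (- x $ 2 * V11 x + x $ 1 * V12 x))
      - (v1 x * ((- x $ 2 * VC x - V12 x) + x $ 1 * VD x) + V12 x * (- x $ 2 * V12 x + x $ 1 * V22 x))" for x
  define K1 where "K1 x = (v2 x * ((x $ 1 * VA x + V11 x) + x $ 2 * VB x) + V12 x * (x $ 1 * V11 x + x $ 2 * V12 x))
      - (v1 x * ((x $ 1 * VB x + V12 x) + x $ 2 * VC x) + V11 x * (x $ 1 * V12 x + x $ 2 * V22 x))" for x
  define K2 where "K2 x = (v2 x * (x $ 1 * VB x + (x $ 2 * VC x + V12 x)) + V22 x * (x $ 1 * V11 x + x $ 2 * V12 x))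
      - (v1 x * (x $ 1 * VC x + (x $ 2 * VD x + V22 x)) + V12 x * (x $ 1 * V12 x + x $ 2 * V22 x))" for x
  have lin: "has_grad (\<lambda>x. - x $ 2 * f x + x $ 1 * g x :: real) (- x $ 2 * p + (x $ 1 * p' + g x)) ((- x $ 2 * q - f x) + x $ 1 * q') x"
    "has_grad (\<lambda>x. x $ 1 * f x + x $ 2 * g x :: real) ((x $ 1 * p + f x) + x $ 2 * p') (x $ 1 * q + (x $ 2 * q' + g x)) x"
    if "has_grad f p q x" "has_grad g p' q' x" for f g p q p' q' x
    by (rule has_grad_eq[OF has_grad_add[OF has_grad_mult[OF has_grad_minus[OF has_grad_coord(2)] that(1)] has_grad_mult[OF has_grad_coord(1) that(2)]]], simp, simp)
       (rule has_grad_eq[OF has_grad_add[OF has_grad_mult[OF has_grad_coord(1) that(1)] has_grad_mult[OF has_grad_coord(2) that(2)]]], simp, simp)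
  have gJ: "has_grad J (J1 x) (J2 x) x" if "x \<in> exterior R" for x
    unfolding J_def[abs_def] J1_def J2_def
    by (intro has_grad_diff has_grad_mult lin grad_v grad_V that)
  have gK: "has_grad K (K1 x) (K2 x) x" if "x \<in> exterior R" for x
    unfolding K_def[abs_def] K1_def K2_def
    by (intro has_grad_diff has_grad_mult lin grad_v grad_V that)
  have cJ: "continuous_on (exterior R) J1" "continuous_on (exterior R) J2" "continuous_on (exterior R) K1" "continuous_on (exterior R) K2"
    unfolding J1_def J2_def K1_def K2_def by (auto intro!: continuous_intros continuous simp del: minus_add_distrib)
  have "Q1 t = circ (\<lambda>x. (x $ 1 * J1 x + x $ 2 * J2 x) - (- x $ 2 * K1 x + x $ 1 * K2 x)) t"
    unfolding Q1_def norm_real2 J1_def J2_def K1_def K2_def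
    by (rule circ_cong) (simp add: power2_eq_square algebra_simps)
  also have "\<dots> = circ (\<lambda>x. x $ 1 * J1 x + x $ 2 * J2 x) t"
    by (subst circ_diff[of R]) (use circ_rotation[OF gK t] t in \<open>auto intro!: continuous_intros cJ\<close>)
  finally show ?thesis unfolding Q_def
    by (simp only:) (rule circ_deriv[OF gJ cJ(1,2) t R])
qed

section \<open>Differential inequalities for the circle integrals of the fields\<close>

lemma sphere_exterior: "R < exp t \<Longrightarrow> norm x = exp t \<Longrightarrow> x \<in> exterior R" by simp

lemma nonneg:
  assumes "R < exp t" shows "0 \<le> Y t" "0 \<le> A t" "0 \<le> X t" "0 \<le> a t"
  unfolding Y_def A_def X_def a_def
  by (auto intro!: circ_nonneg[of R] mult_nonneg_nonneg cont_sq assms continuous_intros continuous simp: Dv_nonneg)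

lemma Q_growth:
  assumes t: "R < exp t"
  shows "a t - 1/100 * (exp (2*t) * Y t) \<le> Q1 t"
proof -
  have "a t - 1/100 * (exp (2*t) * Y t) = exp (2*t) * circ (\<lambda>x. Dv x - 1/100 * ns x) t"
    unfolding a_def Y_def circ_linear(2)[OF cont_sq(1,3) t] circ_linear(2)[OF cont_sq(3,1) t] by (simp add: algebra_simps)
  also have "\<dots> \<le> exp (2*t) * circ (\<lambda>x. - 2 * (V11 x * V22 x - (V12 x)^2)) t"
  proof (intro mult_left_mono circ_mono[of R] t continuous_intros continuous cont_sq)
    fix x :: "real ^ 2" assume "norm x = exp t"
    then have x: "x \<in> exterior R" using t by simp
    show "Dv x - 1/100 * ns x \<le> - 2 * (V11 x * V22 x - (V12 x)^2)"
      unfolding Dv_def ns_def by (rule gradient_growth[OF small(4,5)[OF x] div_v[OF x]])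
  qed auto
  also have "\<dots> = Q1 t" unfolding Q1_def circ_scale ..
  finally show ?thesis .
qed

text \<open>The isoperimetric inequality for the loop traced by \<open>v\<close> on a circle bounds
  \<open>|Q|\<close> by the integral of the squared angular derivative, and
  \<open>rotation_bound\<close> compares this with half of \<open>r^2 * |grad v|^2\<close>.\<close>

lemma Q_bound:
  assumes t: "R < exp t"
  shows "\<bar>Q t\<bar> \<le> (1/2 + 1/100) * a t + 1/100 * (exp (2*t) * Y t)"
proof -
  have pe: "pol t \<theta> \<in> exterior R" for \<theta> using t by simp
  have "\<bar>Q t\<bar> \<le> circ (\<lambda>x. (- x $ 2 * V11 x + x $ 1 * V12 x)^2 + (- x $ 2 * V12 x + x $ 1 * V22 x)^2) t"
    unfolding Q_def circ_def J_def
  proof (rule isoperimetric_inequality)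
    fix \<theta>
    show "((\<lambda>\<theta>. v1 (pol t \<theta>)) has_real_derivative - pol t \<theta> $ 2 * V11 (pol t \<theta>) + pol t \<theta> $ 1 * V12 (pol t \<theta>)) (at \<theta>)"
      by (rule pol_deriv(2)[OF grad_v(1)[OF pe]])
    show "((\<lambda>\<theta>. v2 (pol t \<theta>)) has_real_derivative - pol t \<theta> $ 2 * V12 (pol t \<theta>) + pol t \<theta> $ 1 * V22 (pol t \<theta>)) (at \<theta>)"
      by (rule pol_deriv(2)[OF grad_v(2)[OF pe]])
  qed (unfold pol_nth, auto intro!: continuous_intros continuous_circ[OF _ t] continuous)
  also have "\<dots> \<le> circ (\<lambda>x. (norm x)^2 * ((1/2 + 1/100) * Dv x + 1/100 * ns x)) t"
  proof (intro circ_mono[of R] t continuous_intros continuous cont_sq)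
    fix x :: "real ^ 2" assume n: "norm x = exp t"
    then have x: "x \<in> exterior R" using t by simp
    have "(x $ 1)^2 + (x $ 2)^2 > 0" using n unfolding norm_real2[symmetric] by simp
    from rotation_bound[OF small(4,5)[OF x] div_v[OF x] this]
    show "(- x $ 2 * V11 x + x $ 1 * V12 x)^2 + (- x $ 2 * V12 x + x $ 1 * V22 x)^2 \<le> (norm x)^2 * ((1/2 + 1/100) * Dv x + 1/100 * ns x)"
      unfolding Dv_def ns_def norm_real2 .
  qed
  also have "\<dots> = (1/2 + 1/100) * a t + 1/100 * (exp (2*t) * Y t)"
  proof -
    have "continuous_on (exterior R) (\<lambda>x. (1/2 + 1/100) * Dv x)" by (intro continuous_intros cont_sq)
    from circ_linear(1)[OF this cont_sq(3) t, of "1/100"] show ?thesis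
      unfolding circ_scale a_def Y_def circ_cmult by (simp add: algebra_simps)
  qed
  finally show ?thesis .
qed

lemma Y_growth:
  assumes t: "R < exp t"
  shows "exp (2*t) * Y t - 1/100 * a t \<le> Y2 t"
proof -
  have "exp (2*t) * Y t - 1/100 * a t = exp (2*t) * circ (\<lambda>x. ns x - 1/100 * Dv x) t"
    unfolding a_def Y_def circ_linear(2)[OF cont_sq(1,3) t] circ_linear(2)[OF cont_sq(3,1) t] by (simp add: algebra_simps)
  also have "\<dots> \<le> exp (2*t) * circ (\<lambda>x. ns11 x
    + ns22 x) t"
  proof (intro mult_left_mono circ_mono[of R] t continuous_intros continuous cont_sq)
    fix x :: "real ^ 2" assume "norm x = exp t"
    then have x: "x \<in> exterior R" using t by simp
    have "ns x - 1/100 * Dv x \<le> 2 * ((S11 x)^2 + 2 * (S12 x)^2 + (S22 x)^2) + 2 * (s1 x * (SA x + SC x) + s2 x * (SB x + SD x))"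
      unfolding Dv_def ns_def by (rule modulus_growth[OF small(1,4-8)[OF x] lap_s[OF x]])
    then show "ns x - 1/100 * Dv x \<le> ns11 x
      + ns22 x"
      by (simp add: power2_eq_square algebra_simps)
  qed auto
  also have "\<dots> = Y2 t" unfolding Y2_def circ_scale ..
  finally show ?thesis .
qed

lemma Q_le:
  assumes t: "R < exp t"
  shows "2 * Q t \<le> A1 t + 1/100 * (A t + exp (2*t) * Y t)"
proof -
  have "2 * Q t = circ (\<lambda>x. 2 * J x) t" unfolding Q_def circ_cmult ..
  also have "\<dots> \<le> circ (\<lambda>x. (x $ 1 * (nv1 x) + x $ 2 * (nv2 x))
      + 1/100 * (nv x + (norm x)^2 * ns x)) t"
  proof (intro circ_mono[of R] t continuous_intros continuous cont_sq cont_J)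
    fix x :: "real ^ 2" assume "norm x = exp t"
    then have x: "x \<in> exterior R" using t by simp
    show "2 * J x \<le> (x $ 1 * (nv1 x) + x $ 2 * (nv2 x))
      + 1/100 * (nv x + (norm x)^2 * ns x)"
      unfolding J_def nv_def ns_def norm_real2
      by (rule flux_bound[OF small(4,5)[OF x] div_v[OF x]])
  qed
  also have "\<dots> = A1 t + 1/100 * (A t + exp (2*t) * Y t)"
  proof -
    have c: "continuous_on (exterior R) (\<lambda>x. (norm x)^2 * ns x)" by (intro continuous_intros cont_sq)
    have "circ (\<lambda>x. nv x + (norm x)^2 * ns x) t = A t + exp (2*t) * Y t"
      using circ_add[OF cont_sq(2) c t] unfolding circ_scale A_def Y_def .
    moreover have "continuous_on (exterior R) (\<lambda>x. x $ 1 * (nv1 x) + x $ 2 * (nv2 x))"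
      by (intro continuous_intros continuous)
    note circ_linear(1)[OF this continuous_on_add[OF cont_sq(2) c] t, of "1/100"]
    ultimately show ?thesis unfolding A1_def by simp
  qed
  finally show ?thesis .
qed

text \<open>The radial derivative of \<open>|v|^2\<close> enters \<open>A1\<close>; the angular one
  measures the oscillation of \<open>|v|^2\<close> along a circle in \<open>nv_sup\<close>.\<close>

lemma rotation_growth:
  assumes "x \<in> exterior R" "k > 0"
  shows "\<bar>x $ 1 * (nv1 x) + x $ 2 * (nv2 x)\<bar> \<le> k * nv x + (norm x)^2 * Dv x / k"
    "\<bar>- x $ 2 * (nv1 x) + x $ 1 * (nv2 x)\<bar> \<le> k * nv x + (norm x)^2 * Dv x / k"
proof -
  have "((p * V11 x + q * V12 x)^2 + (p * V12 x + q * V22 x)^2) / k \<le> (p^2 + q^2) * Dv x / k" for p q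
    using matrix_vector_bound[of p "V11 x" q "V12 x" "V22 x"] assms(2) unfolding Dv_def by (intro divide_right_mono) auto
  then have *: "\<bar>2 * (v1 x * (p * V11 x + q * V12 x) + v2 x * (p * V12 x + q * V22 x))\<bar> \<le> k * nv x + (p^2 + q^2) * Dv x / k" for p q
    unfolding nv_def by (rule order_trans[OF young_product[OF assms(2)] add_left_mono])
  show "\<bar>x $ 1 * (nv1 x) + x $ 2 * (nv2 x)\<bar> \<le> k * nv x + (norm x)^2 * Dv x / k"
    using *[of "x $ 1" "x $ 2"] unfolding norm_real2 by (simp add: algebra_simps)
  show "\<bar>- x $ 2 * (nv1 x) + x $ 1 * (nv2 x)\<bar> \<le> k * nv x + (norm x)^2 * Dv x / k"
    using *[of "- x $ 2" "x $ 1"] unfolding norm_real2 by (simp add: algebra_simps)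
qed

lemma circ_comb:
  assumes t: "R < exp t"
  shows "circ (\<lambda>x. k * nv x + (norm x)^2 * Dv x / k) t = k * A t + a t / k"
proof -
  have c: "continuous_on (exterior R) (\<lambda>x. (norm x)^2 * Dv x)" "continuous_on (exterior R) (\<lambda>x. k * nv x)"
    by (auto intro!: continuous_intros cont_sq)
  show ?thesis
    using circ_linear(1)[OF c(2,1) t, of "1/k"] unfolding circ_scale circ_cmult A_def a_def by simp
qed

lemma A_growth:
  assumes t: "R < exp t" and k: "k > 0"
  shows "\<bar>A1 t\<bar> \<le> k * A t + a t / k"
proof -
  have "A1 t \<le> circ (\<lambda>x. k * nv x + (norm x)^2 * Dv x / k) t"
    unfolding A1_def
  proof (intro circ_mono[of R] t continuous_intros continuous cont_sq)
    fix x :: "real ^ 2" assume "norm x = exp t"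
    from rotation_growth(1)[OF sphere_exterior[OF t this] k]
    show "x $ 1 * (nv1 x) + x $ 2 * (nv2 x) \<le> k * nv x + (norm x)^2 * Dv x / k"
      by linarith
  qed (use k in auto)
  moreover have "- A1 t = circ (\<lambda>x. - 1 * (x $ 1 * (nv1 x) + x $ 2 * (nv2 x))) t"
    unfolding circ_cmult A1_def by simp
  moreover have "\<dots> \<le> circ (\<lambda>x. k * nv x + (norm x)^2 * Dv x / k) t"
  proof (intro circ_mono[of R] t continuous_intros continuous cont_sq)
    fix x :: "real ^ 2" assume "norm x = exp t"
    from rotation_growth(1)[OF sphere_exterior[OF t this] k]
    show "- 1 * (x $ 1 * (nv1 x) + x $ 2 * (nv2 x)) \<le> k * nv x + (norm x)^2 * Dv x / k"
      unfolding mult_minus1 by linarith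
  qed (use k in auto)
  ultimately show ?thesis unfolding circ_comb[OF t] by (simp add: abs_le_iff)
qed

lemma nv_sup:
  assumes t: "R < exp t" and x: "norm x = exp t"
  shows "nv x \<le> 2 * A t + a t"
proof -
  have "nv x \<le> circ nv t + circ (\<lambda>x. \<bar>- x $ 2 * (nv1 x) + x $ 1 * (nv2 x)\<bar>) t"
  proof (rule circ_sup[OF _ _ _ t x])
    fix y assume "y \<in> exterior R"
    then show "has_grad nv (nv1 y) (nv2 y) y"
      unfolding nv_def[abs_def] by (intro has_grad_square_sum grad_v)
  qed (auto simp only: Dv_nonneg intro!: continuous_intros continuous)
  also have "circ (\<lambda>x. \<bar>- x $ 2 * (nv1 x) + x $ 1 * (nv2 x)\<bar>) t
    \<le> circ (\<lambda>x. 1 * nv x + (norm x)^2 * Dv x / 1) t"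
  proof (intro circ_mono[of R] t continuous_intros continuous cont_sq)
    fix y :: "real ^ 2" assume "norm y = exp t"
    from rotation_growth(2)[OF sphere_exterior[OF t this] zero_less_one]
    show "\<bar>- y $ 2 * (nv1 y) + y $ 1 * (nv2 y)\<bar> \<le> 1 * nv y + (norm y)^2 * Dv y / 1" .
  qed auto
  finally show ?thesis unfolding circ_comb[OF t] unfolding A_def by simp
qed

text \<open>The circle integral of \<open>|v|^4\<close> is at most the supremum of
  \<open>|v|^2\<close>, bounded by \<open>nv_sup\<close>, times \<open>A\<close>.\<close>

lemma X_growth:
  assumes t: "R < exp t"
  shows "exp (2*t) * (2 * X t - 5 * (A t * (2 * A t + a t))) \<le> X2 t"
proof -
  have "circ (\<lambda>x. (nv x)^2) t \<le> circ (\<lambda>x. (2 * A t + a t) * nv x) t"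
    using nv_sup[OF t] Dv_nonneg
    by (intro circ_mono[of R] t continuous_intros cont_sq) (simp add: power2_eq_square mult_right_mono)
  also have "\<dots> = A t * (2 * A t + a t)" unfolding circ_cmult A_def by simp
  finally have 1: "circ (\<lambda>x. (nv x)^2) t \<le> A t * (2 * A t + a t)" .
  have "2 * X t - 5 * (A t * (2 * A t + a t)) \<le> 2 * X t - 5 * circ (\<lambda>x. (nv x)^2) t" using 1 by simp
  also have "\<dots> = circ (\<lambda>x. 2 * (\<xi> x)^2 - 5 * (nv x)^2) t"
  proof -
    have c: "continuous_on (exterior R) (\<lambda>x. 2 * (\<xi> x)^2)" "continuous_on (exterior R) (\<lambda>x. (nv x)^2)"
      by (auto intro!: continuous_intros continuous cont_sq)
    show ?thesis using circ_linear(2)[OF c t, of 5] unfolding circ_cmult X_def by simp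
  qed
  also have "\<dots> \<le> circ (\<lambda>x. lap\<xi>2 x) t"
    unfolding lap\<xi>_def
  proof (intro circ_mono[of R] t continuous_intros continuous cont_sq)
    fix y :: "real ^ 2" assume "norm y = exp t"
    from potential_growth[OF small(1)[OF sphere_exterior[OF t this]] Dv_nonneg(3)]
    show "2 * (\<xi> y)^2 - 5 * (nv y)^2 \<le> 2 * ((- 2 * (1 - \<xi> y))^2 * ns y) + 2 * \<xi> y * (2 * (1 - \<xi> y) * (\<xi> y - ns y - nv y))" .
  qed
  finally have "exp (2*t) * (2 * X t - 5 * (A t * (2 * A t + a t))) \<le> exp (2*t) * circ (\<lambda>x. lap\<xi>2 x) t"
    by (intro mult_left_mono) auto
  then show ?thesis unfolding X2_def circ_scale .
qed

lemma A_limit: "(A \<longlongrightarrow> 0) at_top"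
proof (rule tendstoI)
  fix e :: real assume e: "e > 0"
  then obtain b where b: "\<And>x. norm x \<ge> b \<Longrightarrow> \<bar>nv x\<bar> < e / 8"
    using tendstoD[OF v_limit, of "e / 8"] unfolding eventually_at_infinity nv_def by auto
  have "eventually (\<lambda>t. max R b < exp t) at_top"
    using filterlim_at_top_dense[THEN iffD1, OF exp_at_top] by blast
  then show "\<forall>\<^sub>F t in at_top. dist (A t) 0 < e"
  proof eventually_elim
    case (elim t)
    have "\<bar>A t\<bar> \<le> 2 * pi * (e / 8)"
      unfolding A_def using elim b by (intro circ_abs[of R] cont_sq) (auto simp: less_imp_le)
    also have "\<dots> < e" using e pi_less_4 by simp
    finally show ?case by simp
  qed
qed

lemma circ_crude:
  assumes "continuous_on (exterior R) g" "R < exp t" "\<And>x. norm x = exp t \<Longrightarrow> \<bar>g x\<bar> \<le> 1/10 * c" "0 \<le> c"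
  shows "\<bar>circ g t\<bar> \<le> 8 * c"
proof -
  have "\<bar>circ g t\<bar> \<le> 2 * pi * (1/10 * c)" by (rule circ_abs[OF assms(1-3)])
  also have "\<dots> \<le> 8 * c" using pi_less_4 assms(4) by (simp add: mult_right_mono)
  finally show ?thesis .
qed

lemma crude:
  assumes t: "R < exp t" "0 \<le> t"
  shows "\<bar>Q t\<bar> \<le> 8 * exp t" "\<bar>Y t\<bar> \<le> 8 * exp t" "\<bar>Y1 t\<bar> \<le> 8 * exp t" "\<bar>X1 t\<bar> \<le> 8 * exp t" "\<bar>X t\<bar> \<le> 8"
proof -
  have e: "1 \<le> exp t" using t by simp
  have comp: "\<bar>x $ i\<bar> \<le> exp t" if "norm x = exp t" for x :: "real ^ 2" and i
    using component_le_norm_cart[of x i] that by simp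
  have prod: "\<bar>p * q\<bar> \<le> 1/1000" if "\<bar>p\<bar> \<le> 1/1000" "\<bar>q\<bar> \<le> 1/1000" for p q :: real
    using mult_mono[OF that] unfolding abs_mult by simp
  have comb: "\<bar>y1 * p + y2 * q\<bar> \<le> 1/10 * exp t" if "\<bar>y1\<bar> \<le> exp t" "\<bar>y2\<bar> \<le> exp t" "\<bar>p\<bar> \<le> 1/20" "\<bar>q\<bar> \<le> 1/20" for p q y1 y2
  proof -
    have "\<bar>y1 * p\<bar> \<le> exp t * (1/20)" "\<bar>y2 * q\<bar> \<le> exp t * (1/20)" unfolding abs_mult by (intro mult_mono that; simp)+
    then show ?thesis by linarith
  qed
  have sm: "\<bar>2 * (p * q + p' * q')\<bar> \<le> 1/20" if "\<bar>p\<bar> \<le> 1/1000" "\<bar>q\<bar> \<le> 1/1000" "\<bar>p'\<bar> \<le> 1/1000" "\<bar>q'\<bar> \<le> 1/1000" for p q p' q' :: real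
    using prod[OF that(1,2)] prod[OF that(3,4)] unfolding distrib_left by linarith
  have "\<bar>J x\<bar> \<le> 1/10 * exp t" if n: "norm x = exp t" for x
  proof -
    note x = sphere_exterior[OF t(1) n]
    have "J x = x $ 1 * (v2 x * V12 x - v1 x * V22 x) + x $ 2 * (v1 x * V12 x - v2 x * V11 x)"
      unfolding J_def by (simp add: algebra_simps)
    moreover have "\<bar>v2 x * V12 x - v1 x * V22 x\<bar> \<le> 1/20" "\<bar>v1 x * V12 x - v2 x * V11 x\<bar> \<le> 1/20"
      using prod[OF small(4)[OF x] small(10)[OF x]] prod[OF small(5)[OF x] small(10)[OF x]]
        prod[OF small(4)[OF x] small(11)[OF x]] prod[OF small(5)[OF x] small(9)[OF x]] by linarith+
    ultimately show ?thesis using comb[OF comp[OF n] comp[OF n]] by simp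
  qed
  then show "\<bar>Q t\<bar> \<le> 8 * exp t" unfolding Q_def by (intro circ_crude[OF cont_J t(1)]) auto
  have "\<bar>ns x\<bar> \<le> 1/10 * exp t" if n: "norm x = exp t" for x
  proof -
    note x = sphere_exterior[OF t(1) n]
    show ?thesis unfolding ns_def power2_eq_square
      using prod[OF small(2)[OF x] small(2)[OF x]] prod[OF small(3)[OF x] small(3)[OF x]] e by linarith
  qed
  then show "\<bar>Y t\<bar> \<le> 8 * exp t" unfolding Y_def by (intro circ_crude[OF cont_sq(3) t(1)]) auto
  show "\<bar>Y1 t\<bar> \<le> 8 * exp t" unfolding Y1_def
  proof (intro circ_crude[OF _ t(1)] continuous_intros continuous comb comp)
    fix x :: "real ^ 2" assume "norm x = exp t"
    note x = sphere_exterior[OF t(1) this]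
    show "\<bar>ns1 x\<bar> \<le> 1/20" "\<bar>ns2 x\<bar> \<le> 1/20"
      by (intro sm small x)+
  qed auto
  show "\<bar>X1 t\<bar> \<le> 8 * exp t" unfolding X1_def
  proof (intro circ_crude[OF _ t(1)] continuous_intros continuous comb comp)
    have *: "\<bar>2 * (p * (- 2 * (1 - p) * q))\<bar> \<le> 1/20" if "\<bar>p\<bar> \<le> 1/1000" "\<bar>q\<bar> \<le> 1/1000" for p q :: real
    proof -
      have "\<bar>p * q\<bar> * \<bar>1 - p\<bar> \<le> 1/1000 * 2" using that by (intro mult_mono prod) auto
      moreover have "2 * (p * (- 2 * (1 - p) * q)) = - 4 * ((p * q) * (1 - p))" by (simp add: algebra_simps)
      ultimately show ?thesis by (simp only: abs_mult)
    qed
    fix x :: "real ^ 2" assume "norm x = exp t"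
    note x = sphere_exterior[OF t(1) this]
    show "\<bar>n\<xi>1 x\<bar> \<le> 1/20" "\<bar>n\<xi>2 x\<bar> \<le> 1/20"
      by (intro * small x)+
  qed auto
  have "\<bar>X t\<bar> \<le> 8 * 1" unfolding X_def
  proof (intro circ_crude[OF _ t(1)] continuous_intros continuous)
    fix x :: "real ^ 2" assume "norm x = exp t"
    note x = sphere_exterior[OF t(1) this]
    show "\<bar>(\<xi> x)^2\<bar> \<le> 1/10 * 1" unfolding power2_eq_square using prod[OF small(1)[OF x] small(1)[OF x]] by simp
  qed auto
  then show "\<bar>X t\<bar> \<le> 8" by simp
qed

lemma potential_decay:
  obtains C t0 where "C \<ge> 0" "R < exp t0" "\<And>t. t \<ge> t0 \<Longrightarrow> circ (\<lambda>x. (\<xi> x)^2) t \<le> C * exp (- (43/20) * t)"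
proof -
  define t0 where "t0 = max 10 (ln R + 1)"
  have t0: "R < exp t" if "t \<ge> t0" for t
  proof -
    have "ln R < t" using that unfolding t0_def by simp
    then have "exp (ln R) < exp t" by simp
    then show ?thesis using R by simp
  qed
  have t0': "0 \<le> t" if "t \<ge> t0" for t using that unfolding t0_def by simp
  interpret D: decay_system Q Q1 Y Y1 Y2 A A1 X X1 X2 a t0 8 "1/100"
  proof
    show "10 \<le> t0" unfolding t0_def by simp
  qed ((rule dQ dY dY1 dA dX dX1 nonneg crude A_limit Q_growth Q_bound Y_growth Q_le A_growth X_growth | erule t0 t0' | assumption | simp)+)
  obtain C where "C \<ge> 0" "\<And>t. t \<ge> t0 \<Longrightarrow> X t \<le> C * exp (- (43/20) * t)" using D.X_decay by blast
  then show ?thesis using that[of C t0] t0[of t0] unfolding X_def by simp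
qed

end

section \<open>The logarithmic gradient of a solution\<close>

lemma inner_eq_Re_divide:
  fixes u z :: complex
  assumes "u \<noteq> 0"
  shows "u \<bullet> z = (norm u)^2 * Re (z / u)"
proof -
  define c where "c = z / u"
  have "z = c * u" unfolding c_def using assms by simp
  moreover have "u \<bullet> (c * u) = (norm u)^2 * Re c"
    unfolding inner_complex_def cmod_power2 by (simp add: power2_eq_square algebra_simps)
  ultimately show ?thesis unfolding c_def by simp
qed

context ginzburg_landau
begin

definition "w i x = pd i U x / U x"
text \<open>\<open>W i j\<close> is the derivative in direction \<open>i\<close> of
  \<open>w j\<close>, and \<open>T k i j\<close> is the derivative in direction \<open>k\<close> of
  \<open>W i j\<close>, both expanded by the quotient rule.\<close>

definition "W i j x = pd i (pd j U) x / U x - w i x * w j x"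
definition "T k i j x = pd k (pd i (pd j U)) x / U x
  - pd i (pd j U) x / U x * w k x - (w i x * W k j x + W k i x * w j x)"

lemma grad_w: "U x \<noteq> 0 \<Longrightarrow> has_grad (w j) (W 1 j x) (W 2 j x) x"
  unfolding w_def[abs_def] W_def
  by (rule has_grad_eq[OF has_grad_divide[OF grad(2) grad(1)]]) (auto simp: w_def power2_eq_square)

lemma grad_W: 
  assumes "U x \<noteq> 0"
  shows "has_grad (W i j) (T 1 i j x) (T 2 i j x) x"
proof -
  have "W i j = (\<lambda>x. pd i (pd j U) x / U x - w i x * w j x)"
    by (rule ext) (rule W_def)
  moreover have "has_grad (\<lambda>x. pd i (pd j U) x / U x - w i x * w j x) (T 1 i j x) (T 2 i j x) x"
    by (rule has_grad_eq[OF has_grad_diff[OF has_grad_divide[OF grad(3) grad(1)] has_grad_mult[OF grad_w grad_w]]])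
      (use assms in \<open>auto simp: T_def w_def power2_eq_square\<close>)
  ultimately show ?thesis by simp
qed

lemma W_symmetric: "W 2 1 = W 1 2"
  unfolding W_def[abs_def] by (simp add: mixed mult.commute)

lemma T_symmetric: "T 2 1 1 = T 1 1 2" "T 2 1 2 = T 1 2 2"
proof -
  have *: "D2 (D1 (D1 U)) = D1 (D1 (D2 U))" "D2 (D1 (D2 U)) = D1 (D2 (D2 U))"
    using mixed(2)[of 1] mixed(2)[of 2] mixed(1) by simp_all
  show "T 2 1 1 = T 1 1 2" "T 2 1 2 = T 1 2 2"
    unfolding T_def[abs_def] W_symmetric * unfolding W_def by (auto simp: mixed algebra_simps)
qed

text \<open>The equation divided by \<open>U\<close>. The squares are complex squares, so the
  imaginary part is the law for \<open>div v\<close> and the real part the law for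
  \<open>div s\<close>.\<close>

lemma div_w:
  assumes "U x \<noteq> 0"
  shows "W 1 1 x + W 2 2 x = - of_real (\<xi> x) - (w 1 x * w 1 x + w 2 x * w 2 x)"
proof -
  have "D1 (D1 U) x + D2 (D2 U) x = - (\<xi> x *\<^sub>R U x)"
    using fun_cong[OF Lap_U, of x] unfolding Lap_def .
  then have "(D1 (D1 U) x + D2 (D2 U) x) / U x = - of_real (\<xi> x)"
    using assms by (simp add: scaleR_conv_of_real)
  then have "D1 (D1 U) x / U x + D2 (D2 U) x / U x = - of_real (\<xi> x)" by (simp add: add_divide_distrib)
  then show ?thesis unfolding W_def by (simp add: algebra_simps)
qed

lemma U_inner:
  assumes "U x \<noteq> 0"
  shows "U x \<bullet> pd i U x = (1 - \<xi> x) * Re (w i x)"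
  using inner_eq_Re_divide[OF assms] unfolding w_def \<xi>_def by simp

text \<open>The gradient of \<open>div_w\<close>: as the Jacobian of \<open>w\<close> is symmetric,
  the gradient of the divergence is the Laplacian. The first term is minus the derivative of
  \<open>\<xi>\<close> and acts as the mass of the real part.\<close>

lemma Lap_w:
  assumes "U x \<noteq> 0"
  shows "T 1 1 1 x + T 1 2 2 x = of_real (2 * (1 - \<xi> x) * Re (w 1 x)) - 2 * (w 1 x * W 1 1 x + w 2 x * W 1 2 x)"
    "T 1 1 2 x + T 2 2 2 x = of_real (2 * (1 - \<xi> x) * Re (w 2 x)) - 2 * (w 1 x * W 1 2 x + w 2 x * W 2 2 x)"
proof -
  have d: "dLap i x / U x = of_real (2 * (1 - \<xi> x) * Re (w i x)) - of_real (\<xi> x) * w i x" for i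
    unfolding dLap_def U_inner[OF assms] w_def using assms
    by (simp add: scaleR_conv_of_real diff_divide_distrib)
  have L: "D1 (D1 U) x / U x + D2 (D2 U) x / U x = - of_real (\<xi> x)"
    using div_w[OF assms] unfolding W_def by (simp add: algebra_simps)
  have "D1 (D1 (D1 U)) x + D1 (D2 (D2 U)) x = dLap 1 x"
    using fun_cong[OF Lap_derivatives(1), of x] mixed(1) mixed(2)[of 2] unfolding Lap_def by simp
  then have 1: "D1 (D1 (D1 U)) x / U x + D1 (D2 (D2 U)) x / U x = dLap 1 x / U x"
    by (simp add: add_divide_distrib[symmetric])
  have "D1 (D1 (D2 U)) x + D2 (D2 (D2 U)) x = dLap 2 x"
    using fun_cong[OF Lap_derivatives(2), of x] unfolding Lap_def by simp
  then have 2: "D1 (D1 (D2 U)) x / U x + D2 (D2 (D2 U)) x / U x = dLap 2 x / U x"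
    by (simp add: add_divide_distrib[symmetric])
  have "T 1 1 1 x + T 1 2 2 x = (D1 (D1 (D1 U)) x / U x + D1 (D2 (D2 U)) x / U x)
     - (D1 (D1 U) x / U x + D2 (D2 U) x / U x) * w 1 x - 2 * (w 1 x * W 1 1 x + w 2 x * W 1 2 x)"
    unfolding T_def by (simp add: algebra_simps)
  then show "T 1 1 1 x + T 1 2 2 x = of_real (2 * (1 - \<xi> x) * Re (w 1 x)) - 2 * (w 1 x * W 1 1 x + w 2 x * W 1 2 x)"
    unfolding 1 L d by simp
  have "T 2 1 1 x + T 2 2 2 x = (D1 (D1 (D2 U)) x / U x + D2 (D2 (D2 U)) x / U x)
     - (D1 (D1 U) x / U x + D2 (D2 U) x / U x) * w 2 x - 2 * (w 1 x * W 2 1 x + w 2 x * W 2 2 x)"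
    unfolding T_def mixed(1)[symmetric] using mixed(2)[of 1] mixed(1) by (simp add: algebra_simps)
  then show "T 1 1 2 x + T 2 2 2 x = of_real (2 * (1 - \<xi> x) * Re (w 2 x)) - 2 * (w 1 x * W 1 2 x + w 2 x * W 2 2 x)"
    unfolding 2 L d T_symmetric W_symmetric by simp
qed

text \<open>Once \<open>|U|\<close> is at least 1/2, division by \<open>U\<close> costs a factor 2;
  hence 1/10000 for the derivatives gives 2/10000 for \<open>w\<close> and less than 1/1000 for
  \<open>W\<close>.\<close>

lemma eventually_small:
  "\<forall>\<^sub>F x in at_infinity. U x \<noteq> 0 \<and> \<bar>\<xi> x\<bar> \<le> 1/1000 \<and> norm (w 1 x) \<le> 1/1000 \<and> norm (w 2 x) \<le> 1/1000
    \<and> norm (W 1 1 x) \<le> 1/1000 \<and> norm (W 1 2 x) \<le> 1/1000 \<and> norm (W 2 2 x) \<le> 1/1000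
    \<and> (norm (w 1 x))^2 + (norm (w 2 x))^2 \<le> 4 * (grad_sq x)"
proof -
  have "\<forall>\<^sub>F x in at_infinity. \<bar>\<xi> x\<bar> < 1/1000"
    using tendstoD[OF \<xi>_tendsto, of "1/1000"] by simp
  moreover have "\<forall>\<^sub>F x in at_infinity. \<bar>grad_sq x\<bar> < (1/10000)^2"
    using tendstoD[OF gradient_tendsto_0, of "(1/10000)^2"] by simp
  moreover have "\<forall>\<^sub>F x in at_infinity. \<bar>hess_sq x\<bar> < (1/10000)^2"
    using tendstoD[OF second_gradient_tendsto_0, of "(1/10000)^2"] by simp
  ultimately show ?thesis
  proof eventually_elim
    case (elim x)
    have sq: "norm z \<le> 1/10000" if "z \<bullet> z \<le> (1/10000)^2" for z :: complex
      using that unfolding power2_norm_eq_inner[symmetric] by (rule power2_le_imp_le) simp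
    have n: "norm (D1 U x) \<le> 1/10000" "norm (D2 U x) \<le> 1/10000" 
        "norm (D1 (D1 U) x) \<le> 1/10000" "norm (D1 (D2 U) x) \<le> 1/10000" "norm (D2 (D2 U) x) \<le> 1/10000"
      using elim(2,3) inner_ge_zero[of "D1 U x"] inner_ge_zero[of "D2 U x"]
        inner_ge_zero[of "D1 (D1 U) x"] inner_ge_zero[of "D1 (D2 U) x"] inner_ge_zero[of "D2 (D1 U) x"] inner_ge_zero[of "D2 (D2 U) x"]
      by (intro sq, linarith)+
    have "(norm (U x))^2 \<ge> (1/2)^2"
    proof -
      have "(1/2)^2 = (1/4 :: real)" by (simp add: power2_eq_square)
      then show ?thesis using elim(1) unfolding \<xi>_def by linarith
    qed
    then have U: "norm (U x) \<ge> 1/2" by (rule power2_le_imp_le) simp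
    then have U0: "U x \<noteq> 0" by auto
    have div: "norm (z / U x) \<le> 2 * norm z" for z
    proof -
      have "norm z / norm (U x) \<le> norm z / (1/2)" using U by (intro divide_left_mono) auto
      then show ?thesis by (simp add: norm_divide)
    qed
    have w: "norm (w 1 x) \<le> 2/10000" "norm (w 2 x) \<le> 2/10000"
      unfolding w_def using div[of "D1 U x"] div[of "D2 U x"] n by linarith+
    have prod: "norm (a * b) \<le> 4/10000" if "norm a \<le> 2/10000" "norm b \<le> 2/10000" for a b :: complex
      using mult_mono[OF that] by (simp add: norm_mult)
    have W: "norm (W i j x) \<le> 1/1000" if "norm (pd i (pd j U) x) \<le> 1/10000" "norm (w i x) \<le> 2/10000" "norm (w j x) \<le> 2/10000" for i j
      unfolding W_def using norm_triangle_ineq4[of "pd i (pd j U) x / U x" "w i x * w j x"]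
        div[of "pd i (pd j U) x"] prod[OF that(2,3)] that(1) by linarith
    have sum: "(norm (w i x))^2 \<le> 4 * (pd i U x \<bullet> pd i U x)" for i
      using power_mono[OF div[of "pd i U x"], of 2] unfolding w_def
      by (simp add: power_mult_distrib power2_norm_eq_inner)
    show ?case
      using U0 elim(1) w W n sum[of 1] sum[of 2] by simp
  qed
qed

lemma continuous_pderivatives: "continuous_on S U" "continuous_on S (pd i U)" "continuous_on S (pd i (pd j U))"
    "continuous_on S (pd k (pd i (pd j U)))"
  by (rule continuous_on_subset[OF C_infinity_continuous], intro C_infinity_pderivative smooth, simp)+

lemma continuous_T: 
  assumes "\<And>x. x \<in> S \<Longrightarrow> U x \<noteq> 0"
  shows "continuous_on S (T k i j)"
  unfolding T_def[abs_def] W_def w_def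
  by (intro continuous_intros continuous_pderivatives) (use assms in auto)

lemma circle_decay:
  obtains C t0 where "C \<ge> 0" "\<And>t. t \<ge> t0 \<Longrightarrow> circ (\<lambda>x. (\<xi> x)^2) t \<le> C * exp (- (43/20) * t)"
proof -
  obtain b where b: "\<And>x. b \<le> norm x \<Longrightarrow> U x \<noteq> 0 \<and> \<bar>\<xi> x\<bar> \<le> 1/1000 \<and> norm (w 1 x) \<le> 1/1000 \<and> norm (w 2 x) \<le> 1/1000
    \<and> norm (W 1 1 x) \<le> 1/1000 \<and> norm (W 1 2 x) \<le> 1/1000 \<and> norm (W 2 2 x) \<le> 1/1000
    \<and> (norm (w 1 x))^2 + (norm (w 2 x))^2 \<le> 4 * (grad_sq x)"
    using eventually_small unfolding eventually_at_infinity by blast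
  define R where "R = max b 1"
  have R: "R > 0" unfolding R_def by simp
  have U0: "U x \<noteq> 0" if "x \<in> exterior R" for x using b[of x] that unfolding R_def by simp
  note small = abs_Re_le_cmod[THEN order_trans] abs_Im_le_cmod[THEN order_trans]
  have "exterior_fields R \<xi> (\<lambda>x. Re (w 1 x)) (\<lambda>x. Re (w 2 x)) (\<lambda>x. Im (w 1 x)) (\<lambda>x. Im (w 2 x))
    (\<lambda>x. Re (W 1 1 x)) (\<lambda>x. Re (W 1 2 x)) (\<lambda>x. Re (W 2 2 x))
    (\<lambda>x. Re (T 1 1 1 x)) (\<lambda>x. Re (T 1 1 2 x)) (\<lambda>x. Re (T 1 2 2 x)) (\<lambda>x. Re (T 2 2 2 x))
    (\<lambda>x. Im (W 1 1 x)) (\<lambda>x. Im (W 1 2 x)) (\<lambda>x. Im (W 2 2 x))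
    (\<lambda>x. Im (T 1 1 1 x)) (\<lambda>x. Im (T 1 1 2 x)) (\<lambda>x. Im (T 1 2 2 x)) (\<lambda>x. Im (T 2 2 2 x))"
  proof
    show "0 < R" by (rule R)
    fix x assume x: "x \<in> exterior R"
    note U = U0[OF x]
    note gw = grad_w[OF U, of 1] grad_w[OF U, of 2]
    note gW = grad_W[OF U, of 1 1] grad_W[OF U, of 1 2] grad_W[OF U, of 2 2]
    note g = gw[unfolded W_symmetric] gW[unfolded T_symmetric]
    note g[THEN has_grad_Re]
    then show "has_grad (\<lambda>x. Re (w 1 x)) (Re (W 1 1 x)) (Re (W 1 2 x)) x" "has_grad (\<lambda>x. Re (w 2 x)) (Re (W 1 2 x)) (Re (W 2 2 x)) x"
      "has_grad (\<lambda>x. Re (W 1 1 x)) (Re (T 1 1 1 x)) (Re (T 1 1 2 x)) x" "has_grad (\<lambda>x. Re (W 1 2 x)) (Re (T 1 1 2 x)) (Re (T 1 2 2 x)) x"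
      "has_grad (\<lambda>x. Re (W 2 2 x)) (Re (T 1 2 2 x)) (Re (T 2 2 2 x)) x"
      by blast+
    note g[THEN has_grad_Im]
    then show "has_grad (\<lambda>x. Im (w 1 x)) (Im (W 1 1 x)) (Im (W 1 2 x)) x" "has_grad (\<lambda>x. Im (w 2 x)) (Im (W 1 2 x)) (Im (W 2 2 x)) x"
      "has_grad (\<lambda>x. Im (W 1 1 x)) (Im (T 1 1 1 x)) (Im (T 1 1 2 x)) x" "has_grad (\<lambda>x. Im (W 1 2 x)) (Im (T 1 1 2 x)) (Im (T 1 2 2 x)) x"
      "has_grad (\<lambda>x. Im (W 2 2 x)) (Im (T 1 2 2 x)) (Im (T 2 2 2 x)) x"
      by blast+
    show "has_grad \<xi> (- 2 * (1 - \<xi> x) * Re (w 1 x)) (- 2 * (1 - \<xi> x) * Re (w 2 x)) x"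
      by (rule has_grad_eq[OF grad_\<xi>]) (simp_all add: U_inner[OF U] algebra_simps)
    note dw = div_w[OF U]
    show "Im (W 1 1 x) + Im (W 2 2 x) = - 2 * (Re (w 1 x) * Im (w 1 x) + Re (w 2 x) * Im (w 2 x))"
      using arg_cong[OF dw, of Im] by simp
    show "Re (W 1 1 x) + Re (W 2 2 x) = - \<xi> x - ((Re (w 1 x))\<^sup>2 + (Re (w 2 x))\<^sup>2) + ((Im (w 1 x))\<^sup>2 + (Im (w 2 x))\<^sup>2)"
      using arg_cong[OF dw, of Re] by (simp add: power2_eq_square)
    show "Re (T 1 1 1 x) + Re (T 1 2 2 x) = 2 * (1 - \<xi> x) * Re (w 1 x) - 2 * (Re (w 1 x) * Re (W 1 1 x) + Re (w 2 x) * Re (W 1 2 x))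
       + 2 * (Im (w 1 x) * Im (W 1 1 x) + Im (w 2 x) * Im (W 1 2 x))"
      using arg_cong[OF Lap_w(1)[OF U], of Re] by simp
    show "Re (T 1 1 2 x) + Re (T 2 2 2 x) = 2 * (1 - \<xi> x) * Re (w 2 x) - 2 * (Re (w 1 x) * Re (W 1 2 x) + Re (w 2 x) * Re (W 2 2 x))
       + 2 * (Im (w 1 x) * Im (W 1 2 x) + Im (w 2 x) * Im (W 2 2 x))"
      using arg_cong[OF Lap_w(2)[OF U], of Re] by simp
    have bx: "b \<le> norm x" using x unfolding R_def by simp
    note bb = b[OF bx]
    show "\<bar>\<xi> x\<bar> \<le> 1/1000" using bb by blast
    show "\<bar>Re (w 1 x)\<bar> \<le> 1/1000" "\<bar>Re (w 2 x)\<bar> \<le> 1/1000" "\<bar>Im (w 1 x)\<bar> \<le> 1/1000" "\<bar>Im (w 2 x)\<bar> \<le> 1/1000"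
      "\<bar>Re (W 1 1 x)\<bar> \<le> 1/1000" "\<bar>Re (W 1 2 x)\<bar> \<le> 1/1000" "\<bar>Re (W 2 2 x)\<bar> \<le> 1/1000"
      "\<bar>Im (W 1 1 x)\<bar> \<le> 1/1000" "\<bar>Im (W 1 2 x)\<bar> \<le> 1/1000" "\<bar>Im (W 2 2 x)\<bar> \<le> 1/1000"
      by (rule small, use bb in blast)+
  next
    have cT: "continuous_on (exterior R) (T k i j)" for k i j using U0 by (rule continuous_T)
    show "continuous_on (exterior R) (\<lambda>x. Re (T 1 1 1 x))" "continuous_on (exterior R) (\<lambda>x. Re (T 1 1 2 x))"
      "continuous_on (exterior R) (\<lambda>x. Re (T 1 2 2 x))" "continuous_on (exterior R) (\<lambda>x. Re (T 2 2 2 x))"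
      "continuous_on (exterior R) (\<lambda>x. Im (T 1 1 1 x))" "continuous_on (exterior R) (\<lambda>x. Im (T 1 1 2 x))"
      "continuous_on (exterior R) (\<lambda>x. Im (T 1 2 2 x))" "continuous_on (exterior R) (\<lambda>x. Im (T 2 2 2 x))"
      by (intro continuous_intros cT)+
    show "((\<lambda>x. (Im (w 1 x))\<^sup>2 + (Im (w 2 x))\<^sup>2) \<longlongrightarrow> 0) at_infinity"
    proof (rule Lim_null_comparison)
      show "((\<lambda>x. 4 * (grad_sq x)) \<longlongrightarrow> 0) at_infinity"
        by (rule tendsto_mult_right_zero[OF gradient_tendsto_0])
      show "\<forall>\<^sub>F x in at_infinity. norm ((Im (w 1 x))\<^sup>2 + (Im (w 2 x))\<^sup>2) \<le> 4 * (grad_sq x)"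
        using eventually_small
      proof eventually_elim
        case (elim x)
        have "(Im z)^2 \<le> (norm z)^2" for z
          using abs_Im_le_cmod[of z] by (simp add: abs_le_square_iff[symmetric])
        from add_mono[OF this[of "w 1 x"] this[of "w 2 x"]] show ?case using elim by simp
      qed
    qed
  qed
  from exterior_fields.potential_decay[OF this] that show ?thesis by blast
qed

end

section \<open>Integration over the plane\<close>

definition rot :: "real \<Rightarrow> real ^ 2 \<Rightarrow> real ^ 2"
  where "rot \<theta> x = vector [cos \<theta> * x $ 1 - sin \<theta> * x $ 2, sin \<theta> * x $ 1 + cos \<theta> * x $ 2]"

lemma rot_nth [simp]: "rot \<theta> x $ 1 = cos \<theta> * x $ 1 - sin \<theta> * x $ 2" "rot \<theta> x $ 2 = sin \<theta> * x $ 1 + cos \<theta> * x $ 2"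
  unfolding rot_def by simp_all

lemma rot_pol: "rot \<theta> (pol t \<alpha>) = pol t (\<theta> + \<alpha>)"
  by (simp add: vec_eq_iff forall_2 cos_add sin_add algebra_simps)

lemma rot_eq: "rot \<theta> x = (cos \<theta> * x $ 1 - sin \<theta> * x $ 2) *\<^sub>R axis 1 1 + (sin \<theta> * x $ 1 + cos \<theta> * x $ 2) *\<^sub>R axis 2 1"
  by (simp add: vec_eq_iff forall_2 axis_def)

lemma continuous_on_rot: "continuous_on S (\<lambda>z. rot (fst z) (snd z))"
  unfolding rot_eq by (intro continuous_intros)

lemma norm_rot [simp]: "norm (rot \<theta> x) = norm x"
proof -
  have "(c * a - s * b)^2 + (s * a + c * b)^2 = (c^2 + s^2) * (a^2 + b^2)" for a b c s :: real
    by (simp add: power2_eq_square algebra_simps)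
  then have "(norm (rot \<theta> x))^2 = ((cos \<theta>)^2 + (sin \<theta>)^2) * (norm x)^2"
    unfolding norm_real2 rot_nth .
  then have "(norm (rot \<theta> x))^2 = (norm x)^2" by simp
  then show ?thesis by (rule power2_eq_imp_eq) auto
qed

lemma orthogonal_rot: "orthogonal_transformation (rot \<theta>)"
  unfolding orthogonal_transformation
proof (intro conjI allI)
  show "linear (rot \<theta>)"
    by (rule linearI) (simp_all add: vec_eq_iff forall_2 algebra_simps)
qed simp

lemma rot_inverse: "rot \<theta> -` S = rot (- \<theta>) ` S"
proof -
  have 1: "rot \<theta> (rot (- \<theta>) x) = x" for \<theta> x
  proof -
    have "(cos \<theta>)^2 * a + (sin \<theta>)^2 * a = a" for a :: real
      unfolding distrib_right[symmetric] by simp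
    then have "cos \<theta> * (cos \<theta> * a) + sin \<theta> * (sin \<theta> * a) = a" "sin \<theta> * (sin \<theta> * a) + cos \<theta> * (cos \<theta> * a) = a" for a :: real
      by (simp_all add: power2_eq_square mult.assoc add.commute)
    then show ?thesis by (simp add: vec_eq_iff forall_2 right_diff_distrib distrib_left mult.left_commute)
  qed
  have 2: "rot (- \<theta>) (rot \<theta> x) = x" for x using 1[of "- \<theta>" x] by simp
  show ?thesis
  proof (intro set_eqI iffI)
    fix x assume "x \<in> rot \<theta> -` S"
    then show "x \<in> rot (- \<theta>) ` S" using 2[of x] by (metis image_eqI vimageD)
  next
    fix x assume "x \<in> rot (- \<theta>) ` S"
    then show "x \<in> rot \<theta> -` S" using 1 by auto
  qed
qed

lemma borel_rot: "rot \<theta> \<in> borel_measurable borel"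
  using continuous_on_compose2[OF continuous_on_rot[of UNIV], of UNIV "\<lambda>x. (\<theta>, x)"]
  by (intro borel_measurable_continuous_onI) (simp add: continuous_intros)

lemma lborel_rot: "distr lborel borel (rot \<theta>) = lborel"
proof (rule lborel_eqI[symmetric])
  fix l u :: "real ^ 2" assume lu: "\<And>b. b \<in> Basis \<Longrightarrow> l \<bullet> b \<le> u \<bullet> b"
  have "emeasure (distr lborel borel (rot \<theta>)) (box l u) = emeasure lborel (rot \<theta> -` box l u)"
    using borel_rot[of \<theta>] by (simp add: emeasure_distr)
  also have "\<dots> = emeasure lebesgue (rot (- \<theta>) ` box l u)"
  proof -
    have "rot \<theta> -` box l u \<in> sets borel" using measurable_sets_borel[OF borel_rot[of \<theta>], of "box l u"] by simp
    then show ?thesis unfolding rot_inverse by simp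
  qed
  also have "\<dots> = ennreal (measure lebesgue (rot (- \<theta>) ` box l u))"
    by (rule emeasure_eq_measure2[OF measurable_orthogonal_image[OF orthogonal_rot lmeasurable_box]])
  also have "measure lebesgue (rot (- \<theta>) ` box l u) = measure lebesgue (box l u)"
    by (rule measure_orthogonal_image[OF orthogonal_rot lmeasurable_box])
  also have "ennreal (measure lebesgue (box l u)) = emeasure lborel (box l u)"
    by (simp add: emeasure_lborel_box_eq measure_lborel_box_eq prod_nonneg inner_diff_left lu)
  also have "\<dots> = (\<Prod>b\<in>Basis. (u - l) \<bullet> b)" using lu by (rule emeasure_lborel_box)
  finally show "emeasure (distr lborel borel (rot \<theta>)) (box l u) = (\<Prod>b\<in>Basis. (u - l) \<bullet> b)" .
qed simp

lemma nn_integral_rot: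
  assumes "h \<in> borel_measurable borel"
  shows "(\<integral>\<^sup>+ x. h (rot \<theta> x) \<partial>lborel) = (\<integral>\<^sup>+ x. h x \<partial>lborel)"
proof -
  have "(\<integral>\<^sup>+ x. h x \<partial>lborel) = (\<integral>\<^sup>+ x. h x \<partial>distr lborel borel (rot \<theta>))" by (simp only: lborel_rot)
  also have "\<dots> = (\<integral>\<^sup>+ x. h (rot \<theta> x) \<partial>lborel)"
    using borel_rot assms by (intro nn_integral_distr) auto
  finally show ?thesis ..
qed

text \<open>The orbit of \<open>x\<close> under \<open>rot\<close> starts at the angle of
  \<open>x\<close>, and periodicity removes this shift.\<close>

lemma nn_integral_circle:
  assumes g: "continuous_on UNIV g" "\<And>x. 0 \<le> g x" and x: "x \<noteq> 0"
  shows "(\<integral>\<^sup>+ \<theta>. indicator {0..2 * pi} \<theta> * ennreal (g (rot \<theta> x)) \<partial>lborel) = ennreal (circ g (ln (norm x)))"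
proof -
  define t where "t = ln (norm x)"
  have n: "norm x = exp t" unfolding t_def using x by simp
  obtain \<alpha> where a: "0 \<le> \<alpha>" "\<alpha> < 2 * pi" and xa: "x = pol t \<alpha>" by (rule polar_coordinates[OF n])
  define k where "k \<theta> = g (pol t \<theta>)" for \<theta>
  have ck: "continuous_on S k" for S
    unfolding k_def by (intro continuous_on_compose2[OF g(1)] continuous_on_pol continuous_intros) auto
  have "integral {0..2 * pi} (\<lambda>\<theta>. k (\<theta> + \<alpha>)) = integral {\<alpha>..\<alpha> + 2 * pi} k"
    using integral_shift_Icc_real[of 0 "2 * pi" k \<alpha>] by (simp add: o_def add.commute)
  also have "\<dots> = integral {0..2 * pi} k"
    by (rule integral_periodic[OF ck]) (use a in \<open>auto simp: k_def\<close>)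
  finally have I: "integral {0..2 * pi} (\<lambda>\<theta>. k (\<theta> + \<alpha>)) = circ g t" unfolding circ_def k_def .
  have "((\<lambda>\<theta>. k (\<theta> + \<alpha>)) has_integral circ g t) {0..2 * pi}"
    unfolding I[symmetric]
    by (intro integrable_integral integrable_continuous_real continuous_on_compose2[OF ck] continuous_intros) auto
  then have "(\<integral>\<^sup>+ \<theta>. indicator {0..2 * pi} \<theta> * ennreal (k (\<theta> + \<alpha>)) \<partial>lborel) = ennreal (circ g t)"
    using nn_integral_has_integral_lebesgue[of "{0..2 * pi}" "\<lambda>\<theta>. k (\<theta> + \<alpha>)" "circ g t"] g(2)
    unfolding k_def by (simp add: ennreal_mult' ennreal_indicator)
  then have *: "(\<integral>\<^sup>+ \<theta>. indicator {0..2 * pi} \<theta> * ennreal (g (pol t (\<theta> + \<alpha>))) \<partial>lborel) = ennreal (circ g t)"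
    unfolding k_def .
  have rx: "rot \<theta> x = pol t (\<theta> + \<alpha>)" for \<theta> by (subst xa) (rule rot_pol)
  show ?thesis unfolding rx t_def[symmetric] by (rule *)
qed

text \<open>Averaging over rotations takes the place of a change of variables: the integral of
  \<open>g\<close> is unchanged by \<open>rot \<theta>\<close>, so integrating over
  \<open>\<theta>\<close> and exchanging the integrals replaces \<open>g x\<close> by its integral
  over the circle through \<open>x\<close>. No Jacobian appears.\<close>

lemma nn_integral_polar_bound:
  assumes g: "continuous_on UNIV g" "\<And>x. 0 \<le> g x" and R: "0 < R"
  shows "ennreal (2 * pi) * (\<integral>\<^sup>+ x. indicator (exterior R) x * ennreal (g x) \<partial>lborel)
    = (\<integral>\<^sup>+ x. indicator (exterior R) x * ennreal (circ g (ln (norm x))) \<partial>lborel)"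
proof -
  define h where "h x = indicator (exterior R) x * ennreal (g x)" for x
  have gb: "g \<in> borel_measurable borel" by (rule borel_measurable_continuous_onI[OF g(1)])
  have eb: "exterior R \<in> sets borel" using open_exterior by auto
  have hb: "h \<in> borel_measurable borel" unfolding h_def using gb eb by measurable
  have "continuous_on UNIV (\<lambda>z. rot (snd z) (fst z))"
    unfolding rot_eq by (intro continuous_intros)
  then have rb': "(\<lambda>z. rot (snd z) (fst z)) \<in> borel_measurable (borel \<Otimes>\<^sub>M borel)"
    using borel_measurable_continuous_onI by (simp add: borel_prod)
  have "ennreal (2 * pi) * (\<integral>\<^sup>+ x. h x \<partial>lborel) = (\<integral>\<^sup>+ \<theta>. indicator {0..2 * pi} \<theta> * (\<integral>\<^sup>+ x. h x \<partial>lborel) \<partial>lborel)"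
    by (subst nn_integral_multc) (auto)
  also have "\<dots> = (\<integral>\<^sup>+ \<theta>. (\<integral>\<^sup>+ x. indicator {0..2 * pi} \<theta> * h (rot \<theta> x) \<partial>lborel) \<partial>lborel)"
  proof (rule nn_integral_cong)
    fix \<theta> :: real
    have "(\<lambda>x. h (rot \<theta> x)) \<in> borel_measurable lborel"
      using measurable_compose[OF borel_rot hb] by simp
    then show "indicator {0..2 * pi} \<theta> * (\<integral>\<^sup>+ x. h x \<partial>lborel) = (\<integral>\<^sup>+ x. indicator {0..2 * pi} \<theta> * h (rot \<theta> x) \<partial>lborel)"
      by (simp add: nn_integral_cmult nn_integral_rot[OF hb])
  qed
  also have "\<dots> = (\<integral>\<^sup>+ x. (\<integral>\<^sup>+ \<theta>. indicator {0..2 * pi} \<theta> * h (rot \<theta> x) \<partial>lborel) \<partial>lborel)"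
  proof (rule pair_sigma_finite.Fubini')
    show "pair_sigma_finite lborel lborel"
      by (intro pair_sigma_finite.intro sigma_finite_lborel)
    have "(\<lambda>z. indicator {0..2 * pi} (snd z) * h (rot (snd z) (fst z))) \<in> borel_measurable (borel \<Otimes>\<^sub>M borel)"
      using hb rb' by measurable
    then show "(\<lambda>(x, \<theta>). indicator {0..2 * pi} \<theta> * h (rot \<theta> x)) \<in> borel_measurable (lborel \<Otimes>\<^sub>M lborel)"
      by (simp add: split_beta')
  qed
  also have "\<dots> = (\<integral>\<^sup>+ x. indicator (exterior R) x * ennreal (circ g (ln (norm x))) \<partial>lborel)"
  proof (rule nn_integral_cong)
    fix x :: "real ^ 2"
    show "(\<integral>\<^sup>+ \<theta>. indicator {0..2 * pi} \<theta> * h (rot \<theta> x) \<partial>lborel) = indicator (exterior R) x * ennreal (circ g (ln (norm x)))"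
    proof (cases "x \<in> exterior R")
      case True
      then have "x \<noteq> 0" using R by auto
      from nn_integral_circle[OF g this] True show ?thesis unfolding h_def by simp
    qed (simp add: h_def)
  qed
  finally show ?thesis unfolding h_def .
qed

text \<open>The integrand is \<open>|x|\<close> to the power \<open>- p\<close>. On the dyadic
  annulus with inner radius \<open>2^n\<close> it is at most \<open>2^(- p n)\<close>, and the
  enclosing disc has area \<open>4 * V * 4^n\<close>, so the ratio of the geometric series is
  \<open>2^(2 - p)\<close>.\<close>

lemma nn_integral_inverse_power:
  assumes p: "p > 2"
  shows "(\<integral>\<^sup>+ x. indicator (exterior 1) x * ennreal (exp (- p * ln (norm (x :: real ^ 2)))) \<partial>lborel) < \<infinity>"
proof -
  define V where "V = unit_ball_vol 2"
  define q where "q = exp ((2 - p) * ln 2)"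
  have q: "0 \<le> q" "q < 1" unfolding q_def using p by (auto simp: mult_less_0_iff)
  define B where "B n = cball (0 :: real ^ 2) (2 ^ Suc n)" for n
  have "(\<integral>\<^sup>+ x. indicator (exterior 1) x * ennreal (exp (- p * ln (norm (x :: real ^ 2)))) \<partial>lborel)
    \<le> (\<integral>\<^sup>+ x. (\<Sum>n. ennreal (exp (- p * (real n * ln 2))) * indicator (B n) x) \<partial>lborel)"
  proof (rule nn_integral_mono)
    fix x :: "real ^ 2"
    show "indicator (exterior 1) x * ennreal (exp (- p * ln (norm x))) \<le> (\<Sum>n. ennreal (exp (- p * (real n * ln 2))) * indicator (B n) x)"
    proof (cases "x \<in> exterior 1")
      case True
      then have n0: "0 < ln (norm x)" by (intro ln_gt_zero) simp
      define n where "n = nat \<lfloor>ln (norm x) / ln 2\<rfloor>"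
      have n: "real n \<le> ln (norm x) / ln 2" "ln (norm x) / ln 2 < real n + 1"
        unfolding n_def using n0 by (auto simp: of_nat_nat floor_le_iff)
      have n1: "real n * ln 2 \<le> ln (norm x)" "ln (norm x) < (real n + 1) * ln 2" using n by (auto simp: field_simps)
      have "0 < norm x" using True by (auto intro: less_trans[of 0 1])
      then have "norm x = exp (ln (norm x))" by (simp only: exp_ln)
      also have "\<dots> \<le> exp (real (Suc n) * ln 2)" using n1(2) by (simp add: add.commute)
      also have "\<dots> = 2 ^ Suc n" by (subst exp_of_nat_mult) simp
      finally have xB: "x \<in> B n" unfolding B_def by simp
      have "indicator (exterior 1) x * ennreal (exp (- p * ln (norm x))) \<le> ennreal (exp (- p * (real n * ln 2))) * indicator (B n) x"
        using True xB p n1(1) by (auto intro!: ennreal_leI mult_left_mono)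
      also have "\<dots> \<le> (\<Sum>n. ennreal (exp (- p * (real n * ln 2))) * indicator (B n) x)"
      proof -
        have "f n \<le> suminf f" for f :: "nat \<Rightarrow> ennreal"
          using sum_le_suminf[of f "{n}"] by simp
        then show ?thesis .
      qed
      finally show ?thesis .
    qed simp
  qed
  also have "\<dots> = (\<Sum>n. \<integral>\<^sup>+ x. ennreal (exp (- p * (real n * ln 2))) * indicator (B n) x \<partial>lborel)"
  proof -
    have [measurable]: "B n \<in> sets borel" for n unfolding B_def by simp
    show ?thesis by (rule nn_integral_suminf) measurable
  qed
  also have "\<dots> = (\<Sum>n. ennreal (4 * V * q ^ n))"
  proof (rule suminf_cong)
    fix n
    have "(\<integral>\<^sup>+ x. ennreal (exp (- p * (real n * ln 2))) * indicator (B n) x \<partial>lborel)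
      = ennreal (exp (- p * (real n * ln 2))) * emeasure lborel (B n)"
      by (rule nn_integral_cmult_indicator) (simp add: B_def)
    also have "emeasure lborel (B n) = ennreal (V * (2 ^ Suc n) ^ 2)"
      unfolding B_def V_def by (subst emeasure_cball) auto
    also have "ennreal (exp (- p * (real n * ln 2))) * ennreal (V * (2 ^ Suc n) ^ 2) = ennreal (exp (- p * (real n * ln 2)) * (V * (2 ^ Suc n) ^ 2))"
      by (rule ennreal_mult[symmetric]) (auto simp: V_def)
    also have "exp (- p * (real n * ln 2)) * (V * (2 ^ Suc n) ^ 2) = 4 * V * q ^ n"
    proof -
      have "(2::real) ^ n = exp (real n * ln 2)" by (subst exp_of_nat_mult) simp
      moreover have "q ^ n = exp (real n * ((2 - p) * ln 2))" unfolding q_def by (subst exp_of_nat_mult) simp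
      ultimately show ?thesis
        by (simp add: power2_eq_square exp_add[symmetric] mult_ac algebra_simps)
    qed
    finally show "(\<integral>\<^sup>+ x. ennreal (exp (- p * (real n * ln 2))) * indicator (B n) x \<partial>lborel) = ennreal (4 * V * q ^ n)" .
  qed
  also have "\<dots> = ennreal (\<Sum>n. 4 * V * q ^ n)"
    using q by (intro suminf_ennreal2 summable_mult summable_geometric) (auto simp: V_def)
  also have "\<dots> < \<infinity>" by simp
  finally show ?thesis .
qed

lemma nn_integral_finite_of_circle_decay:
  assumes g: "continuous_on UNIV g" "\<And>x. 0 \<le> g x" and p: "p > 2"
    and C: "0 \<le> C" "\<And>t. t \<ge> t0 \<Longrightarrow> circ g t \<le> C * exp (- p * t)"
  shows "(\<integral>\<^sup>+ x. ennreal (g x) \<partial>lborel) < \<infinity>"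
proof -
  define R where "R = exp (max t0 0)"
  have R: "1 \<le> R" unfolding R_def by simp
  have gb: "g \<in> borel_measurable borel" by (rule borel_measurable_continuous_onI[OF g(1)])
  have eb: "exterior R \<in> sets borel" using open_exterior by auto
  have "ennreal (2 * pi) * (\<integral>\<^sup>+ x. indicator (exterior R) x * ennreal (g x) \<partial>lborel)
    = (\<integral>\<^sup>+ x. indicator (exterior R) x * ennreal (circ g (ln (norm x))) \<partial>lborel)"
    using R by (intro nn_integral_polar_bound g) auto
  also have "\<dots> \<le> (\<integral>\<^sup>+ x. ennreal C * (indicator (exterior 1) x * ennreal (exp (- p * ln (norm x)))) \<partial>lborel)"
  proof (rule nn_integral_mono)
    fix x :: "real ^ 2"
    show "indicator (exterior R) x * ennreal (circ g (ln (norm x))) \<le> ennreal C * (indicator (exterior 1) x * ennreal (exp (- p * ln (norm x))))"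
    proof (cases "x \<in> exterior R")
      case True
      then have x1: "x \<in> exterior 1" using R by simp
      have "max t0 0 < ln (norm x)"
      proof -
        have "0 < norm x" using x1 by (auto intro: less_trans[of 0 1])
        then have "ln R < ln (norm x)" using True R by (subst ln_less_cancel_iff) auto
        then show ?thesis unfolding R_def by simp
      qed
      then have "t0 \<le> ln (norm x)" by simp
      from C(2)[OF this] show ?thesis
        using True x1 C(1) by (simp add: ennreal_mult[symmetric] ennreal_leI)
    qed simp
  qed
  also have "\<dots> = ennreal C * (\<integral>\<^sup>+ x. indicator (exterior 1) x * ennreal (exp (- p * ln (norm (x :: real ^ 2)))) \<partial>lborel)"
    by (rule nn_integral_cmult) (use open_exterior[of 1] in measurable)
  also have "\<dots> < \<infinity>" using nn_integral_inverse_power[OF p] by (simp add: ennreal_mult_less_top)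
  finally have "ennreal (2 * pi) * (\<integral>\<^sup>+ x. indicator (exterior R) x * ennreal (g x) \<partial>lborel) < \<infinity>" .
  then have far: "(\<integral>\<^sup>+ x. indicator (exterior R) x * ennreal (g x) \<partial>lborel) < \<infinity>"
    by (auto simp: ennreal_mult_less_top)
  have "compact (g ` cball 0 R)" by (intro compact_continuous_image continuous_on_subset[OF g(1)]) auto
  then have "bounded (g ` cball 0 R)" by (rule compact_imp_bounded)
  then obtain K where "\<forall>y\<in>g ` cball 0 R. norm y \<le> K" unfolding bounded_iff by blast
  then have K: "g x \<le> K" if "x \<in> cball 0 R" for x using that abs_le_D1[of "g x" K] by auto
  have "(\<integral>\<^sup>+ x. ennreal (g x) \<partial>lborel) \<le> (\<integral>\<^sup>+ x. ennreal K * indicator (cball (0 :: real ^ 2) R) x + indicator (exterior R) x * ennreal (g x) \<partial>lborel)"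
  proof (rule nn_integral_mono)
    fix x :: "real ^ 2"
    show "ennreal (g x) \<le> ennreal K * indicator (cball (0 :: real ^ 2) R) x + indicator (exterior R) x * ennreal (g x)"
      using K[of x] by (cases "norm x \<le> R") (auto simp: ennreal_leI)
  qed
  also have "\<dots> = (\<integral>\<^sup>+ x. ennreal K * indicator (cball (0 :: real ^ 2) R) x \<partial>lborel) + (\<integral>\<^sup>+ x. indicator (exterior R) x * ennreal (g x) \<partial>lborel)"
    by (rule nn_integral_add)
      (use gb eb in \<open>auto intro!: borel_measurable_times_ennreal borel_measurable_indicator\<close>)
  also have "(\<integral>\<^sup>+ x. ennreal K * indicator (cball (0 :: real ^ 2) R) x \<partial>lborel) = ennreal K * emeasure lborel (cball (0 :: real ^ 2) R)"
    by (rule nn_integral_cmult_indicator) simp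
  finally show ?thesis using far emeasure_lborel_cball_finite[of "0 :: real ^ 2" R]
    by (auto simp: ennreal_mult_less_top intro: le_less_trans)
qed

section \<open>The potential energy is finite\<close>

lemma norm_complex_pair: "norm (Complex (v $ 1) (v $ 2)) = norm (v :: real ^ 2)"
  unfolding complex_norm norm_vec_def L2_set_def by (simp add: sum_2)

lemma bounded_linear_complex_pair: "bounded_linear (\<lambda>v :: real ^ 2. Complex (v $ 1) (v $ 2))"
proof (rule bounded_linear_intro[where K = 1])
  fix v :: "real ^ 2"
  show "norm (Complex (v $ 1) (v $ 2)) \<le> norm v * 1" by (simp add: norm_complex_pair)
qed (simp_all add: complex_eq_iff)

theorem theorem1p1:
  fixes u :: "real ^ 2 \<Rightarrow> real ^ 2"
  assumes "C_infinity u"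
    and "\<And>x. - vec_laplacian u x = (1 - (norm (u x))\<^sup>2) *\<^sub>R u x"
    and "((\<lambda>x. norm (u x)) \<longlongrightarrow> 1) at_infinity"
  shows "(\<integral>\<^sup>+ x. ennreal ((1 - (norm (u x))\<^sup>2)\<^sup>2) \<partial>lborel) < \<infinity>"
proof -
  \<comment> \<open>The target plane is identified with the complex numbers so that the quotient of
    the gradient by the map makes sense.\<close>
  define U where "U x = Complex (u x $ 1) (u x $ 2)" for x
  have nU: "norm (U x) = norm (u x)" for x unfolding U_def by (rule norm_complex_pair)
  have smooth: "C_infinity U"
    unfolding U_def using C_infinity_bounded_linear[OF bounded_linear_complex_pair assms(1)] .
  have component: "L (Lap f x) = laplacian (\<lambda>y. L (f y)) x"
    if "C_infinity f" "bounded_linear L" for f :: "real ^ 2 \<Rightarrow> 'b::real_normed_vector" and L x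
  proof -
    have p: "pd i (\<lambda>y. L (h y)) = (\<lambda>y. L (pd i h y))" if "C_infinity h" for h :: "real ^ 2 \<Rightarrow> 'b" and i
      using pderivative_bounded_linear[OF \<open>bounded_linear L\<close> C_infinity_differentiable[OF that]] by (rule ext)
    have "laplacian (\<lambda>y. L (f y)) x = L (D1 (D1 f) x) + L (D2 (D2 f) x)"
      unfolding laplacian_def sum_2 by (simp add: p that C_infinity_pderivative)
    then show ?thesis unfolding Lap_def
      using linear_add[OF bounded_linear.linear[OF that(2)]] by simp
  qed
  have equation: "Lap U x = - ((1 - (norm (U x))\<^sup>2) *\<^sub>R U x)" for x
  proof -
    have v: "vec_laplacian u x = - ((1 - (norm (u x))\<^sup>2) *\<^sub>R u x)"
      using assms(2)[of x] by (metis minus_minus)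
    have "Re (Lap U x) = vec_laplacian u x $ 1" "Im (Lap U x) = vec_laplacian u x $ 2"
      using component[OF smooth bounded_linear_Re, of x] component[OF smooth bounded_linear_Im, of x]
      unfolding vec_laplacian_def U_def by simp_all
    then show ?thesis unfolding nU v by (simp add: complex_eq_iff U_def)
  qed
  interpret ginzburg_landau U
    by unfold_locales (use smooth equation assms(3) nU in auto)
  obtain C t0 where C: "C \<ge> 0" "\<And>t. t \<ge> t0 \<Longrightarrow> circ (\<lambda>x. (\<xi> x)^2) t \<le> C * exp (- (43/20) * t)"
    using circle_decay by blast
  have "continuous_on UNIV (\<lambda>x. (\<xi> x)^2)"
    unfolding \<xi>_def by (intro continuous_intros continuous_pderivatives)
  \<comment> \<open>The rate 43/20 exceeds 2, the dimension of the plane.\<close>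
  from nn_integral_finite_of_circle_decay[OF this _ _ C]
  have "(\<integral>\<^sup>+ x. ennreal ((\<xi> x)^2) \<partial>lborel) < \<infinity>" by simp
  then show ?thesis unfolding \<xi>_def nU .
qed

end
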